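(* Let $b \in L^1_{loc}[0,\infty)$ be real-valued and suppose that $$b(x) = \frac{-1+\epsilon(x)}{x} + \eta(x), \qquad x \ge 1,$$ where $\lim_{x\to\infty}\epsilon(x) = 0$ and $\eta \in L^1_{loc}[0,\infty)$ is such that the limit $A := \lim_{x\to\infty}\int_1^x \eta(u)\,du$ exists in $\mathbf{R}$ (this is the case $\rho = 0$). Put $$W(x) := \exp\left(\int_1^x b(u)\,du\right), \qquad m(x) := 2\int_0^x W(u)\,du,$$ and let $p(t;x,y)$ be the transition probability density, with respect to the speed measure $m(dx) = 2W(x)\,dx$, of the diffusion process on $[0,\infty)$ with generator $$\mathcal{L} = \frac12\left(\frac{d^2}{dx^2} + b(x)\frac{d}{dx}\right)$$ and reflecting boundary condition at $0$. If $m_\infty := \lim_{x\to\infty} m(x) = \infty$, then for all $x, y \in [0,\infty)$, $$p(t;x,y) \sim \frac{1}{m(\sqrt{t})}, \qquad t \to \infty.$$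
   Context: Notation: $f \sim g$ means $\lim f/g = 1$. $L^1_{loc}[0,\infty)$ denotes functions integrable on every bounded interval $[0,R]$, so the left boundary $0$ is regular, and the reflecting boundary condition is imposed there. With $s(x) = \int_c^x \frac{du}{W(u)}$ the scale function, the generator has the canonical form $\mathcal{L} = \frac{d}{dm(x)}\frac{d}{ds(x)}$. The transition density $p(t;x,y)$ is taken with respect to $m(dx)$, i.e. $P_x(X_t \in dy) = p(t;x,y)\,m(dy)$, in its continuous version in $(x,y)$. It satisfies $p(t;0,0) = \int_{[0,\infty)} e^{-\lambda t}\,d\sigma(\lambda)$ for $t>0$, where $\sigma$ is the spectral function of the diffusion. *)

theory Defs
  imports "HOL-Probability.Probability" "HOL-Library.Landau_Symbols"
begin

definition L1_loc :: "(real \<Rightarrow> real) \<Rightarrow> bool" where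
  "L1_loc f \<longleftrightarrow> (\<forall>R\<ge>0. set_integrable lebesgue {0..R} f)"

text \<open>The integrals below are oriented, e.g. the integral from \<open>1\<close> to \<open>x\<close> is minus the
  integral over \<open>[x, 1]\<close> when \<open>x < 1\<close>. The functions are only meaningful on \<open>[0, \<infinity>)\<close>.\<close>

definition W :: "(real \<Rightarrow> real) \<Rightarrow> real \<Rightarrow> real" where
  "W b x = exp (LINT u=1..x|lebesgue. b u)"

definition speed :: "(real \<Rightarrow> real) \<Rightarrow> real \<Rightarrow> real" where
  "speed b x = 2 * (LINT u=0..x|lebesgue. W b u)"

text \<open>The base point of the scale function is irrelevant, as only its increments are used.\<close>

definition scale :: "(real \<Rightarrow> real) \<Rightarrow> real \<Rightarrow> real" where
  "scale b x = (LINT u=0..x|lebesgue. (1 / W b u))"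

definition speed_measure :: "(real \<Rightarrow> real) \<Rightarrow> real measure" where
  "speed_measure b = density lborel (\<lambda>x. ennreal (indicator {0..} x * (2 * W b x)))"

text \<open>\<open>df(x)/d\<phi>(x) = D\<close> on \<open>[0, \<infinity>)\<close>, the derivative being one-sided at \<open>0\<close>.\<close>

definition has_deriv_wrt :: "(real \<Rightarrow> real) \<Rightarrow> (real \<Rightarrow> real) \<Rightarrow> real \<Rightarrow> real \<Rightarrow> bool" where
  "has_deriv_wrt f \<phi> D x \<longleftrightarrow>
     ((\<lambda>y. (f y - f x) / (\<phi> y - \<phi> x)) \<longlongrightarrow> D) (at x within {0..})"

text \<open>\<open>g\<close> is the image of \<open>f\<close> under \<open>d/dm d/ds\<close>, and \<open>f\<close> satisfies the reflecting boundary
  condition \<open>df/ds(0) = 0\<close>. Since \<open>ds = dx/W\<close>, \<open>dm = 2 W dx\<close> and \<open>W' = b W\<close> almost everywhere, this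
  is \<open>(f'' + b f')/2 = g\<close> with \<open>f'(0) = 0\<close>; for a merely locally integrable \<open>b\<close> the latter equation
  is to be read almost everywhere, with \<open>f'\<close> locally absolutely continuous.\<close>

definition reflecting_L :: "(real \<Rightarrow> real) \<Rightarrow> (real \<Rightarrow> real) \<Rightarrow> (real \<Rightarrow> real) \<Rightarrow> bool" where
  "reflecting_L b f g \<longleftrightarrow>
     (\<exists>h. (\<forall>x\<ge>0. has_deriv_wrt f (scale b) (h x) x) \<and>
          h 0 = 0 \<and>
          (\<forall>x\<ge>0. has_deriv_wrt h (speed b) (g x) x))"

text \<open>The space \<open>C\<^sub>0[0, \<infinity>)\<close>; values at negative arguments play no role anywhere.\<close>

definition C0 :: "(real \<Rightarrow> real) set" where
  "C0 = {f. continuous_on {0..} f \<and> (f \<longlongrightarrow> 0) at_top}"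

definition past :: "'w measure \<Rightarrow> (real \<Rightarrow> 'w \<Rightarrow> real) \<Rightarrow> real \<Rightarrow> 'w measure" where
  "past M X s =
     sigma (space M) {X u -` B \<inter> space M | u B. 0 \<le> u \<and> u \<le> s \<and> B \<in> sets borel}"

text \<open>A conservative time-homogeneous Markov process \<open>X\<close> on \<open>[0, \<infinity>)\<close> with continuous paths, given by
  the family of laws \<open>P x\<close> of the process started at \<open>x \<ge> 0\<close>, all of them on one measurable space.\<close>

definition continuous_markov_process ::
  "(real \<Rightarrow> 'w measure) \<Rightarrow> (real \<Rightarrow> 'w \<Rightarrow> real) \<Rightarrow> bool" where
  "continuous_markov_process P X \<longleftrightarrow>
     (\<forall>x\<ge>0. prob_space (P x) \<and> sets (P x) = sets (P 0)) \<and>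
     (\<forall>t\<ge>0. X t \<in> borel_measurable (P 0)) \<and>
     (\<forall>\<omega>\<in>space (P 0). (\<forall>t\<ge>0. X t \<omega> \<ge> 0) \<and> continuous_on {0..} (\<lambda>t. X t \<omega>)) \<and>
     (\<forall>x\<ge>0. AE \<omega> in P x. X 0 \<omega> = x) \<and>
     (\<forall>t\<ge>0. \<forall>B\<in>sets borel.
        (\<lambda>x. measure (P x) {\<omega>\<in>space (P x). X t \<omega> \<in> B})
          \<in> borel_measurable (restrict_space borel {0..})) \<and>
     (\<forall>x\<ge>0. \<forall>s\<ge>0. \<forall>t\<ge>0. \<forall>B\<in>sets borel.
        AE \<omega> in P x.
          real_cond_exp (P x) (past (P x) X s) (\<lambda>\<omega>'. indicator B (X (s + t) \<omega>')) \<omega> =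
          measure (P (X s \<omega>)) {\<omega>'\<in>space (P (X s \<omega>)). X t \<omega>' \<in> B})"

definition transition_op ::
  "(real \<Rightarrow> 'w measure) \<Rightarrow> (real \<Rightarrow> 'w \<Rightarrow> real) \<Rightarrow> real \<Rightarrow> (real \<Rightarrow> real) \<Rightarrow> real \<Rightarrow> real" where
  "transition_op P X t f x = (LINT \<omega>|P x. f (X t \<omega>))"

text \<open>Feller property: the semigroup acts on \<open>C\<^sub>0[0, \<infinity>)\<close> and is strongly continuous there. Together
  with path continuity it implies the strong Markov property.\<close>

definition feller :: "(real \<Rightarrow> 'w measure) \<Rightarrow> (real \<Rightarrow> 'w \<Rightarrow> real) \<Rightarrow> bool" where
  "feller P X \<longleftrightarrow>
     (\<forall>f\<in>C0. (\<forall>t\<ge>0. transition_op P X t f \<in> C0) \<and>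
             uniform_limit {0..} (\<lambda>t. transition_op P X t f) f (at_right 0))"

text \<open>\<open>(f, g)\<close> lies in the graph of the infinitesimal generator on \<open>C\<^sub>0[0, \<infinity>)\<close>.\<close>

definition generator ::
  "(real \<Rightarrow> 'w measure) \<Rightarrow> (real \<Rightarrow> 'w \<Rightarrow> real) \<Rightarrow> (real \<Rightarrow> real) \<Rightarrow> (real \<Rightarrow> real) \<Rightarrow> bool" where
  "generator P X f g \<longleftrightarrow>
     f \<in> C0 \<and> g \<in> C0 \<and>
     uniform_limit {0..} (\<lambda>t x. (transition_op P X t f x - f x) / t) g (at_right 0)"

text \<open>The diffusion with generator \<open>(d\<^sup>2/dx\<^sup>2 + b d/dx)/2\<close>, reflected at \<open>0\<close>. The generator is the full
  operator \<open>d/dm d/ds\<close> in \<open>C\<^sub>0[0, \<infinity>)\<close> with the boundary condition at \<open>0\<close> only, which is the situation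
  of a natural boundary at \<open>\<infinity>\<close>. By Hille--Yosida this determines the transition probabilities.\<close>

definition reflecting_diffusion ::
  "(real \<Rightarrow> real) \<Rightarrow> (real \<Rightarrow> 'w measure) \<Rightarrow> (real \<Rightarrow> 'w \<Rightarrow> real) \<Rightarrow> bool" where
  "reflecting_diffusion b P X \<longleftrightarrow>
     continuous_markov_process P X \<and> feller P X \<and>
     (\<forall>f g. generator P X f g \<longleftrightarrow> f \<in> C0 \<and> g \<in> C0 \<and> reflecting_L b f g)"

text \<open>\<open>p\<close> is the jointly continuous version of the density \<open>P\<^sub>x(X\<^sub>t \<in> dy) = p(t;x,y) m(dy)\<close>.\<close>

definition transition_density ::
  "(real \<Rightarrow> real) \<Rightarrow> (real \<Rightarrow> 'w measure) \<Rightarrow> (real \<Rightarrow> 'w \<Rightarrow> real) \<Rightarrow>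
   (real \<Rightarrow> real \<Rightarrow> real \<Rightarrow> real) \<Rightarrow> bool" where
  "transition_density b P X p \<longleftrightarrow>
     (\<forall>t>0.
        (\<forall>x\<ge>0. \<forall>y\<ge>0. p t x y \<ge> 0) \<and>
        continuous_on ({0..} \<times> {0..}) (\<lambda>(x, y). p t x y) \<and>
        (\<forall>x\<ge>0. \<forall>B\<in>sets borel. B \<subseteq> {0..} \<longrightarrow>
           emeasure (P x) {\<omega>\<in>space (P x). X t \<omega> \<in> B} =
           (\<integral>\<^sup>+y\<in>B. ennreal (p t x y) \<partial>speed_measure b)))"

end

theory Submission
  imports Defs "HOL-Real_Asymp.Real_Asymp"
begin

text \<open>Write \<open>m\<close> for the speed function, \<open>s\<close> for the scale function, \<open>\<phi> t = p t x x\<close>, and let \<open>V\<close> solve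
  \<open>dV/ds = m\<close>, so that \<open>V\<close> is sent to \<open>1\<close> by the generator. The proof avoids spectral theory and
  Tauberian theorems. For compactly supported \<open>f\<close>, \<open>g\<close> in the domain, Green's identity shows that the
  \<open>L\<^sup>2(m)\<close> product of \<open>T r f\<close> and \<open>T (c - r) g\<close> does not depend on \<open>r\<close>, so the semigroup is symmetric
  and \<open>\<langle>T t f, f\<rangle>\<close> is convex and nonnegative. Hence the Dirichlet energy of \<open>T t f\<close> is at most
  \<open>\<langle>T t f, f\<rangle> / t\<close>, and letting \<open>f\<close> tend to a unit mass at \<open>x\<close> one gets the oscillation bound
  \<open>(p t z x - p t y x)\<^sup>2 \<le> \<phi> t \<bar>s z - s y\<bar> / t\<close>.

  Upper bound: \<open>p t x\<close> has total mass \<open>1\<close> and is almost constant on \<open>[0, Y]\<close> as long as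
  \<open>s Y\<close> is small compared to \<open>t \<phi> t\<close>, so \<open>\<phi> t\<close> is at most about \<open>1 / m Y\<close>. Lower bound: by
  Cauchy--Schwarz \<open>\<phi> t\<close> is at least the square of the mass of \<open>[0, Y]\<close> at time \<open>t/2\<close> divided by
  \<open>m Y\<close>, and the mass outside \<open>[0, Y]\<close> is at most \<open>(V x + t/2) / V Y\<close>. Since \<open>W\<close> is regularly varying
  with index \<open>-1\<close>, \<open>m\<close> varies so slowly that one may take \<open>Y = \<surd>t\<close> in the lower bound, where
  \<open>V Y / t\<close> tends to infinity, and \<open>Y = t W(\<surd>t) / m(\<surd>t)\<close> in the upper bound, with
  \<open>m Y\<close> asymptotic to \<open>m(\<surd>t)\<close>.\<close>

section \<open>Calculus on the half-line\<close>

text \<open>The drift \<open>b\<close> is only locally integrable, so \<open>W\<close> is only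
  continuous and functions smooth in \<open>x\<close> need not lie in the domain. The remedy is to
  prescribe the flux df/ds as a C^1 function of \<open>m\<close>: its derivative in \<open>m\<close>
  is then continuous without further regularity of \<open>W\<close>. Squared positive parts supply
  the C^1 cutoffs. The other obstacle is at infinity. The generator is known on C0, whose elements
  need not be integrable, while Green's identity needs its boundary terms to vanish. They are
  products of a function tending to 0 and a flux bounded by an L^1 norm, so an L^1(m) bound for the
  semigroup has to precede its symmetry. It comes from truncations of \<open>V\<close>. For the
  scales, put r(x) = x W(x) / m(x). Karamata's theorem for index -1 gives r -> 0. Since V' = m / W =
  x / r, V(x) / x^2 diverges. The scale of the upper bound is x r(x) at x = \<surd>t; between x r(x)
  and x the mass changes only by a fraction of order \<surd>r, and the oscillation over [0, x r(x)]
  is negligible for the same reason.\<close>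

lemma deriv_pos_part_square:
  "((\<lambda>x::real. (max 0 x)\<^sup>2) has_real_derivative 2 * max 0 x) (at x)"
proof -
  consider "x < 0" | "x > 0" | "x = 0" by linarith
  then show ?thesis
  proof cases
    case 1
    have "((\<lambda>x::real. 0) has_real_derivative 2 * max 0 x) (at x)" using 1 by simp
    then show ?thesis
      by (rule has_field_derivative_transform_within_open[where S = "{..<0}"]) (use 1 in auto)
  next
    case 2
    have "((\<lambda>x::real. x\<^sup>2) has_real_derivative 2 * max 0 x) (at x)"
      using 2 by (auto intro!: derivative_eq_intros)
    then show ?thesis
      by (rule has_field_derivative_transform_within_open[where S = "{0<..}"]) (use 2 in auto)
  next
    case 3
    have "((\<lambda>y::real. (max 0 y)\<^sup>2 / y) \<longlongrightarrow> 0) (at 0)"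
    proof (rule Lim_null_comparison[where g = "\<lambda>y. \<bar>y\<bar>"])
      show "\<forall>\<^sub>F y in at (0::real). norm ((max 0 y)\<^sup>2 / y) \<le> \<bar>y\<bar>"
        by (rule always_eventually) (auto simp: max_def power2_eq_square)
      show "((\<lambda>y::real. \<bar>y\<bar>) \<longlongrightarrow> 0) (at 0)"
        by (intro tendsto_eq_intros) auto
    qed
    then show ?thesis using 3 by (simp add: has_field_derivative_iff)
  qed
qed

lemma antiderivative_atLeast:
  fixes q :: "real \<Rightarrow> real"
  assumes "continuous_on {0..} q" "t \<ge> 0"
  shows "((\<lambda>x. integral {0..x} q) has_real_derivative q t) (at t within {0..})"
proof -
  have "((\<lambda>x. integral {0..x} q) has_real_derivative q t) (at t within {0..t+1})"
    by (rule integral_has_real_derivative) (use assms in \<open>auto intro: continuous_on_subset\<close>)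
  moreover have "at t within {0..t+1} = at t within {0..}"
    by (rule at_within_nhd[of _ "{t-1<..<t+1}"]) auto
  ultimately show ?thesis by simp
qed

lemma deriv_zero_atLeast:
  fixes f :: "real \<Rightarrow> real"
  assumes "\<And>x. x \<ge> R \<Longrightarrow> (f has_real_derivative 0) (at x within {0..})" "R \<ge> 0" "x \<ge> R"
  shows "f x = f R"
proof -
  have "\<exists>c. \<forall>y\<in>{R..}. f y = c"
    by (rule has_field_derivative_zero_constant)
       (use assms in \<open>auto intro: DERIV_subset\<close>)
  with assms show ?thesis by auto
qed

lemma mono_of_deriv_atLeast:
  fixes f :: "real \<Rightarrow> real"
  assumes "\<And>x. x \<ge> 0 \<Longrightarrow> (f has_real_derivative f' x) (at x within {0..})"
    and "\<And>x. x \<ge> a \<Longrightarrow> x \<le> b \<Longrightarrow> f' x \<ge> 0" "0 \<le> a" "a \<le> b"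
  shows "f a \<le> f b"
proof (rule DERIV_nonneg_imp_increasing_open[OF assms(4)])
  fix x assume x: "a < x" "x < b"
  have "at x within {0..} = at x"
    by (rule at_within_interior) (use x assms in auto)
  then show "\<exists>y. (f has_real_derivative y) (at x) \<and> 0 \<le> y"
    using assms(1)[of x] assms(2)[of x] x assms(3) by auto
next
  show "continuous_on {a..b} f"
    using assms(1,3) by (intro DERIV_continuous_on[where D = f']) (auto intro!: DERIV_subset[OF assms(1)])
qed

lemma strict_mono_of_deriv_atLeast:
  fixes f :: "real \<Rightarrow> real"
  assumes "\<And>x. x \<ge> 0 \<Longrightarrow> (f has_real_derivative f' x) (at x within {0..})"
    and "\<And>x. x > a \<Longrightarrow> x < b \<Longrightarrow> f' x > 0" "0 \<le> a" "a < b"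
  shows "f a < f b"
proof (rule DERIV_pos_imp_increasing_open[OF assms(4)])
  fix x assume x: "a < x" "x < b"
  have "at x within {0..} = at x"
    by (rule at_within_interior) (use x assms in auto)
  then show "\<exists>y. (f has_real_derivative y) (at x) \<and> 0 < y"
    using assms(1)[of x] assms(2)[of x] x assms(3) by auto
next
  show "continuous_on {a..b} f"
    using assms(1,3) by (intro DERIV_continuous_on[where D = f']) (auto intro!: DERIV_subset[OF assms(1)])
qed

text \<open>Cutting [0, c] into equal steps shorter than \<open>d\<close> and summing gives the
  bound with \<open>K + e\<close>; then \<open>e\<close> is arbitrary. This replaces integrating a
  derivative in time: what enters is a \<open>d\<close> uniform in the starting point
  \<open>r\<close>.\<close>

lemma increment_bound:
  fixes F :: "real \<Rightarrow> real"
  assumes c: "c \<ge> 0"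
    and inc: "\<And>e. e > 0 \<Longrightarrow> \<exists>d>0. \<forall>r h. 0 \<le> r \<longrightarrow> 0 < h \<longrightarrow> h < d \<longrightarrow> r + h \<le> c \<longrightarrow>
       F (r + h) - F r \<le> (K + e) * h"
  shows "F c - F 0 \<le> K * c"
proof (cases "c = 0")
  case False
  with c have c: "c > 0" by simp
  have bound: "F c - F 0 \<le> (K + e) * c" if e: "e > 0" for e
  proof -
    obtain d where d: "d > 0" "\<And>r h. 0 \<le> r \<Longrightarrow> 0 < h \<Longrightarrow> h < d \<Longrightarrow> r + h \<le> c \<Longrightarrow>
       F (r + h) - F r \<le> (K + e) * h" using inc[OF e] by blast
    obtain n :: nat where n: "c / d < real n" using reals_Archimedean2 by blast
    have n0: "n > 0" using n c d by (metis divide_pos_pos of_nat_0_less_iff order_less_trans)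
    define h where "h = c / n"
    have h: "h > 0" "h < d" "n * h = c"
      using n0 c d n by (auto simp: h_def field_simps)
    have "F (k * h) - F 0 \<le> (K + e) * (k * h)" if "k \<le> n" for k :: nat
      using that
    proof (induction k)
      case (Suc k)
      have "k * h + h \<le> c"
        using mult_right_mono[of "Suc k" n h] Suc.prems h by (simp add: algebra_simps)
      then have "F (k * h + h) - F (k * h) \<le> (K + e) * h"
        using h by (intro d) auto
      with Suc show ?case by (simp add: algebra_simps)
    qed simp
    from this[of n] h show ?thesis by simp
  qed
  have *: "F c - F 0 - K * c \<le> e * c" if "e > 0" for e
    using bound[OF that] by (simp add: algebra_simps)
  have "F c - F 0 - K * c \<le> 0 + e" if "e > 0" for e
    using *[of "e / c"] c that by simp
  then have "F c - F 0 - K * c \<le> 0"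
    by (rule field_le_epsilon)
  then show ?thesis by simp
qed simp

text \<open>Common core of two Cauchy-Schwarz inequalities below, one in L^2(m) and one for the
  Dirichlet energy against \<open>s\<close>. For \<open>a = 0\<close> there is no minimiser
  \<open>b / a\<close>; there a suitable \<open>x\<close> makes the expression equal to -1 unless
  \<open>b = 0\<close>.\<close>

lemma discriminant_le:
  fixes a b c :: real
  assumes "\<And>x. a * x\<^sup>2 - 2 * b * x + c \<ge> 0" "a \<ge> 0"
  shows "b\<^sup>2 \<le> a * c"
proof (cases "a = 0")
  case True
  have "b = 0"
  proof (rule ccontr)
    assume "b \<noteq> 0"
    with assms(1)[of "(c + 1) / (2 * b)"] True show False by simp
  qed
  then show ?thesis using True by simp
next
  case False
  with assms have a: "a > 0" by simp
  have "a * (b / a)\<^sup>2 - 2 * b * (b / a) + c = c - b\<^sup>2 / a"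
    using a by (simp add: power2_eq_square field_simps)
  with assms(1)[of "b / a"] have "0 \<le> c - b\<^sup>2 / a" by simp
  with a show ?thesis by (simp add: field_simps)
qed

text \<open>Decrements of a convex sequence are nonincreasing, so \<open>n\<close> copies of the
  \<open>n\<close>-th are at most the telescoping sum of the first \<open>n\<close>. It is the
  discrete form of -u \<phi>'(u) \<le> \<phi>(0) for convex nonnegative \<phi>.\<close>

lemma convex_sequence_decrement:
  fixes a :: "nat \<Rightarrow> real"
  assumes "\<And>j. a j - 2 * a (Suc j) + a (Suc (Suc j)) \<ge> 0" "\<And>j. a j \<ge> 0"
  shows "real n * (a n - a (Suc n)) \<le> a 0"
proof -
  have dec: "a k - a (Suc k) \<ge> a n - a (Suc n)" if "k \<le> n" for k n
    using that
  proof (induction n rule: dec_induct)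
    case (step n) then show ?case using assms(1)[of n] by simp
  qed simp
  have "real n * (a n - a (Suc n)) = (\<Sum>k<n. a n - a (Suc n))" by simp
  also have "\<dots> \<le> (\<Sum>k<n. a k - a (Suc k))" by (intro sum_mono dec) auto
  also have "\<dots> = a 0 - a n" by (rule sum_lessThan_telescope')
  finally show ?thesis using assms(2)[of n] by simp
qed

section \<open>Integration against the speed measure on the half-line\<close>

locale speed_scale =
  fixes w s m V :: "real \<Rightarrow> real"
  assumes w_cont: "continuous_on {0..} w"
    and w_pos: "\<And>x. x \<ge> 0 \<Longrightarrow> w x > 0"
    and s_deriv: "\<And>x. x \<ge> 0 \<Longrightarrow> (s has_real_derivative 1 / w x) (at x within {0..})"
    and m_deriv: "\<And>x. x \<ge> 0 \<Longrightarrow> (m has_real_derivative 2 * w x) (at x within {0..})"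
    and V_deriv: "\<And>x. x \<ge> 0 \<Longrightarrow> (V has_real_derivative m x / w x) (at x within {0..})"
    and s_0: "s 0 = 0" and m_0: "m 0 = 0" and V_0: "V 0 = 0"
    and m_top: "filterlim m at_top at_top"
begin

text \<open>The speed measure lives on the subspace \<open>{0..}\<close> rather than on the line, so
  that continuity on \<open>{0..}\<close> already gives measurability and values at negative
  arguments never have to be fixed.\<close>

definition N :: "real measure" where
  "N = density (restrict_space lborel {0..}) (\<lambda>x. ennreal (2 * w x))"

lemma space_N [simp]: "space N = {0..}"
  by (simp add: N_def space_restrict_space)

lemma sets_N [measurable_cong]: "sets N = sets (restrict_space borel {0..})"
  unfolding N_def sets_density by (rule sets_restrict_space_cong) simp

lemma measurable_N: "continuous_on {0..} f \<Longrightarrow> (f :: real \<Rightarrow> real) \<in> borel_measurable N"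
  unfolding measurable_cong_sets[OF sets_N refl]
  by (rule borel_measurable_continuous_on_restrict)

lemma measurable_N_eq: "borel_measurable N = borel_measurable (restrict_space lborel {0..})"
  by (rule measurable_cong_sets) (auto simp: N_def)

lemma w_measurable [measurable]: "w \<in> borel_measurable (restrict_space lborel {0..})"
  using measurable_N[OF w_cont] by (simp only: measurable_N_eq)

lemma integrable_N_iff:
  assumes "f \<in> borel_measurable N"
  shows "integrable N (f :: real \<Rightarrow> real) \<longleftrightarrow> set_integrable lborel {0..} (\<lambda>x. 2 * w x * f x)"
proof -
  have f: "f \<in> borel_measurable (restrict_space lborel {0..})"
    using assms by (simp only: measurable_N_eq)
  have "integrable N f \<longleftrightarrow> integrable (restrict_space lborel {0..}) (\<lambda>x. (2 * w x) *\<^sub>R f x)"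
    unfolding N_def
    by (rule integrable_density)
       (use f w_pos in \<open>auto simp: less_imp_le AE_restrict_space_iff intro!: always_eventually\<close>)
  also have "\<dots> \<longleftrightarrow> set_integrable lborel {0..} (\<lambda>x. 2 * w x * f x)"
    unfolding set_integrable_def real_scaleR_def
    by (subst integrable_restrict_space) simp_all
  finally show ?thesis .
qed

lemma integral_N:
  assumes "f \<in> borel_measurable N"
  shows "integral\<^sup>L N (f :: real \<Rightarrow> real) = (LINT x:{0..}|lborel. 2 * w x * f x)"
proof -
  have f: "f \<in> borel_measurable (restrict_space lborel {0..})"
    using assms by (simp only: measurable_N_eq)
  show ?thesis unfolding N_def
    by (subst integral_density)
       (use f w_pos in \<open>auto simp: integral_restrict_space set_lebesgue_integral_def less_imp_le
          AE_restrict_space_iff mult.assoc space_restrict_space intro!: always_eventually\<close>)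
qed

lemma interval_sets_N [measurable]: "{0..R::real} \<in> sets N"
  by (auto simp: sets_N sets_restrict_space intro!: image_eqI[of _ _ "{0..R}"])

lemma set_integrable_interval:
  assumes "continuous_on {0..} (f :: real \<Rightarrow> real)"
  shows "set_integrable N {0..R} f"
proof -
  have "set_integrable lborel {0..R} (\<lambda>x. 2 * w x * f x)"
    by (rule borel_integrable_atLeastAtMost')
       (intro continuous_intros continuous_on_subset[OF assms] continuous_on_subset[OF w_cont]; auto)
  then have "set_integrable lborel {0..} (\<lambda>x. 2 * w x * (indicator {0..R} x * f x))"
    unfolding set_integrable_def
    by (rule Bochner_Integration.integrable_cong[OF refl, THEN iffD1, rotated])
       (auto simp: indicator_def)
  moreover have "(\<lambda>x. indicator {0..R} x * f x) \<in> borel_measurable N"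
    using measurable_N[OF assms] interval_sets_N by measurable
  ultimately show ?thesis
    by (simp add: set_integrable_def integrable_N_iff)
qed

lemma integral_N_FTC:
  assumes "\<And>x. x \<ge> 0 \<Longrightarrow> (F has_real_derivative 2 * w x * f x) (at x within {0..})"
    and f: "continuous_on {0..} f" and R: "R \<ge> 0"
  shows "(LINT x:{0..R}|N. f x) = F R - F 0"
proof -
  have mf: "(\<lambda>x. indicator {0..R} x * f x) \<in> borel_measurable N"
    using measurable_N[OF f] interval_sets_N by measurable
  have "(LINT x:{0..R}|N. f x) = (LINT x:{0..}|lborel. 2 * w x * (indicator {0..R} x * f x))"
    by (simp add: set_lebesgue_integral_def integral_N[OF mf])
  also have "\<dots> = (LINT x|lborel. indicator {0..R} x *\<^sub>R (2 * w x * f x))"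
    unfolding set_lebesgue_integral_def
    by (rule Bochner_Integration.integral_cong) (auto simp: indicator_def)
  also have "\<dots> = F R - F 0"
  proof (rule integral_FTC_Icc[OF R])
    show "(F has_vector_derivative 2 * w x * f x) (at x within {0..R})" if "0 \<le> x" "x \<le> R" for x
      using assms(1)[of x] that
      by (auto simp: has_real_derivative_iff_has_vector_derivative intro: has_vector_derivative_within_subset)
    show "continuous_on {0..R} (\<lambda>x. 2 * w x * f x)"
      by (intro continuous_intros continuous_on_subset[OF f] continuous_on_subset[OF w_cont]; auto)
  qed
  finally show ?thesis .
qed

lemma integral_N_exhaust:
  assumes "integrable N f"
  shows "((\<lambda>R. LINT x:{0..R}|N. f x) \<longlongrightarrow> integral\<^sup>L N (f :: real \<Rightarrow> real)) at_top"
proof -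
  have "((\<lambda>R. \<integral>x. indicator {0..R} x *\<^sub>R f x \<partial>N) \<longlongrightarrow> integral\<^sup>L N f) at_top"
  proof (rule tendsto_at_topI_sequentially)
    fix X :: "nat \<Rightarrow> real" assume X: "filterlim X at_top sequentially"
    show "(\<lambda>n. \<integral>x. indicator {0..X n} x *\<^sub>R f x \<partial>N) \<longlonglongrightarrow> integral\<^sup>L N f"
    proof (rule integral_dominated_convergence[where w = "\<lambda>x. norm (f x)"])
      show "AE x in N. (\<lambda>n. indicator {0..X n} x *\<^sub>R f x) \<longlonglongrightarrow> f x"
      proof (rule AE_I2)
        fix x assume x: "x \<in> space N"
        have "\<forall>\<^sub>F n in sequentially. indicator {0..X n} x *\<^sub>R f x = f x"
          using filterlim_at_top_dense[THEN iffD1, OF X, rule_format, of x]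
          by eventually_elim (use x in \<open>auto simp: indicator_def\<close>)
        then show "(\<lambda>n. indicator {0..X n} x *\<^sub>R f x) \<longlonglongrightarrow> f x"
          by (rule tendsto_eventually)
      qed
      show "(\<lambda>x. indicator {0..X n} x *\<^sub>R f x) \<in> borel_measurable N" for n
        using assms interval_sets_N by measurable
    qed (use assms in \<open>auto simp: indicator_def\<close>)
  qed
  then show ?thesis by (simp add: set_lebesgue_integral_def)
qed

lemma integrable_compact_support:
  assumes "continuous_on {0..} (f :: real \<Rightarrow> real)" "\<And>x. x \<ge> R \<Longrightarrow> f x = 0"
  shows "integrable N f" "integral\<^sup>L N f = (LINT x:{0..R}|N. f x)"
proof -
  have eq: "indicator {0..R} x *\<^sub>R f x = f x" if "x \<in> space N" for x
    using assms(2)[of x] that by (cases "x \<le> R") (auto simp: indicator_def)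
  show "integrable N f"
    using set_integrable_interval[OF assms(1), of R] eq
    unfolding set_integrable_def by (metis (no_types, lifting) Bochner_Integration.integrable_cong)
  show "integral\<^sup>L N f = (LINT x:{0..R}|N. f x)"
    unfolding set_lebesgue_integral_def using eq
    by (metis (no_types, lifting) Bochner_Integration.integral_cong)
qed

lemma integrable_bounded_mult:
  fixes f g :: "real \<Rightarrow> real"
  assumes "continuous_on {0..} f" "\<And>x. x \<ge> 0 \<Longrightarrow> \<bar>f x\<bar> \<le> C" "integrable N g"
  shows "integrable N (\<lambda>x. f x * g x)"
proof (rule Bochner_Integration.integrable_bound[where f = "\<lambda>x. C * g x"])
  show "(\<lambda>x. f x * g x) \<in> borel_measurable N"
    using measurable_N[OF assms(1)] assms(3) by measurable
  show "AE x in N. norm (f x * g x) \<le> norm (C * g x)"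
  proof (rule AE_I2)
    fix x assume "x \<in> space N"
    then have "\<bar>f x\<bar> \<le> \<bar>C\<bar>" using assms(2)[of x] by simp
    then show "norm (f x * g x) \<le> norm (C * g x)" by (simp add: abs_mult mult_right_mono)
  qed
qed (use assms in auto)

end

lemma continuous_on_of_deriv_atLeast:
  fixes f :: "real \<Rightarrow> real"
  assumes "\<And>x. x \<ge> 0 \<Longrightarrow> (f has_real_derivative f' x) (at x within {0..})"
  shows "continuous_on {0..} f"
  using assms by (intro DERIV_continuous_on[where D = f']) auto

lemma compact_support_C0:
  assumes "continuous_on {0..} f" "\<And>x. x \<ge> R \<Longrightarrow> f x = 0"
  shows "f \<in> C0"
proof -
  have "\<forall>\<^sub>F x in at_top. f x = 0"
    using eventually_ge_at_top[of R] by eventually_elim (rule assms(2))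
  then show ?thesis using assms(1) by (auto simp: C0_def intro: tendsto_eventually)
qed

section \<open>Test functions in the domain of the generator\<close>

context speed_scale
begin

text \<open>The graph of d/dm d/ds on C0 in ordinary derivatives. The witness \<open>k\<close> is
  the flux df/ds, and \<open>k 0 = 0\<close> is reflection at 0. The flux, not the derivative of
  \<open>f\<close>, is what is differentiated a second time.\<close>

definition Lgraph :: "(real \<Rightarrow> real) \<Rightarrow> (real \<Rightarrow> real) \<Rightarrow> bool" where
  "Lgraph f g \<longleftrightarrow> f \<in> C0 \<and> g \<in> C0 \<and>
     (\<exists>k. (\<forall>x\<ge>0. (f has_real_derivative k x / w x) (at x within {0..})) \<and> k 0 = 0 \<and>
          (\<forall>x\<ge>0. (k has_real_derivative 2 * w x * g x) (at x within {0..})))"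

lemmas m_cont = continuous_on_of_deriv_atLeast[OF m_deriv]

lemma m_mono: "0 \<le> x \<Longrightarrow> x \<le> y \<Longrightarrow> m x \<le> m y"
  by (rule mono_of_deriv_atLeast[OF m_deriv]) (auto simp: w_pos less_imp_le)

lemma m_strict_mono: "0 \<le> x \<Longrightarrow> x < y \<Longrightarrow> m x < m y"
  by (rule strict_mono_of_deriv_atLeast[OF m_deriv]) (auto simp: w_pos)

lemma m_nonneg: "0 \<le> x \<Longrightarrow> 0 \<le> m x"
  using m_mono[of 0 x] m_0 by simp

lemma s_mono: "0 \<le> x \<Longrightarrow> x \<le> y \<Longrightarrow> s x \<le> s y"
  by (rule mono_of_deriv_atLeast[OF s_deriv]) (auto simp: w_pos less_imp_le)

lemma s_strict_mono: "0 \<le> x \<Longrightarrow> x < y \<Longrightarrow> s x < s y"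
  by (rule strict_mono_of_deriv_atLeast[OF s_deriv]) (auto simp: w_pos)

lemma V_mono: "0 \<le> x \<Longrightarrow> x \<le> y \<Longrightarrow> V x \<le> V y"
  by (rule mono_of_deriv_atLeast[OF V_deriv]) (auto simp: w_pos less_imp_le m_nonneg)

lemma V_nonneg: "0 \<le> x \<Longrightarrow> 0 \<le> V x"
  using V_mono[of 0 x] V_0 by simp

lemma m_surj:
  assumes "z \<ge> m a" "a \<ge> 0"
  obtains x where "x \<ge> a" "m x = z"
proof -
  obtain b where b: "b \<ge> a" "m b \<ge> z"
    using eventually_conj[OF eventually_ge_at_top[of a] filterlim_at_top[THEN iffD1, OF m_top, rule_format, of z]]
    by (auto simp: eventually_at_top_linorder)
  have "\<exists>x\<ge>a. x \<le> b \<and> m x = z"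
    by (rule IVT') (use assms b in \<open>auto intro: continuous_on_subset[OF m_cont]\<close>)
  with that show ?thesis by auto
qed

lemma Lgraph_scale:
  assumes "Lgraph f g"
  shows "Lgraph (\<lambda>x. c * f x) (\<lambda>x. c * g x)"
proof -
  obtain k where fg: "f \<in> C0" "g \<in> C0" and k: "k 0 = 0"
    "\<And>x. x \<ge> 0 \<Longrightarrow> (f has_real_derivative k x / w x) (at x within {0..})"
    "\<And>x. x \<ge> 0 \<Longrightarrow> (k has_real_derivative 2 * w x * g x) (at x within {0..})"
    using assms by (auto simp: Lgraph_def)
  have "(\<lambda>x. c * f x) \<in> C0" "(\<lambda>x. c * g x) \<in> C0"
    using fg by (auto simp: C0_def intro!: continuous_intros tendsto_mult_right_zero)
  moreover have "((\<lambda>x. c * f x) has_real_derivative (c * k x) / w x) (at x within {0..})"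
    "((\<lambda>x. c * k x) has_real_derivative 2 * w x * (c * g x)) (at x within {0..})" if "x \<ge> 0" for x
    using DERIV_cmult[OF k(2)[OF that], of c] DERIV_cmult[OF k(3)[OF that], of c]
    by (auto simp: mult_ac)
  ultimately show ?thesis
    using k(1) unfolding Lgraph_def by (intro conjI exI[of _ "\<lambda>x. c * k x"]) auto
qed

text \<open>A flux of the form \<open>\<kappa> (m x)\<close> has dm-derivative
  \<open>\<kappa>' (m x)\<close> by the chain rule, whatever the regularity of \<open>w\<close>.
  Integrating it against ds and subtracting the value at \<open>R\<close> makes \<open>f\<close>
  vanish beyond \<open>R\<close>; \<open>\<kappa> 0 = 0\<close> is the reflecting condition, as
  \<open>m 0 = 0\<close>.\<close>

lemma test_function:
  assumes der: "\<And>z. (\<kappa> has_real_derivative \<kappa>' z) (at z)" and cont: "continuous_on UNIV \<kappa>'"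
    and "\<kappa> 0 = 0" "R \<ge> 0" and vanish: "\<And>z. z \<ge> m R \<Longrightarrow> \<kappa> z = 0" "\<And>z. z \<ge> m R \<Longrightarrow> \<kappa>' z = 0"
  obtains f where "Lgraph f (\<lambda>x. \<kappa>' (m x))" "\<And>x. x \<ge> R \<Longrightarrow> f x = 0"
    "\<And>x. x \<ge> R \<Longrightarrow> \<kappa>' (m x) = 0"
    "\<And>x. x \<ge> 0 \<Longrightarrow> (f has_real_derivative \<kappa> (m x) / w x) (at x within {0..})"
proof -
  have \<kappa>: "continuous_on UNIV \<kappa>"
    using der by (intro DERIV_continuous_on) auto
  define J where "J x = integral {0..x} (\<lambda>x. \<kappa> (m x) / w x)" for x
  have contJ: "continuous_on {0..} (\<lambda>x. \<kappa> (m x) / w x)"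
    using w_pos by (intro continuous_intros w_cont continuous_on_compose2[OF \<kappa> m_cont])
      (auto simp: less_imp_neq[symmetric])
  have J: "(J has_real_derivative \<kappa> (m x) / w x) (at x within {0..})" if "x \<ge> 0" for x
    unfolding J_def by (rule antiderivative_atLeast[OF contJ that])
  have const: "J x = J R" if "x \<ge> R" for x
  proof (rule deriv_zero_atLeast[of R J x, OF _ \<open>R \<ge> 0\<close> that])
    fix y assume "y \<ge> R"
    with J[of y] vanish(1)[of "m y"] m_mono[of R y] \<open>R \<ge> 0\<close>
    show "(J has_real_derivative 0) (at y within {0..})" by simp
  qed
  define f where "f x = J x - J R" for x
  have f: "(f has_real_derivative \<kappa> (m x) / w x) (at x within {0..})" if "x \<ge> 0" for x
    unfolding f_def using J[OF that] by (auto intro!: derivative_eq_intros)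
  have f0: "f x = 0" if "x \<ge> R" for x using const[OF that] by (simp add: f_def)
  have g0: "\<kappa>' (m x) = 0" if "x \<ge> R" for x
    using vanish(2)[of "m x"] m_mono[of R x] that \<open>R \<ge> 0\<close> by simp
  have "continuous_on {0..} (\<lambda>x. \<kappa>' (m x))"
    by (rule continuous_on_compose2[OF cont m_cont]) auto
  then have "f \<in> C0" "(\<lambda>x. \<kappa>' (m x)) \<in> C0"
    using compact_support_C0[OF continuous_on_of_deriv_atLeast[OF f] f0]
      compact_support_C0[OF _ g0] by auto
  moreover have "((\<lambda>x. \<kappa> (m x)) has_real_derivative 2 * w x * \<kappa>' (m x)) (at x within {0..})"
    if "x \<ge> 0" for x
    using DERIV_chain2[OF der m_deriv[OF that]] by (simp add: mult_ac)
  ultimately have "Lgraph f (\<lambda>x. \<kappa>' (m x))"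
    unfolding Lgraph_def using f assms(3) m_0 by (intro conjI exI[of _ "\<lambda>x. \<kappa> (m x)"]) auto
  then show ?thesis using that f0 g0 f by blast
qed

text \<open>\<open>F\<close> agrees with a constant minus \<open>V\<close> up to \<open>Y\<close>; since \<open>d/dm d/ds V = 1\<close>, it is a truncation
  of the Lyapunov function \<open>V\<close>.\<close>

lemma truncated_lyapunov:
  assumes Y: "Y \<ge> 0"
  shows "\<exists>F G Y'. Lgraph F G \<and> Y' \<ge> Y \<and> m Y' = m Y + 1 \<and>
    (\<forall>x\<ge>Y'. F x = 0 \<and> G x = 0) \<and>
    (\<forall>x\<ge>0. 0 \<le> F x \<and> F x \<le> F 0 \<and> F 0 - V x \<le> F x \<and> - 1 \<le> G x) \<and>
    V Y \<le> F 0 \<and> (\<integral>x. \<bar>G x\<bar> \<partial>N) \<le> 2 * (m Y + 1)"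
proof -
  obtain Y' where Y': "Y' \<ge> Y" "m Y' = m Y + 1"
    using m_surj[of Y "m Y + 1"] Y by auto
  \<comment> \<open>A C^1 cutoff: 1 for y \<le> 0, 0 for y \<ge> 1, decreasing in between.\<close>
  define q where "q y = (max 0 (1 - (max 0 y)\<^sup>2))\<^sup>2" for y :: real
  define q' where "q' y = - 4 * max 0 (1 - (max 0 y)\<^sup>2) * max 0 y" for y :: real
  have q_deriv: "(q has_real_derivative q' y) (at y)" for y
  proof -
    have "((\<lambda>y. 1 - (max 0 y)\<^sup>2) has_real_derivative - (2 * max 0 y)) (at y)"
      using DERIV_diff[OF DERIV_const deriv_pos_part_square] by simp
    from DERIV_chain2[OF deriv_pos_part_square this] show ?thesis
      by (simp add: q_def[abs_def] q'_def mult_ac)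
  qed
  have q_le: "q y \<le> 1" for y
    unfolding q_def by (rule power_le_one) auto
  have q_ge: "q y \<ge> 0" for y by (simp add: q_def)
  have q_0: "q y = 1" if "y \<le> 0" for y using that by (simp add: q_def max_def)
  have q_1: "q y = 0" "q' y = 0" if "y \<ge> 1" for y
  proof -
    have "1 \<le> (max 0 y)\<^sup>2" using that by (intro one_le_power) auto
    then have "max 0 (1 - (max 0 y)\<^sup>2) = 0" by simp
    then show "q y = 0" "q' y = 0" by (auto simp: q_def q'_def)
  qed
  have q'_le: "q' y \<le> 0" for y by (simp add: q'_def)
  define z where "z = m Y"
  \<comment> \<open>The flux of \<open>- V\<close> is \<open>- m x\<close>; it is switched off while
    \<open>m\<close> climbs from \<open>m Y\<close> to \<open>m Y + 1\<close>. Cutting in the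
    variable \<open>m\<close> costs just one unit of mass.\<close>
  define \<kappa> where "\<kappa> x = - x * q (x - z)" for x
  define \<kappa>' where "\<kappa>' x = - q (x - z) - x * q' (x - z)" for x
  have \<kappa>: "(\<kappa> has_real_derivative \<kappa>' x) (at x)" for x
  proof -
    have "((\<lambda>x. q (x - z)) has_real_derivative q' (x - z)) (at x)"
    proof -
      have "((\<lambda>x. x - z) has_real_derivative 1) (at x)" by (auto intro!: derivative_eq_intros)
      from DERIV_chain2[OF q_deriv this] show ?thesis by simp
    qed
    then show ?thesis unfolding \<kappa>_def \<kappa>'_def by (auto intro!: derivative_eq_intros)
  qed
  have cont: "continuous_on UNIV \<kappa>'"
    unfolding \<kappa>'_def[abs_def] q_def q'_def by (intro continuous_intros)
  have Y'0: "Y' \<ge> 0" using Y Y' by simp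
  obtain F where F: "Lgraph F (\<lambda>x. \<kappa>' (m x))" "\<And>x. x \<ge> Y' \<Longrightarrow> F x = 0"
    "\<And>x. x \<ge> Y' \<Longrightarrow> \<kappa>' (m x) = 0"
    "\<And>x. x \<ge> 0 \<Longrightarrow> (F has_real_derivative \<kappa> (m x) / w x) (at x within {0..})"
    by (rule test_function[OF \<kappa> cont _ Y'0]) (auto simp: \<kappa>_def \<kappa>'_def Y' z_def q_1)
  define G where "G x = \<kappa>' (m x)" for x
  have F_dec: "F y \<le> F x" if "0 \<le> x" "x \<le> y" for x y
  proof -
    have "- F x \<le> - F y"
    proof (rule mono_of_deriv_atLeast[where f = "\<lambda>x. - F x" and f' = "\<lambda>x. - (\<kappa> (m x) / w x)" and a = x and b = y])
      show "((\<lambda>x. - F x) has_real_derivative - (\<kappa> (m x) / w x)) (at x within {0..})" if "x \<ge> 0" for x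
        using F(4)[OF that] by (auto intro!: derivative_eq_intros)
      show "- (\<kappa> (m y) / w y) \<ge> 0" if "x \<le> y" for y
        using that \<open>0 \<le> x\<close> w_pos[of y] m_nonneg[of y] q_ge by (simp add: \<kappa>_def)
    qed (use that in auto)
    then show ?thesis by simp
  qed
  have FV: "((\<lambda>x. F x + V x) has_real_derivative m x * (1 - q (m x - z)) / w x) (at x within {0..})"
    if "x \<ge> 0" for x
    using DERIV_add[OF F(4)[OF that] V_deriv[OF that]]
    by (rule DERIV_cong) (simp add: \<kappa>_def diff_divide_distrib right_diff_distrib)
  have FV_inc: "F 0 \<le> F x + V x" if "0 \<le> x" for x
    using mono_of_deriv_atLeast[OF FV, where a = 0 and b = x] that w_pos m_nonneg q_le V_0
    by (auto simp: less_imp_le)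
  \<comment> \<open>Differentiating the cutoff contributes \<open>- m x * q'\<close>, which is
    nonnegative because \<open>q\<close> decreases; the other term is \<open>- q\<close>, at least
    -1.\<close>
  have G_ge: "G x \<ge> - 1" if "x \<ge> 0" for x
    using q_le[of "m x - z"] mult_nonneg_nonpos[OF m_nonneg[OF that] q'_le[of "m x - z"]]
    by (simp add: G_def \<kappa>'_def)
  have F_Y: "V Y \<le> F 0"
  proof -
    have "- (F 0 + V 0) \<le> - (F Y + V Y)"
    proof (rule mono_of_deriv_atLeast[where f = "\<lambda>x. - (F x + V x)" and a = 0 and b = Y and f' = "\<lambda>x. - (m x * (1 - q (m x - z)) / w x)"])
      show "((\<lambda>x. - (F x + V x)) has_real_derivative - (m x * (1 - q (m x - z)) / w x)) (at x within {0..})"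
        if "x \<ge> 0" for x
        using DERIV_minus[OF FV[OF that]] .
      show "- (m x * (1 - q (m x - z)) / w x) \<ge> 0" if "x \<ge> 0" "x \<le> Y" for x
        using q_0[of "m x - z"] m_mono[of x Y] that by (simp add: z_def)
    qed (use Y in auto)
    moreover have "F Y \<ge> 0" using F_dec[of Y Y'] F(2)[of Y'] Y Y' by simp
    ultimately show ?thesis using V_0 by simp
  qed
  have Gc: "continuous_on {0..} G" "\<And>x. x \<ge> Y' \<Longrightarrow> G x = 0"
    using F(1,3) by (auto simp: G_def[abs_def] Lgraph_def C0_def)
  \<comment> \<open>From \<open>G \<ge> - 1\<close> one has |G| \<le> G + 2. The flux vanishes at
    both ends of [0, Y'], so \<open>G\<close> has integral 0 and only twice the mass of [0, Y']
    remains.\<close>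
  have "(\<integral>x. \<bar>G x\<bar> \<partial>N) = (LINT x:{0..Y'}|N. \<bar>G x\<bar>)"
    by (rule integrable_compact_support) (use Gc in \<open>auto intro!: continuous_intros\<close>)
  also have "\<dots> \<le> (LINT x:{0..Y'}|N. G x + 2)"
  proof (rule set_integral_mono)
    fix x assume "x \<in> {0..Y'}"
    then show "\<bar>G x\<bar> \<le> G x + 2" using G_ge[of x] by simp
  qed (intro set_integrable_interval continuous_intros Gc)+
  also have "\<dots> = (\<kappa> (m Y') + 2 * m Y') - (\<kappa> (m 0) + 2 * m 0)"
  proof (rule integral_N_FTC[where F = "\<lambda>x. \<kappa> (m x) + 2 * m x"])
    show "((\<lambda>x. \<kappa> (m x) + 2 * m x) has_real_derivative 2 * w x * (G x + 2)) (at x within {0..})"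
      if "x \<ge> 0" for x
      using DERIV_add[OF DERIV_chain2[OF \<kappa> m_deriv[OF that]] DERIV_cmult[OF m_deriv[OF that], of 2]]
      by (simp add: G_def algebra_simps)
  qed (use Y Y' in \<open>auto intro!: continuous_intros Gc\<close>)
  also have "\<dots> = 2 * (m Y + 1)"
    by (simp add: m_0 Y' \<kappa>_def q_1 z_def)
  finally have "(\<integral>x. \<bar>G x\<bar> \<partial>N) \<le> 2 * (m Y + 1)" .
  moreover have "0 \<le> F x" if "x \<ge> 0" for x
    using F_dec[of x "max x Y'"] F(2)[of "max x Y'"] that by simp
  moreover have "F 0 - V x \<le> F x" if "x \<ge> 0" for x using FV_inc[OF that] by simp
  ultimately show ?thesis
    using F(1,2) Gc(2) Y' F_dec G_ge F_Y
    by (intro exI[of _ F] exI[of _ G] exI[of _ Y']) (auto simp: G_def[abs_def])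
qed

text \<open>The flux is a positive bump followed by a negative one, both in the variable
  \<open>m\<close> and scaled to opposite ds-integrals; hence \<open>f\<close> rises from 0 on
  [\<alpha>, \<mu>] and returns to 0 on [\<mu>, \<beta>]. A last scaling gives unit mass.\<close>

lemma bump_function:
  assumes ab: "0 \<le> \<alpha>" "\<alpha> < \<beta>"
  obtains f g where "Lgraph f g" "\<And>x. x \<ge> 0 \<Longrightarrow> f x \<ge> 0"
    "\<And>x. x \<ge> \<beta> \<Longrightarrow> f x = 0" "\<And>x. x \<ge> \<beta> \<Longrightarrow> g x = 0"
    "\<And>x. 0 \<le> x \<Longrightarrow> x \<le> \<alpha> \<Longrightarrow> f x = 0" "integral\<^sup>L N f = 1"
proof -
  define \<mu> where "\<mu> = (\<alpha> + \<beta>) / 2"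
  have \<mu>: "\<alpha> < \<mu>" "\<mu> < \<beta>" "0 < \<mu>" "0 < \<beta>" using ab by (auto simp: \<mu>_def)
  define H where "H a c z = (max 0 ((z - a) * (c - z)))\<^sup>2" for a c z :: real
  define H' where "H' a c z = 2 * max 0 ((z - a) * (c - z)) * ((c - z) - (z - a))" for a c z :: real
  have H: "(H a c has_real_derivative H' a c z) (at z)" for a c z
  proof -
    have "((\<lambda>z. (z - a) * (c - z)) has_real_derivative ((c - z) - (z - a))) (at z)"
      by (auto intro!: derivative_eq_intros)
    from DERIV_chain2[OF deriv_pos_part_square this] show ?thesis
      by (simp add: H_def[abs_def] H'_def)
  qed
  have H'_cont: "continuous_on UNIV (H' a c)" for a c
    unfolding H'_def[abs_def] by (intro continuous_intros)
  have H_cont: "continuous_on UNIV (H a c)" for a c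
    unfolding H_def[abs_def] by (intro continuous_intros)
  have H_nonneg: "H a c z \<ge> 0" for a c z by (simp add: H_def)
  have H_pos: "H a c z > 0" if "a < z" "z < c" for a c z
    using that by (simp add: H_def max_def)
  have H_zero: "H a c z = 0" "H' a c z = 0" if "a \<le> c" "z \<le> a \<or> c \<le> z" for a c z
  proof -
    have "(z - a) * (c - z) \<le> 0" using that by (auto simp: mult_le_0_iff)
    then show "H a c z = 0" "H' a c z = 0" by (auto simp: H_def H'_def)
  qed
  define J where "J a c x = integral {0..x} (\<lambda>x. H a c (m x) / w x)" for a c x
  have J: "(J a c has_real_derivative H a c (m x) / w x) (at x within {0..})" if "x \<ge> 0" for a c x
    unfolding J_def using w_pos
    by (intro antiderivative_atLeast[OF _ that] continuous_intros w_cont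
        continuous_on_compose2[OF H_cont m_cont]) (auto simp: less_imp_neq[symmetric])
  have J_mono: "J a c x \<le> J a c y" if "0 \<le> x" "x \<le> y" for a c x y
    using that w_pos H_nonneg by (intro mono_of_deriv_atLeast[OF J]) (auto simp: less_imp_le)
  have J_0: "J a c 0 = 0" for a c by (simp add: J_def)
  have J_strict: "J (m a) (m c) a < J (m a) (m c) c" if "0 \<le> a" "a < c" for a c
    using that w_pos by (intro strict_mono_of_deriv_atLeast[OF J])
      (auto intro!: divide_pos_pos H_pos m_strict_mono)
  define c1 where "c1 = J (m \<alpha>) (m \<mu>) \<beta>"
  define c2 where "c2 = J (m \<mu>) (m \<beta>) \<beta>"
  have c: "c1 > 0" "c2 > 0"
    using J_strict[of \<alpha> \<mu>] J_mono[of 0 \<alpha> "m \<alpha>" "m \<mu>"] J_mono[of \<mu> \<beta> "m \<alpha>" "m \<mu>"]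
      J_strict[of \<mu> \<beta>] J_mono[of 0 \<mu> "m \<mu>" "m \<beta>"] \<mu> ab J_0 by (auto simp: c1_def c2_def)
  define \<kappa> where "\<kappa> z = H (m \<alpha>) (m \<mu>) z / c1 - H (m \<mu>) (m \<beta>) z / c2" for z
  define \<kappa>' where "\<kappa>' z = H' (m \<alpha>) (m \<mu>) z / c1 - H' (m \<mu>) (m \<beta>) z / c2" for z
  have m_le: "m \<alpha> \<le> m \<mu>" "m \<mu> \<le> m \<beta>" "0 \<le> m \<alpha>"
    using \<mu> ab by (auto intro!: m_mono m_nonneg)
  have \<kappa>: "(\<kappa> has_real_derivative \<kappa>' z) (at z)" for z
    unfolding \<kappa>_def[abs_def] \<kappa>'_def by (intro DERIV_diff DERIV_cdivide H)
  have cont: "continuous_on UNIV \<kappa>'"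
    unfolding \<kappa>'_def[abs_def] using c by (intro continuous_intros H'_cont) auto
  obtain f where f: "Lgraph f (\<lambda>x. \<kappa>' (m x))" "\<And>x. x \<ge> \<beta> \<Longrightarrow> f x = 0"
    "\<And>x. x \<ge> \<beta> \<Longrightarrow> \<kappa>' (m x) = 0"
    "\<And>x. x \<ge> 0 \<Longrightarrow> (f has_real_derivative \<kappa> (m x) / w x) (at x within {0..})"
    by (rule test_function[OF \<kappa> cont, of \<beta>])
       (use \<mu> m_le in \<open>auto simp: \<kappa>_def \<kappa>'_def H_zero\<close>)
  \<comment> \<open>\<open>test_function\<close> normalises \<open>f\<close> at the right end. Both
    scaled integrals \<open>J\<close> from 0 equal 1 at \<beta>, so their difference vanishes there
    too and must be \<open>f\<close>.\<close>
  have f_eq: "f x = J (m \<alpha>) (m \<mu>) x / c1 - J (m \<mu>) (m \<beta>) x / c2" if "x \<ge> 0" for x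
  proof -
    define D where "D x = f x - (J (m \<alpha>) (m \<mu>) x / c1 - J (m \<mu>) (m \<beta>) x / c2)" for x
    have "D x = D 0" if "x \<ge> 0" for x
    proof (rule deriv_zero_atLeast[of 0 D x, OF _ order_refl that])
      fix x :: real assume "x \<ge> 0"
      from DERIV_diff[OF f(4)[OF this] DERIV_diff[OF DERIV_cdivide[OF J[OF this]] DERIV_cdivide[OF J[OF this]]]]
      show "(D has_real_derivative 0) (at x within {0..})"
        unfolding D_def[abs_def] by (rule DERIV_cong) (simp add: \<kappa>_def diff_divide_distrib mult.commute)
    qed
    from this[of x] this[of \<beta>] that \<mu> f(2)[of \<beta>] c show ?thesis
      by (simp add: D_def c1_def c2_def)
  qed
  have f_left: "f x = J (m \<alpha>) (m \<mu>) x / c1" if "0 \<le> x" "x \<le> \<mu>" for x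
  proof -
    have "J (m \<mu>) (m \<beta>) x \<le> 0"
    proof -
      have "- J (m \<mu>) (m \<beta>) 0 \<le> - J (m \<mu>) (m \<beta>) x"
        by (rule mono_of_deriv_atLeast[OF DERIV_minus[OF J], where b = x])
           (use that \<mu> m_le in \<open>auto simp: H_zero m_mono\<close>)
      then show ?thesis using J_0 by simp
    qed
    then show ?thesis using f_eq[OF that(1)] J_mono[of 0 x "m \<mu>" "m \<beta>"] J_0 that by simp
  qed
  have f_zero: "f x = 0" if "0 \<le> x" "x \<le> \<alpha>" for x
  proof -
    have "- J (m \<alpha>) (m \<mu>) 0 \<le> - J (m \<alpha>) (m \<mu>) x"
      by (rule mono_of_deriv_atLeast[OF DERIV_minus[OF J], where b = x])
         (use that \<mu> m_le in \<open>auto simp: H_zero m_mono\<close>)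
    then show ?thesis using f_left[of x] J_mono[of 0 x "m \<alpha>" "m \<mu>"] J_0 that \<mu> by simp
  qed
  have f_nonneg: "f x \<ge> 0" if "x \<ge> 0" for x
  proof (cases "x \<le> \<mu>")
    case True
    then show ?thesis using f_left[of x] that c J_mono[of 0 x "m \<alpha>" "m \<mu>"] J_0 by simp
  next
    case False
    have "- f x \<le> - f (max x \<beta>)"
    proof (rule mono_of_deriv_atLeast[OF DERIV_minus[OF f(4)], where a = x and b = "max x \<beta>"])
      fix y assume y: "x \<le> y" "y \<le> max x \<beta>"
      have "m \<mu> \<le> m y" using y False \<mu> by (intro m_mono) auto
      then show "- (\<kappa> (m y) / w y) \<ge> 0"
        using y that w_pos[of y] c m_le H_nonneg[of "m \<mu>" "m \<beta>" "m y"] by (simp add: \<kappa>_def H_zero)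
    qed (use that in auto)
    then show ?thesis using f(2)[of "max x \<beta>"] by simp
  qed
  have f_pos: "f x > 0" if "\<alpha> < x" "x < \<mu>" for x
  proof -
    have "J (m \<alpha>) (m \<mu>) \<alpha> < J (m \<alpha>) (m \<mu>) x"
      using that w_pos ab by (intro strict_mono_of_deriv_atLeast[OF J])
        (auto intro!: divide_pos_pos H_pos m_strict_mono)
    then show ?thesis using J_mono[of 0 \<alpha> "m \<alpha>" "m \<mu>"] J_0 f_left[of x] c that ab by simp
  qed
  have f_cont: "continuous_on {0..} f" using f(1) by (simp add: Lgraph_def C0_def)
  define \<Phi> where "\<Phi> x = integral {0..x} (\<lambda>x. 2 * w x * f x)" for x
  have \<Phi>: "(\<Phi> has_real_derivative 2 * w x * f x) (at x within {0..})" if "x \<ge> 0" for x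
    unfolding \<Phi>_def by (rule antiderivative_atLeast[OF _ that]) (intro continuous_intros w_cont f_cont)
  have "\<Phi> 0 \<le> \<Phi> \<alpha>" "\<Phi> \<mu> \<le> \<Phi> \<beta>"
    by (rule mono_of_deriv_atLeast[OF \<Phi>]; use ab \<mu> w_pos f_nonneg in \<open>simp add: less_imp_le\<close>)+
  moreover have "\<Phi> \<alpha> < \<Phi> \<mu>"
    using ab \<mu> w_pos f_pos by (intro strict_mono_of_deriv_atLeast[OF \<Phi>]) auto
  moreover have "integral\<^sup>L N f = \<Phi> \<beta> - \<Phi> 0"
    using integrable_compact_support(2)[OF f_cont f(2)] integral_N_FTC[OF \<Phi> f_cont, of \<beta>] \<mu> by simp
  ultimately have I: "integral\<^sup>L N f > 0" by simp
  define c where "c = 1 / integral\<^sup>L N f"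
  have "integral\<^sup>L N (\<lambda>x. c * f x) = 1" using I by (simp add: c_def)
  moreover have "c > 0" using I by (simp add: c_def)
  ultimately show ?thesis
    using that[of "\<lambda>x. c * f x" "\<lambda>x. c * \<kappa>' (m x)"] Lgraph_scale[OF f(1)] f(2,3) f_zero f_nonneg by simp
qed

end

section \<open>Symmetric semigroups generated by \<open>d/dm d/ds\<close>\<close>

lemma C0_lin:
  assumes "f \<in> C0" "g \<in> C0"
  shows "(\<lambda>x. a * f x + c * g x) \<in> C0"
proof -
  have "((\<lambda>x. a * f x + c * g x) \<longlongrightarrow> a * 0 + c * 0) at_top"
    using assms by (intro tendsto_intros) (auto simp: C0_def)
  then show ?thesis using assms by (auto simp: C0_def intro!: continuous_intros)
qed

lemma C0_bounded:
  assumes "f \<in> C0"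
  obtains C where "C \<ge> 0" "\<And>x. x \<ge> 0 \<Longrightarrow> \<bar>f x\<bar> \<le> C"
proof -
  have "\<forall>\<^sub>F x in at_top. \<bar>f x\<bar> < 1"
    using assms order_tendstoD(2)[OF tendsto_rabs, of f 0 at_top 1] by (auto simp: C0_def)
  then obtain R where R: "\<And>x. x \<ge> R \<Longrightarrow> \<bar>f x\<bar> < 1" by (auto simp: eventually_at_top_linorder)
  have "bounded (f ` {0..R})"
    using assms by (intro compact_imp_bounded compact_continuous_image)
      (auto simp: C0_def intro: continuous_on_subset)
  then obtain B where B: "\<And>x. x \<in> {0..R} \<Longrightarrow> \<bar>f x\<bar> \<le> B" by (force simp: bounded_iff)
  show ?thesis
  proof (rule that[of "max 1 B"])
    fix x :: real assume "x \<ge> 0"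
    with R[of x] B[of x] show "\<bar>f x\<bar> \<le> max 1 B" by (cases "x \<le> R") auto
  qed simp
qed

text \<open>What is kept of the process: a positive contraction semigroup on C0 whose generator is
  exactly \<open>Lgraph\<close>. The two growth conditions on \<open>V\<close> control mass escaping
  to infinity. Identities are stated at x \<ge> 0, as functions are arbitrary at negative
  arguments.\<close>

locale reflected_semigroup = speed_scale +
  fixes T :: "real \<Rightarrow> (real \<Rightarrow> real) \<Rightarrow> real \<Rightarrow> real"
  assumes V_top: "filterlim V at_top at_top"
    and m_over_V: "((\<lambda>x. m x / V x) \<longlongrightarrow> 0) at_top"
    and T_C0: "t \<ge> 0 \<Longrightarrow> f \<in> C0 \<Longrightarrow> T t f \<in> C0"
    and T_lin: "t \<ge> 0 \<Longrightarrow> f \<in> C0 \<Longrightarrow> g \<in> C0 \<Longrightarrow> x \<ge> 0 \<Longrightarrow>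
      T t (\<lambda>x. a * f x + c * g x) x = a * T t f x + c * T t g x"
    and T_le_const: "t \<ge> 0 \<Longrightarrow> f \<in> C0 \<Longrightarrow> (\<And>y. y \<ge> 0 \<Longrightarrow> f y \<le> c) \<Longrightarrow> x \<ge> 0 \<Longrightarrow> T t f x \<le> c"
    and T_0: "f \<in> C0 \<Longrightarrow> x \<ge> 0 \<Longrightarrow> T 0 f x = f x"
    and T_semigroup: "r \<ge> 0 \<Longrightarrow> t \<ge> 0 \<Longrightarrow> f \<in> C0 \<Longrightarrow> x \<ge> 0 \<Longrightarrow> T (r + t) f x = T r (T t f) x"
    and Lgraph_iff: "Lgraph f g \<longleftrightarrow> f \<in> C0 \<and> g \<in> C0 \<and>
      uniform_limit {0..} (\<lambda>t x. (T t f x - f x) / t) g (at_right 0)"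
begin

lemma T_mono:
  assumes "t \<ge> 0" "f \<in> C0" "g \<in> C0" "\<And>y. y \<ge> 0 \<Longrightarrow> f y \<le> g y" "x \<ge> 0"
  shows "T t f x \<le> T t g x"
  using T_le_const[OF assms(1) C0_lin[OF assms(2,3), of 1 "-1"], of 0 x]
    T_lin[OF assms(1-3,5), of 1 "-1"] assms(4,5) by simp

lemma T_ge_const:
  assumes "t \<ge> 0" "f \<in> C0" "\<And>y. y \<ge> 0 \<Longrightarrow> c \<le> f y" "x \<ge> 0"
  shows "c \<le> T t f x"
  using T_le_const[OF assms(1) C0_lin[OF assms(2,2), of "-1" 0], of "- c" x]
    T_lin[OF assms(1,2,2,4), of "-1" 0] assms(3,4) by simp

lemma T_abs_le:
  assumes "t \<ge> 0" "f \<in> C0" "\<And>y. y \<ge> 0 \<Longrightarrow> \<bar>f y\<bar> \<le> c" "x \<ge> 0"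
  shows "\<bar>T t f x\<bar> \<le> c"
  using T_le_const[OF assms(1,2), of c x] T_ge_const[OF assms(1,2), of "-c" x] assms(3,4)
  by (simp add: abs_le_iff minus_le_iff)

text \<open>\<open>T t\<close> commutes with \<open>T h\<close> and contracts the sup norm, so
  applying it to the difference quotients of \<open>f\<close> preserves their uniform
  convergence.\<close>

lemma Lgraph_T:
  assumes fg: "Lgraph f g" and t: "t \<ge> 0"
  shows "Lgraph (T t f) (T t g)"
proof -
  have C: "f \<in> C0" "g \<in> C0" using fg by (auto simp: Lgraph_def)
  have "uniform_limit {0..} (\<lambda>h x. (T h (T t f) x - T t f x) / h) (T t g) (at_right 0)"
  proof (rule uniform_limitI)
    fix e :: real assume e: "e > 0"
    have "\<forall>\<^sub>F h in at_right 0. \<forall>x\<in>{0..}. dist ((T h f x - f x) / h) (g x) < e / 2"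
      using fg e unfolding Lgraph_iff uniform_limit_iff by (meson half_gt_zero)
    then show "\<forall>\<^sub>F h in at_right 0. \<forall>x\<in>{0..}. dist ((T h (T t f) x - T t f x) / h) (T t g x) < e"
      using eventually_at_right_less[of 0]
    proof (eventually_elim, intro ballI)
      fix h x :: real
      assume h: "\<forall>x\<in>{0..}. dist ((T h f x - f x) / h) (g x) < e / 2" "0 < h" and x: "x \<in> {0..}"
      \<comment> \<open>The coefficients, including 1 and -1, are written out to match the shape of
        \<open>T_lin\<close> and \<open>C0_lin\<close>.\<close>
      define q where "q y = (1 / h) * T h f y + (- 1 / h) * f y" for y
      define u where "u y = 1 * q y + (- 1) * g y" for y
      have Th: "T h f \<in> C0" using h C by (intro T_C0) auto
      have qC: "q \<in> C0" unfolding q_def by (intro C0_lin Th C)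
      have uC: "u \<in> C0" unfolding u_def by (intro C0_lin qC C)
      have "\<bar>u y\<bar> \<le> e / 2" if "y \<ge> 0" for y
        using h(1)[rule_format, of y] that by (simp add: u_def q_def dist_real_def diff_divide_distrib)
      from T_abs_le[OF t uC this, of x] x have "\<bar>T t u x\<bar> \<le> e / 2" by simp
      moreover have "T t u x = (T t (T h f) x - T t f x) / h - T t g x"
        using T_lin[OF t qC C(2), of x 1 "-1"] T_lin[OF t Th C(1), of x "1 / h" "- 1 / h"] x
        by (simp add: u_def[abs_def] q_def[abs_def] diff_divide_distrib)
      moreover have "T t (T h f) x = T h (T t f) x"
        using T_semigroup[of t h f x] T_semigroup[of h t f x] t h x C by (simp add: add.commute)
      ultimately show "dist ((T h (T t f) x - T t f x) / h) (T t g x) < e"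
        using e by (simp add: dist_real_def)
    qed
  qed
  then show ?thesis unfolding Lgraph_iff using T_C0[OF t] C by blast
qed

text \<open>The first-order expansion at time 0 is carried to time \<open>t\<close> by the
  contraction \<open>T t\<close>, so \<open>d\<close> depends neither on \<open>t\<close> nor on
  \<open>x\<close>.\<close>

lemma T_increment:
  assumes "Lgraph f g" "e > 0"
  shows "\<exists>d>0. \<forall>h t x. 0 < h \<longrightarrow> h < d \<longrightarrow> 0 \<le> t \<longrightarrow> 0 \<le> x \<longrightarrow>
    \<bar>T (t + h) f x - T t f x - h * T t g x\<bar> \<le> e * h"
proof -
  have fg: "f \<in> C0" "g \<in> C0" using assms by (auto simp: Lgraph_def)
  have "\<forall>\<^sub>F h in at_right 0. \<forall>x\<in>{0..}. dist ((T h f x - f x) / h) (g x) < e"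
    using assms unfolding Lgraph_iff uniform_limit_iff by blast
  then obtain d where d: "d > 0"
    "\<And>h x. 0 < h \<Longrightarrow> h < d \<Longrightarrow> 0 \<le> x \<Longrightarrow> \<bar>(T h f x - f x) / h - g x\<bar> < e"
    by (auto simp: eventually_at_right_field dist_real_def)
  have "\<bar>T (t + h) f x - T t f x - h * T t g x\<bar> \<le> e * h" if "0 < h" "h < d" "0 \<le> t" "0 \<le> x" for h t x
  proof -
    define u where "u y = 1 * f y + h * g y" for y
    define v where "v y = 1 * T h f y + (- 1) * u y" for y
    have u: "u \<in> C0" unfolding u_def by (intro C0_lin fg)
    have Th: "T h f \<in> C0" using that fg by (intro T_C0) auto
    have v: "v \<in> C0" unfolding v_def by (intro C0_lin u Th)
    have "\<bar>T t v x\<bar> \<le> e * h"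
    proof (rule T_abs_le[OF \<open>0 \<le> t\<close> v _ \<open>0 \<le> x\<close>])
      fix y :: real assume y: "y \<ge> 0"
      have "v y = ((T h f y - f y) / h - g y) * h"
        using that by (simp add: v_def u_def field_simps)
      then show "\<bar>v y\<bar> \<le> e * h"
        using d(2)[of h y] that y by (simp add: abs_mult mult_right_mono less_imp_le)
    qed
    also have "T t v x = T t (T h f) x - (T t f x + h * T t g x)"
      using T_lin[OF \<open>0 \<le> t\<close> Th u \<open>0 \<le> x\<close>, of 1 "-1"] T_lin[OF \<open>0 \<le> t\<close> fg \<open>0 \<le> x\<close>, of 1 h]
      by (simp add: v_def[abs_def] u_def[abs_def])
    also have "T t (T h f) x = T (t + h) f x"
      using T_semigroup[of t h f x] that fg by simp
    finally show ?thesis by (simp add: algebra_simps)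
  qed
  with d(1) show ?thesis by blast
qed

section \<open>Pairings against the speed measure, Green's identity and L^1 bounds\<close>

definition ip :: "(real \<Rightarrow> real) \<Rightarrow> (real \<Rightarrow> real) \<Rightarrow> real" where
  "ip f g = (\<integral>x. f x * g x \<partial>N)"

lemma ip_commute: "ip f g = ip g f"
  by (simp add: ip_def mult.commute)

text \<open>L^2(m) never appears as a space: a pairing is finite because one factor is bounded and
  the other integrable.\<close>

lemma integrable_C0_mult:
  assumes "f \<in> C0" "integrable N g"
  shows "integrable N (\<lambda>x. f x * g x)"
proof -
  obtain C where "\<And>x. x \<ge> 0 \<Longrightarrow> \<bar>f x\<bar> \<le> C" using C0_bounded[OF assms(1)] by auto
  then show ?thesis
    using assms by (intro integrable_bounded_mult[where C = C]) (auto simp: C0_def)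
qed

lemma ip_bound:
  assumes "continuous_on {0..} f" "\<And>x. x \<ge> 0 \<Longrightarrow> \<bar>f x\<bar> \<le> C" "integrable N g"
  shows "\<bar>ip f g\<bar> \<le> C * (\<integral>x. \<bar>g x\<bar> \<partial>N)"
proof -
  have "\<bar>ip f g\<bar> \<le> (\<integral>x. \<bar>f x * g x\<bar> \<partial>N)"
    unfolding ip_def by (rule integral_abs_bound)
  also have "\<dots> \<le> (\<integral>x. C * \<bar>g x\<bar> \<partial>N)"
  proof (rule integral_mono)
    show "integrable N (\<lambda>x. \<bar>f x * g x\<bar>)"
      using integrable_bounded_mult[OF assms] by (rule integrable_abs)
    show "integrable N (\<lambda>x. C * \<bar>g x\<bar>)" using assms(3) by simp
    show "\<bar>f x * g x\<bar> \<le> C * \<bar>g x\<bar>" if "x \<in> space N" for x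
      using assms(2)[of x] that by (simp add: abs_mult mult_right_mono)
  qed
  finally show ?thesis by simp
qed

lemma ip_lin:
  assumes "f \<in> C0" "g \<in> C0" "integrable N u"
  shows "ip (\<lambda>x. a * f x + c * g x) u = a * ip f u + c * ip g u"
proof -
  have "ip (\<lambda>x. a * f x + c * g x) u = (\<integral>x. a * (f x * u x) + c * (g x * u x) \<partial>N)"
    unfolding ip_def by (rule Bochner_Integration.integral_cong) (auto simp: algebra_simps)
  also have "\<dots> = a * ip f u + c * ip g u"
    using integrable_C0_mult[OF assms(1,3)] integrable_C0_mult[OF assms(2,3)]
    by (simp add: ip_def)
  finally show ?thesis .
qed

text \<open>The error is governed by the L^1 norm of \<open>u\<close>, with one \<open>d\<close> for
  all \<open>u\<close> and \<open>t\<close>; this allows the second factor to depend on time in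
  turn.\<close>

lemma ip_increment:
  assumes "Lgraph f g" "e > 0"
  shows "\<exists>d>0. \<forall>h t u. 0 < h \<longrightarrow> h < d \<longrightarrow> 0 \<le> t \<longrightarrow> integrable N u \<longrightarrow>
    \<bar>ip (T (t + h) f) u - ip (T t f) u - h * ip (T t g) u\<bar> \<le> e * h * (\<integral>x. \<bar>u x\<bar> \<partial>N)"
proof -
  have fg: "f \<in> C0" "g \<in> C0" using assms by (auto simp: Lgraph_def)
  obtain d where d: "d > 0" "\<And>h t x. 0 < h \<Longrightarrow> h < d \<Longrightarrow> 0 \<le> t \<Longrightarrow> 0 \<le> x \<Longrightarrow>
    \<bar>T (t + h) f x - T t f x - h * T t g x\<bar> \<le> e * h"
    using T_increment[OF assms] by blast
  have "\<bar>ip (T (t + h) f) u - ip (T t f) u - h * ip (T t g) u\<bar> \<le> e * h * (\<integral>x. \<bar>u x\<bar> \<partial>N)"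
    if h: "0 < h" "h < d" "0 \<le> t" and u: "integrable N u" for h t u
  proof -
    have C: "T (t + h) f \<in> C0" "T t f \<in> C0" "T t g \<in> C0" using fg h by (auto intro: T_C0)
    define v where "v y = 1 * T t f y + h * T t g y" for y
    have v: "v \<in> C0" unfolding v_def by (intro C0_lin C)
    have w: "(\<lambda>y. 1 * T (t + h) f y + (- 1) * v y) \<in> C0" by (intro C0_lin C v)
    have "ip (\<lambda>y. 1 * T (t + h) f y + (- 1) * v y) u = ip (T (t + h) f) u - (ip (T t f) u + h * ip (T t g) u)"
      using ip_lin[OF C(1) v u, of 1 "-1"] ip_lin[OF C(2,3) u, of 1 h]
      by (simp add: v_def[abs_def])
    moreover have "\<bar>ip (\<lambda>y. 1 * T (t + h) f y + (- 1) * v y) u\<bar> \<le> e * h * (\<integral>x. \<bar>u x\<bar> \<partial>N)"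
      by (rule ip_bound[OF _ _ u])
         (use w d(2)[OF h] in \<open>auto simp: C0_def v_def algebra_simps\<close>)
    ultimately show ?thesis by (simp add: algebra_simps)
  qed
  with d(1) show ?thesis by blast
qed

text \<open>The integrand is the dm-derivative of v l - u k, since the cross terms k l / w cancel.
  Both fluxes vanish at 0, so only the right end contributes.\<close>

lemma green_interval:
  assumes v: "\<And>x. x \<ge> 0 \<Longrightarrow> (v has_real_derivative k x / w x) (at x within {0..})"
    "\<And>x. x \<ge> 0 \<Longrightarrow> (k has_real_derivative 2 * w x * a x) (at x within {0..})" "k 0 = 0"
    "continuous_on {0..} a"
   and u: "\<And>x. x \<ge> 0 \<Longrightarrow> (u has_real_derivative l x / w x) (at x within {0..})"
    "\<And>x. x \<ge> 0 \<Longrightarrow> (l has_real_derivative 2 * w x * c x) (at x within {0..})" "l 0 = 0"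
    "continuous_on {0..} c"
   and "R \<ge> 0"
  shows "(LINT x:{0..R}|N. v x * c x - u x * a x) = v R * l R - u R * k R"
proof -
  have "(LINT x:{0..R}|N. v x * c x - u x * a x) = (v R * l R - u R * k R) - (v 0 * l 0 - u 0 * k 0)"
  proof (rule integral_N_FTC[where F = "\<lambda>x. v x * l x - u x * k x"])
    fix x :: real assume x: "x \<ge> 0"
    show "((\<lambda>x. v x * l x - u x * k x) has_real_derivative 2 * w x * (v x * c x - u x * a x)) (at x within {0..})"
      using DERIV_diff[OF DERIV_mult[OF v(1)[OF x] u(2)[OF x]] DERIV_mult[OF u(1)[OF x] v(2)[OF x]]]
      by (rule DERIV_cong) (simp add: algebra_simps)
  qed (use assms continuous_on_of_deriv_atLeast[OF v(1)] continuous_on_of_deriv_atLeast[OF u(1)]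
      in \<open>auto intro!: continuous_intros\<close>)
  then show ?thesis using v u by simp
qed

text \<open>Reflection at 0 makes the flux the integral of \<open>a\<close> over [0, x]. Multiplied
  by a function tending to 0, such a bounded flux gives a vanishing boundary term at
  infinity.\<close>

lemma flux_bound:
  assumes k: "\<And>x. x \<ge> 0 \<Longrightarrow> (k has_real_derivative 2 * w x * a x) (at x within {0..})" "k 0 = 0"
    "continuous_on {0..} a" and a: "integrable N a" and "x \<ge> 0"
  shows "\<bar>k x\<bar> \<le> (\<integral>x. \<bar>a x\<bar> \<partial>N)"
proof -
  have "k x = (LINT x:{0..x}|N. a x)"
    using integral_N_FTC[OF k(1,3) \<open>x \<ge> 0\<close>] k(2) by simp
  also have "\<bar>\<dots>\<bar> \<le> (LINT x:{0..x}|N. \<bar>a x\<bar>)"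
    using set_integral_norm_bound[OF set_integrable_interval[OF k(3)], of x] by simp
  also have "\<dots> \<le> (\<integral>x. \<bar>a x\<bar> \<partial>N)"
    unfolding set_lebesgue_integral_def
    by (rule integral_mono)
       (use set_integrable_interval[of "\<lambda>x. \<bar>a x\<bar>" x] k(3) a in
         \<open>auto simp: set_integrable_def indicator_def intro!: continuous_intros\<close>)
  finally show ?thesis .
qed

text \<open>Compact support of \<open>u\<close> removes the boundary term at infinity, so the
  identity is available before any L^1 bound on the semigroup is known.\<close>

lemma green_compact:
  assumes "Lgraph v a" "Lgraph u c" "\<And>x. x \<ge> R \<Longrightarrow> u x = 0" "\<And>x. x \<ge> R \<Longrightarrow> c x = 0"
  shows "ip a u = ip v c"
proof -
  obtain k where k: "v \<in> C0" "a \<in> C0" "k 0 = 0"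
    "\<And>x. x \<ge> 0 \<Longrightarrow> (v has_real_derivative k x / w x) (at x within {0..})"
    "\<And>x. x \<ge> 0 \<Longrightarrow> (k has_real_derivative 2 * w x * a x) (at x within {0..})"
    using assms(1) by (auto simp: Lgraph_def)
  obtain l where l: "u \<in> C0" "c \<in> C0" "l 0 = 0"
    "\<And>x. x \<ge> 0 \<Longrightarrow> (u has_real_derivative l x / w x) (at x within {0..})"
    "\<And>x. x \<ge> 0 \<Longrightarrow> (l has_real_derivative 2 * w x * c x) (at x within {0..})"
    using assms(2) by (auto simp: Lgraph_def)
  have cont: "continuous_on {0..} v" "continuous_on {0..} a" "continuous_on {0..} u" "continuous_on {0..} c"
    using k l by (auto simp: C0_def)
  \<comment> \<open>Strictly beyond \<open>R\<close>, and positive, so that \<open>u\<close>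
    vanishes in a neighbourhood and its derivative at \<open>R'\<close> is two-sided; hence the flux
    \<open>l\<close> is 0 there.\<close>
  define R' where "R' = max 0 R + 1"
  have R': "R' > 0" "R' > R" by (auto simp: R'_def)
  have "(u has_real_derivative 0) (at R')"
    by (rule has_field_derivative_transform_within_open[where f = "\<lambda>_. 0" and S = "{R<..}"])
       (use R' assms(3) in auto)
  moreover have "(u has_real_derivative l R' / w R') (at R')"
    using l(4)[of R'] R' by (simp add: at_within_interior[of R' "{0..}"])
  ultimately have "l R' / w R' = 0" using DERIV_unique by blast
  then have lR: "l R' = 0" using w_pos[of R'] R' by simp
  have uR: "u R' = 0" using assms(3) R' by simp
  have u_int: "integrable N u" "integrable N c"
    using integrable_compact_support(1)[OF cont(3) assms(3)] integrable_compact_support(1)[OF cont(4) assms(4)] by auto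
  have "ip v c - ip a u = (\<integral>x. v x * c x - u x * a x \<partial>N)"
    using integrable_C0_mult[OF k(1) u_int(2)] integrable_C0_mult[OF k(2) u_int(1)]
    by (simp add: ip_def mult.commute[of "u _"])
  also have "\<dots> = (LINT x:{0..R'}|N. v x * c x - u x * a x)"
    by (rule integrable_compact_support(2)) (use cont assms(3,4) R' in \<open>auto intro!: continuous_intros\<close>)
  also have "\<dots> = 0"
    using green_interval[OF k(4,5,3) cont(2) l(4,5,3) cont(4), of R'] R' lR uR by simp
  finally show ?thesis by simp
qed

text \<open>The boundary terms v l and u k vanish at infinity because the fluxes stay bounded by L^1
  norms while \<open>v\<close> and \<open>u\<close> tend to 0.\<close>

lemma green:
  assumes "Lgraph v a" "Lgraph u c" "integrable N v" "integrable N a" "integrable N u" "integrable N c"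
  shows "ip a u = ip v c"
proof -
  obtain k where k: "v \<in> C0" "a \<in> C0" "k 0 = 0"
    "\<And>x. x \<ge> 0 \<Longrightarrow> (v has_real_derivative k x / w x) (at x within {0..})"
    "\<And>x. x \<ge> 0 \<Longrightarrow> (k has_real_derivative 2 * w x * a x) (at x within {0..})"
    using assms(1) by (auto simp: Lgraph_def)
  obtain l where l: "u \<in> C0" "c \<in> C0" "l 0 = 0"
    "\<And>x. x \<ge> 0 \<Longrightarrow> (u has_real_derivative l x / w x) (at x within {0..})"
    "\<And>x. x \<ge> 0 \<Longrightarrow> (l has_real_derivative 2 * w x * c x) (at x within {0..})"
    using assms(2) by (auto simp: Lgraph_def)
  have cont: "continuous_on {0..} v" "continuous_on {0..} a" "continuous_on {0..} u" "continuous_on {0..} c"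
    using k l by (auto simp: C0_def)
  have int: "integrable N (\<lambda>x. v x * c x)" "integrable N (\<lambda>x. u x * a x)"
    using integrable_C0_mult[OF k(1) assms(6)] integrable_C0_mult[OF l(1) assms(4)] .
  have lim: "((\<lambda>R. LINT x:{0..R}|N. v x * c x - u x * a x) \<longlongrightarrow> (\<integral>x. v x * c x - u x * a x \<partial>N)) at_top"
    by (intro integral_N_exhaust Bochner_Integration.integrable_diff int)
  have lim0: "((\<lambda>R. v R * l R - u R * k R) \<longlongrightarrow> 0) at_top"
  proof (rule Lim_null_comparison)
    show "\<forall>\<^sub>F R in at_top. norm (v R * l R - u R * k R) \<le>
        \<bar>v R\<bar> * (\<integral>x. \<bar>c x\<bar> \<partial>N) + \<bar>u R\<bar> * (\<integral>x. \<bar>a x\<bar> \<partial>N)"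
      using eventually_ge_at_top[of 0]
    proof eventually_elim
      fix R :: real assume R: "0 \<le> R"
      have "\<bar>v R * l R\<bar> \<le> \<bar>v R\<bar> * (\<integral>x. \<bar>c x\<bar> \<partial>N)" "\<bar>u R * k R\<bar> \<le> \<bar>u R\<bar> * (\<integral>x. \<bar>a x\<bar> \<partial>N)"
        using flux_bound[OF l(5,3) cont(4) assms(6) R] flux_bound[OF k(5,3) cont(2) assms(4) R]
        by (auto simp: abs_mult intro!: mult_left_mono)
      then show "norm (v R * l R - u R * k R) \<le> \<bar>v R\<bar> * (\<integral>x. \<bar>c x\<bar> \<partial>N) + \<bar>u R\<bar> * (\<integral>x. \<bar>a x\<bar> \<partial>N)"
        by simp
    qed
    have "((\<lambda>R. \<bar>v R\<bar> * (\<integral>x. \<bar>c x\<bar> \<partial>N) + \<bar>u R\<bar> * (\<integral>x. \<bar>a x\<bar> \<partial>N)) \<longlongrightarrow>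
        \<bar>0\<bar> * (\<integral>x. \<bar>c x\<bar> \<partial>N) + \<bar>0\<bar> * (\<integral>x. \<bar>a x\<bar> \<partial>N)) at_top"
      using k(1) l(1) by (intro tendsto_intros) (auto simp: C0_def)
    then show "((\<lambda>R. \<bar>v R\<bar> * (\<integral>x. \<bar>c x\<bar> \<partial>N) + \<bar>u R\<bar> * (\<integral>x. \<bar>a x\<bar> \<partial>N)) \<longlongrightarrow> 0) at_top" by simp
  qed
  have ev: "\<forall>\<^sub>F R in at_top. (LINT x:{0..R}|N. v x * c x - u x * a x) = v R * l R - u R * k R"
    using eventually_ge_at_top[of 0]
    by eventually_elim (rule green_interval[OF k(4,5,3) cont(2) l(4,5,3) cont(4)])
  have "(\<integral>x. v x * c x - u x * a x \<partial>N) = 0"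
    by (rule tendsto_unique[OF trivial_limit_at_top_linorder lim]) (simp only: tendsto_cong[OF ev] lim0)
  then show ?thesis using int by (simp add: ip_def mult.commute[of "u _"])
qed

text \<open>Pairing with truncated Lyapunov functions \<open>F\<close>: the functions \<open>F / F 0\<close> increase to \<open>1\<close>, while
  their images under the generator tend to \<open>0\<close> in \<open>L\<^sup>1\<close> because \<open>m / V\<close> tends to \<open>0\<close>.\<close>

lemma mass_interval_le:
  assumes f: "Lgraph f g" "\<And>x. x \<ge> 0 \<Longrightarrow> f x \<ge> 0" "integrable N f" and t: "t \<ge> 0" and a: "a \<ge> 0"
  shows "(LINT x:{0..a}|N. T t f x) \<le> integral\<^sup>L N f"
proof -
  have fg: "f \<in> C0" "g \<in> C0" using f(1) by (auto simp: Lgraph_def)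
  obtain C where C: "C \<ge> 0" "\<And>x. x \<ge> 0 \<Longrightarrow> \<bar>f x\<bar> \<le> C" using C0_bounded[OF fg(1)] by auto
  have Tf_nonneg: "T t f x \<ge> 0" if "x \<ge> 0" "t \<ge> 0" for t x
    using T_ge_const[OF that(2) fg(1) f(2) that(1)] .
  have Tf_cont: "continuous_on {0..} (T t f)" if "t \<ge> 0" for t
    using T_C0[OF that fg(1)] by (simp add: C0_def)
  define I where "I = (LINT x:{0..a}|N. T t f x)"
  have bound: "I * (1 - V a / V Y) \<le> integral\<^sup>L N f + t * C * (2 * (m Y + 1)) / V Y"
    if Y: "Y \<ge> 0" "V Y > V a" for Y
  proof -
    obtain F G Y' where F: "Lgraph F G" "Y' \<ge> Y" "m Y' = m Y + 1"
      "\<And>x. x \<ge> Y' \<Longrightarrow> F x = 0" "\<And>x. x \<ge> Y' \<Longrightarrow> G x = 0"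
      "\<And>x. x \<ge> 0 \<Longrightarrow> 0 \<le> F x" "\<And>x. x \<ge> 0 \<Longrightarrow> F x \<le> F 0" "\<And>x. x \<ge> 0 \<Longrightarrow> F 0 - V x \<le> F x"
      "\<And>x. x \<ge> 0 \<Longrightarrow> - 1 \<le> G x" "V Y \<le> F 0" "(\<integral>x. \<bar>G x\<bar> \<partial>N) \<le> 2 * (m Y + 1)"
      using truncated_lyapunov[OF Y(1)] by blast
    have FC: "F \<in> C0" "G \<in> C0" using F(1) by (auto simp: Lgraph_def)
    have Fi: "integrable N F" "integrable N G"
      using integrable_compact_support(1)[OF _ F(4)] integrable_compact_support(1)[OF _ F(5)] FC
      by (auto simp: C0_def)
    define K where "K = C * (2 * (m Y + 1))"
    \<comment> \<open>The growth rate of the pairing with \<open>F\<close> is moved onto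
      \<open>G\<close>, where the sup bound \<open>C\<close> on \<open>T r f\<close> suffices;
      integrability of \<open>T r f\<close> is not yet known.\<close>
    have gb: "ip (T r g) F \<le> K" if "r \<ge> 0" for r
    proof -
      have "ip (T r g) F = ip (T r f) G"
        by (rule green_compact[OF Lgraph_T[OF f(1) that] F(1,4,5)])
      also have "\<bar>\<dots>\<bar> \<le> C * (\<integral>x. \<bar>G x\<bar> \<partial>N)"
        by (rule ip_bound[OF Tf_cont[OF that] T_abs_le[OF that fg(1) C(2)] Fi(2)])
      also have "\<dots> \<le> K" unfolding K_def by (intro mult_left_mono F(11) C(1))
      finally show ?thesis by simp
    qed
    have "ip (T t f) F - ip (T 0 f) F \<le> K * t"
    proof (rule increment_bound[OF t])
      fix e :: real assume e: "e > 0"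
      \<comment> \<open>Dividing by \<open>B + 1\<close> rather than \<open>B\<close> avoids having
        to bound \<open>B\<close> away from 0.\<close>
      define B where "B = (\<integral>x. \<bar>F x\<bar> \<partial>N)"
      have B: "B \<ge> 0" by (simp add: B_def)
      obtain d where d: "d > 0" "\<And>h t. 0 < h \<Longrightarrow> h < d \<Longrightarrow> 0 \<le> t \<Longrightarrow>
        \<bar>ip (T (t + h) f) F - ip (T t f) F - h * ip (T t g) F\<bar> \<le> e / (B + 1) * h * B"
        using ip_increment[OF f(1), of "e / (B + 1)"] Fi(1) e B unfolding B_def by auto
      have "ip (T (r + h) f) F - ip (T r f) F \<le> (K + e) * h" if h: "0 \<le> r" "0 < h" "h < d" for r h
      proof -
        have "e / (B + 1) * h * B \<le> e * h"
          using e h B by (simp add: field_simps)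
        moreover have "h * ip (T r g) F \<le> h * K" using gb[OF h(1)] h by simp
        ultimately show ?thesis using d(2)[OF h(2,3,1)] by (simp add: algebra_simps abs_le_iff)
      qed
      with d(1) show "\<exists>d>0. \<forall>r h. 0 \<le> r \<longrightarrow> 0 < h \<longrightarrow> h < d \<longrightarrow> r + h \<le> t \<longrightarrow>
        ip (T (r + h) f) F - ip (T r f) F \<le> (K + e) * h" by blast
    qed
    moreover have "ip (T 0 f) F \<le> F 0 * integral\<^sup>L N f"
    proof -
      have "ip (T 0 f) F = (\<integral>x. F x * f x \<partial>N)"
        unfolding ip_def by (rule Bochner_Integration.integral_cong) (auto simp: T_0[OF fg(1)])
      also have "\<dots> \<le> (\<integral>x. F 0 * f x \<partial>N)"
        by (rule integral_mono) (use integrable_C0_mult[OF FC(1) f(3)] f(2,3) F(7) in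
            \<open>auto intro!: mult_right_mono\<close>)
      finally show ?thesis by simp
    qed
    \<comment> \<open>On [0, a] one has \<open>F x \<ge> F 0 - V a\<close>, elsewhere
      \<open>F\<close> is nonnegative, and so is \<open>T t f\<close>.\<close>
    moreover have "(F 0 - V a) * I \<le> ip (T t f) F"
    proof -
      have "(F 0 - V a) * I = (\<integral>x. (F 0 - V a) * (indicator {0..a} x * T t f x) \<partial>N)"
        by (simp add: I_def set_lebesgue_integral_def)
      also have "\<dots> \<le> (\<integral>x. T t f x * F x \<partial>N)"
      proof (rule integral_mono)
        show "integrable N (\<lambda>x. (F 0 - V a) * (indicator {0..a} x * T t f x))"
          using set_integrable_interval[OF Tf_cont[OF t], of a] by (simp add: set_integrable_def)
        show "integrable N (\<lambda>x. T t f x * F x)"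
          by (rule integrable_C0_mult[OF T_C0[OF t fg(1)] Fi(1)])
        fix x assume "x \<in> space N"
        then have x: "x \<ge> 0" by simp
        have "(F 0 - V a) * T t f x \<le> F x * T t f x" if "x \<le> a"
          using F(8)[OF x] V_mono[OF x that] Tf_nonneg[OF x t] by (intro mult_right_mono) auto
        then show "(F 0 - V a) * (indicator {0..a} x * T t f x) \<le> T t f x * F x"
          using F(6)[OF x] Tf_nonneg[OF x t] x by (auto simp: indicator_def mult.commute)
      qed
      finally show ?thesis by (simp add: ip_def)
    qed
    ultimately have *: "(F 0 - V a) * I \<le> F 0 * integral\<^sup>L N f + t * K" by (simp add: mult.commute)
    have VY: "V Y > 0" using Y V_nonneg[OF a] by simp
    then have F0: "F 0 > 0" using F(10) by simp
    have I: "I \<ge> 0"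
      unfolding I_def set_lebesgue_integral_def
      by (rule integral_nonneg_AE) (auto simp: indicator_def intro!: always_eventually Tf_nonneg t)
    have "I * (1 - V a / F 0) \<le> integral\<^sup>L N f + t * K / F 0"
      using divide_right_mono[OF *, of "F 0"] F0
      by (simp add: add_divide_distrib diff_divide_distrib left_diff_distrib right_diff_distrib mult.commute)
    moreover have "I * (1 - V a / V Y) \<le> I * (1 - V a / F 0)"
      using I VY F(10) V_nonneg[OF a] by (intro mult_left_mono diff_mono divide_left_mono) auto
    moreover have "t * K / F 0 \<le> t * K / V Y"
      using VY F(10) t C(1) m_nonneg[OF Y(1)] by (intro divide_left_mono) (auto simp: K_def)
    ultimately show ?thesis by (simp add: K_def mult.assoc)
  qed
  have V_inv: "((\<lambda>Y. inverse (V Y)) \<longlongrightarrow> 0) at_top"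
    by (rule tendsto_inverse_0_at_top[OF V_top])
  have "((\<lambda>Y. I * (1 - V a * inverse (V Y))) \<longlongrightarrow> I * (1 - V a * 0)) at_top"
    by (intro tendsto_intros V_inv)
  moreover have "((\<lambda>Y. integral\<^sup>L N f + t * C * 2 * (m Y / V Y + inverse (V Y))) \<longlongrightarrow>
      integral\<^sup>L N f + t * C * 2 * (0 + 0)) at_top"
    by (intro tendsto_intros V_inv m_over_V)
  moreover have "\<forall>\<^sub>F Y in at_top. I * (1 - V a * inverse (V Y)) \<le>
      integral\<^sup>L N f + t * C * 2 * (m Y / V Y + inverse (V Y))"
    using eventually_ge_at_top[of 0] filterlim_at_top_dense[THEN iffD1, OF V_top, rule_format, of "V a"]
  proof eventually_elim
    case (elim Y)
    from bound[OF elim] show ?case by (simp add: divide_inverse algebra_simps)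
  qed
  ultimately have "I * (1 - V a * 0) \<le> integral\<^sup>L N f + t * C * 2 * (0 + 0)"
    by (intro tendsto_le[OF trivial_limit_at_top_linorder])
  then show ?thesis by (simp add: I_def)
qed

text \<open>The masses of \<open>T t f\<close> on [0, n] increase and stay below that of
  \<open>f\<close>; monotone convergence turns this into integrability.\<close>

lemma L1_contraction:
  assumes f: "Lgraph f g" "\<And>x. x \<ge> 0 \<Longrightarrow> f x \<ge> 0" "integrable N f" and t: "t \<ge> 0"
  shows "integrable N (T t f)" "integral\<^sup>L N (T t f) \<le> integral\<^sup>L N f"
proof -
  have fC: "f \<in> C0" using f(1) by (auto simp: Lgraph_def)
  have nonneg: "T t f x \<ge> 0" if "x \<ge> 0" for x
    using T_ge_const[OF t fC f(2) that] .
  have cont: "continuous_on {0..} (T t f)"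
    using T_C0[OF t fC] by (simp add: C0_def)
  define J where "J n = (LINT x:{0..real n}|N. T t f x)" for n
  have "incseq J"
    unfolding J_def set_lebesgue_integral_def incseq_def
    by (intro allI impI integral_mono)
       (use set_integrable_interval[OF cont] nonneg in \<open>auto simp: set_integrable_def indicator_def\<close>)
  then obtain L where L: "J \<longlonglongrightarrow> L"
    using mass_interval_le[OF f t] by (auto intro: incseq_convergent[of J "integral\<^sup>L N f"] simp: J_def)
  show int: "integrable N (T t f)"
  proof (rule integrable_monotone_convergence[where f = "\<lambda>n x. indicator {0..real n} x *\<^sub>R T t f x"])
    show "(\<lambda>n. \<integral>x. indicator {0..real n} x *\<^sub>R T t f x \<partial>N) \<longlonglongrightarrow> L"
      using L by (simp add: J_def[abs_def] set_lebesgue_integral_def)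
    show "AE x in N. (\<lambda>n. indicator {0..real n} x *\<^sub>R T t f x) \<longlonglongrightarrow> T t f x"
    proof (rule AE_I2)
      fix x assume x: "x \<in> space N"
      have "\<forall>\<^sub>F n in sequentially. indicator {0..real n} x *\<^sub>R T t f x = T t f x"
        using eventually_ge_at_top[of "nat \<lceil>x\<rceil>"]
        by eventually_elim (use x in \<open>auto simp: indicator_def\<close>)
      then show "(\<lambda>n. indicator {0..real n} x *\<^sub>R T t f x) \<longlonglongrightarrow> T t f x"
        by (rule tendsto_eventually)
    qed
  qed (use set_integrable_interval[OF cont] nonneg measurable_N[OF cont] in
      \<open>auto simp: set_integrable_def indicator_def mono_def\<close>)
  show "integral\<^sup>L N (T t f) \<le> integral\<^sup>L N f"
  proof (rule tendsto_upperbound[OF integral_N_exhaust[OF int]])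
    show "\<forall>\<^sub>F a in at_top. (LINT x:{0..a}|N. T t f x) \<le> integral\<^sup>L N f"
      using eventually_ge_at_top[of 0] by eventually_elim (rule mass_interval_le[OF f t])
  qed simp
qed

text \<open>Stated for all compactly supported elements of C0, because it is applied to images under
  the generator as well. Such an \<open>f\<close> is dominated by a multiple of a truncated Lyapunov
  function \<open>F\<close>; positivity gives |T t f| \<le> c T t F, and
  \<open>L1_contraction\<close> controls \<open>T t F\<close>.\<close>

lemma L1_bound:
  assumes "f \<in> C0" "\<And>x. x \<ge> R \<Longrightarrow> f x = 0"
  obtains B where "B \<ge> 0" "\<And>t. t \<ge> 0 \<Longrightarrow> integrable N (T t f)"
    "\<And>t. t \<ge> 0 \<Longrightarrow> (\<integral>x. \<bar>T t f x\<bar> \<partial>N) \<le> B"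
proof -
  define R' where "R' = max 0 R"
  \<comment> \<open>Taking \<open>V Y\<close> above \<open>V R'\<close> makes \<open>F\<close> at
    least \<open>V Y - V R'\<close>, a positive number, on [0, R'].\<close>
  obtain Y where Y: "Y \<ge> 0" "V Y > V R'"
    using eventually_conj[OF eventually_ge_at_top[of 0] filterlim_at_top_dense[THEN iffD1, OF V_top, rule_format, of "V R'"]]
    by (auto simp: eventually_at_top_linorder)
  obtain F G Y' where F: "Lgraph F G" "\<And>x. x \<ge> Y' \<Longrightarrow> F x = 0" "\<And>x. x \<ge> 0 \<Longrightarrow> 0 \<le> F x"
    "\<And>x. x \<ge> 0 \<Longrightarrow> F 0 - V x \<le> F x" "V Y \<le> F 0"
    using truncated_lyapunov[OF Y(1)] by blast
  obtain C where C: "C \<ge> 0" "\<And>x. x \<ge> 0 \<Longrightarrow> \<bar>f x\<bar> \<le> C" using C0_bounded[OF assms(1)] by auto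
  define d where "d = V Y - V R'"
  have d: "d > 0" using Y by (simp add: d_def)
  have FC: "F \<in> C0" using F(1) by (simp add: Lgraph_def)
  have Fi: "integrable N F"
    using integrable_compact_support(1)[OF _ F(2)] FC by (auto simp: C0_def)
  define c where "c = C / d"
  have c: "c \<ge> 0" using C d by (simp add: c_def)
  have dom: "\<bar>f x\<bar> \<le> c * F x" if "x \<ge> 0" for x
  proof (cases "x \<le> R'")
    case True
    have "d \<le> F x" using F(4)[OF that] F(5) V_mono[OF that True] by (simp add: d_def)
    then have "c * d \<le> c * F x" using c by (rule mult_left_mono)
    then show ?thesis using C(2)[OF that] d by (simp add: c_def)
  next
    case False
    then show ?thesis using assms(2)[of x] F(3)[OF that] c by (simp add: R'_def)
  qed
  have Tdom: "\<bar>T t f x\<bar> \<le> c * T t F x" if "t \<ge> 0" "x \<ge> 0" for t x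
  proof -
    have lin: "T t (\<lambda>x. c * F x + 0 * F x) x = c * T t F x" "T t (\<lambda>x. (-c) * F x + 0 * F x) x = - c * T t F x"
      using T_lin[OF that(1) FC FC that(2), of c 0] T_lin[OF that(1) FC FC that(2), of "-c" 0] by auto
    have "T t f x \<le> T t (\<lambda>x. c * F x + 0 * F x) x"
      using dom that by (intro T_mono assms(1) C0_lin FC) (auto simp: abs_le_iff)
    moreover have "T t (\<lambda>x. (-c) * F x + 0 * F x) x \<le> T t f x"
    proof (intro T_mono assms(1) C0_lin FC that)
      fix y :: real assume "y \<ge> 0"
      then show "- c * F y + 0 * F y \<le> f y" using dom[of y] by (simp add: abs_le_iff)
    qed
    ultimately show ?thesis using lin by (simp add: abs_le_iff)
  qed
  have TF: "integrable N (T t F)" "integral\<^sup>L N (T t F) \<le> integral\<^sup>L N F" if "t \<ge> 0" for t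
    using L1_contraction[OF F(1,3) Fi that] by auto
  have int: "integrable N (T t f)" if "t \<ge> 0" for t
  proof (rule Bochner_Integration.integrable_bound[where f = "\<lambda>x. c * T t F x"])
    show "T t f \<in> borel_measurable N"
      using T_C0[OF that assms(1)] by (intro measurable_N) (simp add: C0_def)
    show "AE x in N. norm (T t f x) \<le> norm (c * T t F x)"
      by (rule AE_I2) (use Tdom[OF that] in \<open>force simp: abs_le_iff\<close>)
  qed (use TF that in auto)
  show ?thesis
  proof (rule that[of "c * integral\<^sup>L N F"])
    show "c * integral\<^sup>L N F \<ge> 0"
    proof (intro mult_nonneg_nonneg c integral_nonneg_AE AE_I2)
      fix x assume "x \<in> space N"
      then show "0 \<le> F x" by (simp add: F(3))
    qed
    show "(\<integral>x. \<bar>T t f x\<bar> \<partial>N) \<le> c * integral\<^sup>L N F" if "t \<ge> 0" for t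
    proof -
      have "(\<integral>x. \<bar>T t f x\<bar> \<partial>N) \<le> (\<integral>x. c * T t F x \<partial>N)"
        by (rule integral_mono) (use Tdom[OF that] int[OF that] TF(1)[OF that] in auto)
      also have "\<dots> \<le> c * integral\<^sup>L N F" using TF(2)[OF that] c by (simp add: mult_left_mono)
      finally show ?thesis .
    qed
  qed (use int in auto)
qed

end

section \<open>Symmetry, energy and oscillation of the semigroup\<close>

context reflected_semigroup
begin

text \<open>The compactly supported part of the domain. Compact support may be lost under
  \<open>T\<close>, so what is carried along in time is integrability of \<open>T t f\<close> and
  \<open>T t g\<close>.\<close>

definition Dc :: "(real \<Rightarrow> real) \<Rightarrow> (real \<Rightarrow> real) \<Rightarrow> bool" where
  "Dc f g \<longleftrightarrow> Lgraph f g \<and> (\<exists>R. \<forall>x\<ge>R. f x = 0 \<and> g x = 0)"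

lemma Dc_C0: "Dc f g \<Longrightarrow> f \<in> C0" "Dc f g \<Longrightarrow> g \<in> C0"
  by (auto simp: Dc_def Lgraph_def)

lemma Dc_T_bound:
  assumes "Dc f g"
  obtains B where "B \<ge> 0" "\<And>t. t \<ge> 0 \<Longrightarrow> integrable N (T t f)"
    "\<And>t. t \<ge> 0 \<Longrightarrow> (\<integral>x. \<bar>T t f x\<bar> \<partial>N) \<le> B"
  using L1_bound[OF Dc_C0(1)[OF assms]] assms unfolding Dc_def by blast

lemma Dc_integrable:
  assumes "Dc f g" "t \<ge> 0"
  shows "integrable N (T t f)" "integrable N (T t g)" "integrable N f"
proof -
  obtain R where R: "\<And>x. x \<ge> R \<Longrightarrow> f x = 0" "\<And>x. x \<ge> R \<Longrightarrow> g x = 0"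
    using assms(1) by (auto simp: Dc_def)
  show "integrable N (T t f)" "integrable N (T t g)"
    using L1_bound[OF Dc_C0(1)[OF assms(1)] R(1)] L1_bound[OF Dc_C0(2)[OF assms(1)] R(2)] assms(2)
    by metis+
  show "integrable N f"
    using integrable_compact_support(1)[OF _ R(1)] Dc_C0(1)[OF assms(1)] by (simp add: C0_def)
qed

lemma ip_T_0: "f \<in> C0 \<Longrightarrow> ip (T 0 f) u = ip f u"
  unfolding ip_def by (rule Bochner_Integration.integral_cong) (auto simp: T_0)

text \<open>By Green's identity the pairing of \<open>T r f\<close> with \<open>T (c - r) u\<close> has zero derivative in \<open>r\<close>.\<close>

lemma pairing_increment:
  assumes f: "Dc f g" and u: "Dc u v" and e: "e > 0"
  shows "\<exists>d>0. \<forall>\<rho> h. 0 \<le> \<rho> \<longrightarrow> 0 < h \<longrightarrow> h < d \<longrightarrow> \<rho> + h \<le> c \<longrightarrow>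
    \<bar>ip (T (\<rho> + h) f) (T (c - (\<rho> + h)) u) - ip (T \<rho> f) (T (c - \<rho>) u)\<bar> \<le> e * h"
proof -
  obtain A where A: "A \<ge> 0" "\<And>t. t \<ge> 0 \<Longrightarrow> (\<integral>x. \<bar>T t f x\<bar> \<partial>N) \<le> A"
    using Dc_T_bound[OF f] by metis
  obtain B where B: "B \<ge> 0" "\<And>t. t \<ge> 0 \<Longrightarrow> (\<integral>x. \<bar>T t u x\<bar> \<partial>N) \<le> B"
    using Dc_T_bound[OF u] by metis
  have L: "Lgraph f g" "Lgraph u v" using f u by (auto simp: Dc_def)
  \<comment> \<open>The two first-order errors carry L^1 norms bounded by \<open>B\<close> and
    \<open>A\<close>, so with this choice they add up to at most \<open>e * h\<close>.\<close>
  define e' where "e' = e / (A + B + 1)"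
  have e': "e' > 0" using e A(1) B(1) by (simp add: e'_def)
  have e'_eq: "e' * (A + B + 1) = e"
    using A(1) B(1) by (simp add: e'_def)
  obtain d1 where d1: "d1 > 0" "\<And>h t q. 0 < h \<Longrightarrow> h < d1 \<Longrightarrow> 0 \<le> t \<Longrightarrow> integrable N q \<Longrightarrow>
      \<bar>ip (T (t + h) f) q - ip (T t f) q - h * ip (T t g) q\<bar> \<le> e' * h * (\<integral>x. \<bar>q x\<bar> \<partial>N)"
    using ip_increment[OF L(1) e'] by blast
  obtain d2 where d2: "d2 > 0" "\<And>h t q. 0 < h \<Longrightarrow> h < d2 \<Longrightarrow> 0 \<le> t \<Longrightarrow> integrable N q \<Longrightarrow>
      \<bar>ip (T (t + h) u) q - ip (T t u) q - h * ip (T t v) q\<bar> \<le> e' * h * (\<integral>x. \<bar>q x\<bar> \<partial>N)"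
    using ip_increment[OF L(2) e'] by blast
  have main: "\<bar>ip (T (\<rho> + h) f) (T (c - (\<rho> + h)) u) - ip (T \<rho> f) (T (c - \<rho>) u)\<bar> \<le> e * h"
    if h: "0 \<le> \<rho>" "0 < h" "h < min d1 d2" "\<rho> + h \<le> c" for \<rho> h
  proof -
    \<comment> \<open>One factor is moved at a time: \<open>f\<close> from \<rho> to \<rho> + h
      against \<open>T r' u\<close>, and \<open>u\<close> from r' to r' + h against
      \<open>T \<rho> f\<close>. The two first-order terms agree by Green's identity and
      cancel.\<close>
    define r' where "r' = c - (\<rho> + h)"
    have r': "r' \<ge> 0" "c - \<rho> = r' + h" using h by (auto simp: r'_def)
    have int: "integrable N (T r' u)" "integrable N (T r' v)" "integrable N (T \<rho> f)" "integrable N (T \<rho> g)"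
      using Dc_integrable[OF f h(1)] Dc_integrable[OF u r'(1)] by auto
    have "\<bar>ip (T (\<rho> + h) f) (T r' u) - ip (T \<rho> f) (T r' u) - h * ip (T \<rho> g) (T r' u)\<bar>
        \<le> e' * h * (\<integral>x. \<bar>T r' u x\<bar> \<partial>N)"
      by (rule d1(2)[OF h(2) _ h(1) int(1)]) (use h in simp)
    also have "\<dots> \<le> e' * h * B" using e' h B(2)[OF r'(1)] by (intro mult_left_mono) auto
    finally have 1: "\<bar>ip (T (\<rho> + h) f) (T r' u) - ip (T \<rho> f) (T r' u) - h * ip (T \<rho> g) (T r' u)\<bar>
        \<le> e' * h * B" .
    have "\<bar>ip (T (r' + h) u) (T \<rho> f) - ip (T r' u) (T \<rho> f) - h * ip (T r' v) (T \<rho> f)\<bar>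
        \<le> e' * h * (\<integral>x. \<bar>T \<rho> f x\<bar> \<partial>N)"
      by (rule d2(2)[OF h(2) _ r'(1) int(3)]) (use h in simp)
    also have "\<dots> \<le> e' * h * A" using e' h A(2)[OF h(1)] by (intro mult_left_mono) auto
    finally have 2: "\<bar>ip (T (r' + h) u) (T \<rho> f) - ip (T r' u) (T \<rho> f) - h * ip (T r' v) (T \<rho> f)\<bar>
        \<le> e' * h * A" .
    have 3: "ip (T \<rho> g) (T r' u) = ip (T \<rho> f) (T r' v)"
      by (rule green[OF Lgraph_T[OF L(1) h(1)] Lgraph_T[OF L(2) r'(1)] int(3,4,1,2)])
    have "\<bar>ip (T (\<rho> + h) f) (T r' u) - ip (T \<rho> f) (T (r' + h) u)\<bar> \<le> e' * h * B + e' * h * A"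
      using 1 2 3 ip_commute[of "T (r' + h) u"] ip_commute[of "T r' u"] ip_commute[of "T r' v"] by simp
    also have "\<dots> \<le> e' * h * (A + B + 1)" using e' h by (simp add: algebra_simps)
    also have "\<dots> = e' * (A + B + 1) * h" by (simp only: mult_ac)
    also have "\<dots> = e * h" by (simp only: e'_eq)
    finally show ?thesis unfolding r'(2) r'_def .
  qed
  show ?thesis
  proof (rule exI[where x = "min d1 d2"], intro conjI allI impI)
    show "0 < min d1 d2" using d1(1) d2(1) by simp
    fix \<rho> h assume "0 \<le> \<rho>" "0 < h" "h < min d1 d2" "\<rho> + h \<le> c"
    then show "\<bar>ip (T (\<rho> + h) f) (T (c - (\<rho> + h)) u) - ip (T \<rho> f) (T (c - \<rho>) u)\<bar> \<le> e * h"
      by (rule main)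
  qed
qed

lemma pairing_const:
  assumes f: "Dc f g" and u: "Dc u v" and r: "0 \<le> r" "r \<le> c"
  shows "ip (T r f) (T (c - r) u) = ip f (T c u)"
proof -
  define \<Phi> where "\<Phi> r = ip (T r f) (T (c - r) u)" for r
  have inc: "\<exists>d>0. \<forall>\<rho> h. 0 \<le> \<rho> \<longrightarrow> 0 < h \<longrightarrow> h < d \<longrightarrow> \<rho> + h \<le> r \<longrightarrow> \<bar>\<Phi> (\<rho> + h) - \<Phi> \<rho>\<bar> \<le> e * h"
    if "e > 0" for e
    using pairing_increment[OF f u that, of c] r unfolding \<Phi>_def by (meson order_trans)
  \<comment> \<open>The increments are o(h) uniformly, so \<open>increment_bound\<close> with
    \<open>K = 0\<close> applies to \<Phi> and to -\<Phi>.\<close>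
  have "\<Phi> r - \<Phi> 0 \<le> 0 * r"
    by (rule increment_bound[OF r(1)]) (use inc in \<open>fastforce simp: abs_le_iff\<close>)
  moreover have "- \<Phi> r - - \<Phi> 0 \<le> 0 * r"
    by (rule increment_bound[OF r(1), where F = "\<lambda>r. - \<Phi> r"]) (use inc in \<open>fastforce simp: abs_le_iff\<close>)
  ultimately show ?thesis using ip_T_0[OF Dc_C0(1)[OF f]] by (simp add: \<Phi>_def)
qed

lemma T_symmetric:
  assumes f: "Dc f g" and u: "Dc u v" and t: "t \<ge> 0"
  shows "ip (T t f) u = ip f (T t u)"
  using pairing_const[OF f u t order_refl] ip_T_0[OF Dc_C0(1)[OF u]] ip_commute[of _ u]
    ip_commute[of _ "T 0 u"] by simp

text \<open>Every product collapses to a value of \<open>ip (T u f) f\<close> at the sum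
  \<open>u\<close> of the times; in particular these values are squared norms at half the
  time.\<close>

lemma ip_T_T:
  assumes f: "Dc f g" and a: "a \<ge> 0" "b \<ge> 0"
  shows "ip (T a f) (T b f) = ip (T (a + b) f) f"
  using pairing_const[OF f f, of a "a + b"] a T_symmetric[OF f f, of "a + b"] by simp

lemma ip_diff_square:
  assumes "f \<in> C0" "g \<in> C0" "integrable N f" "integrable N g"
  shows "0 \<le> ip f f - 2 * x * ip f g + x\<^sup>2 * ip g g"
proof -
  have int: "integrable N (\<lambda>y. f y * f y)" "integrable N (\<lambda>y. f y * g y)" "integrable N (\<lambda>y. g y * g y)"
    using assms by (auto intro: integrable_C0_mult)
  have "0 \<le> (\<integral>y. (f y - x * g y)\<^sup>2 \<partial>N)" by simp
  also have "\<dots> = (\<integral>y. f y * f y - 2 * x * (f y * g y) + x\<^sup>2 * (g y * g y) \<partial>N)"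
    by (rule Bochner_Integration.integral_cong) (auto simp: power2_eq_square algebra_simps)
  also have "\<dots> = ip f f - 2 * x * ip f g + x\<^sup>2 * ip g g"
    using int by (simp add: ip_def)
  finally show ?thesis .
qed

lemma ip_nonneg_self: "0 \<le> ip f f"
  unfolding ip_def by (rule integral_nonneg_AE) auto

lemma ip_Cauchy_Schwarz:
  assumes "f \<in> C0" "g \<in> C0" "integrable N f" "integrable N g"
  shows "(ip f g)\<^sup>2 \<le> ip g g * ip f f"
  by (rule discriminant_le) (use ip_diff_square[OF assms] ip_nonneg_self in \<open>auto simp: algebra_simps\<close>)

text \<open>The convexity of \<open>ip (T t f) f\<close> in \<open>t\<close> is the positivity of squares \<open>\<integral>(T a f - T b f)\<^sup>2\<close>.\<close>

lemma energy_bound: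
  assumes f: "Dc f g" and t: "t > 0"
  shows "- ip (T t f) (T t g) \<le> ip (T t f) f / t"
proof (rule field_le_epsilon)
  fix e :: real assume e: "e > 0"
  have L: "Lgraph f g" using f by (simp add: Dc_def)
  have fC: "f \<in> C0" by (rule Dc_C0(1)[OF f])
  note int = Dc_integrable(1)[OF f]
  define B where "B = (\<integral>x. \<bar>T t f x\<bar> \<partial>N)"
  have B: "B \<ge> 0" by (simp add: B_def)
  define e' where "e' = e / (B + 1)"
  have e': "e' > 0" "e' * B \<le> e" using e B by (auto simp: e'_def field_simps)
  obtain d where d: "d > 0" "\<And>h. 0 < h \<Longrightarrow> h < d \<Longrightarrow>
      \<bar>ip (T (t + h) f) (T t f) - ip (T t f) (T t f) - h * ip (T t g) (T t f)\<bar> \<le> e' * h * B"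
    using ip_increment[OF L e'(1)] int[OF less_imp_le[OF t]] t unfolding B_def by (meson less_imp_le)
  obtain n :: nat where n: "t / d < real n" using reals_Archimedean2 by blast
  have n0: "n > 0" using n t d(1) by (metis divide_pos_pos of_nat_0_less_iff order_less_trans)
  define h where "h = t / n"
  have h: "h > 0" "h < d" "n * h = t"
    using n0 t d(1) n by (auto simp: h_def field_simps)
  \<comment> \<open>The grid starts at time \<open>t\<close>, not 0, so \<open>a n\<close> sits at
    time 2 t. There \<open>a n\<close> is the squared norm of \<open>T t f\<close>, and its
    decrement is to first order \<open>h\<close> times the energy
    \<open>- ip (T t f) (T t g)\<close>.\<close>
  define a where "a j = ip (T (t + real j * h) f) f" for j :: nat
  have ip_a: "ip (T ((t + real i * h) / 2) f) (T ((t + real k * h) / 2) f) = ip (T (t + real (i + k) / 2 * h) f) f"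
    for i k :: nat
  proof -
    have "(t + real i * h) / 2 + (t + real k * h) / 2 = t + real (i + k) / 2 * h"
      by (simp add: field_simps)
    then show ?thesis
      using ip_T_T[OF f, of "(t + real i * h) / 2" "(t + real k * h) / 2"] t h by simp
  qed
  \<comment> \<open>The square is taken at half the grid times \<open>j\<close> and
    \<open>j + 2\<close>, so that its mixed term lands on \<open>j + 1\<close>.\<close>
  have cv: "a j - 2 * a (Suc j) + a (Suc (Suc j)) \<ge> 0" for j
  proof -
    have nn: "(t + real i * h) / 2 \<ge> 0" for i :: nat using t h by simp
    have "0 \<le> ip (T ((t + real j * h) / 2) f) (T ((t + real j * h) / 2) f)
        - 2 * 1 * ip (T ((t + real j * h) / 2) f) (T ((t + real (j + 2) * h) / 2) f)
        + 1\<^sup>2 * ip (T ((t + real (j + 2) * h) / 2) f) (T ((t + real (j + 2) * h) / 2) f)"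
      by (intro ip_diff_square T_C0 nn fC int)
    moreover have "real (j + j) / 2 = real j" "real (j + (j + 2)) / 2 = real (Suc j)"
      "real (j + 2 + (j + 2)) / 2 = real (Suc (Suc j))" by auto
    ultimately show ?thesis unfolding ip_a a_def by (simp only: mult_1 mult_1_right power_one)
  qed
  have a_nonneg: "a j \<ge> 0" for j
    using ip_nonneg_self[of "T ((t + real j * h) / 2) f"] unfolding ip_a by (simp add: a_def)
  have "real n * (a n - a (Suc n)) \<le> a 0"
    by (rule convex_sequence_decrement[where a = a, OF cv a_nonneg])
  moreover have "a n = ip (T t f) (T t f)" "a (Suc n) = ip (T (t + h) f) (T t f)" "a 0 = ip (T t f) f"
    using ip_T_T[OF f, of t t] ip_T_T[OF f, of "t + h" t] t h by (auto simp: a_def algebra_simps)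
  ultimately have 1: "n * (ip (T t f) (T t f) - ip (T (t + h) f) (T t f)) \<le> ip (T t f) f" by simp
  have "h * - ip (T t g) (T t f) \<le> ip (T t f) (T t f) - ip (T (t + h) f) (T t f) + e' * B * h"
    using d(2)[OF h(1,2)] by (simp add: abs_le_iff algebra_simps)
  then have "n * (h * - ip (T t g) (T t f)) \<le> n * (ip (T t f) (T t f) - ip (T (t + h) f) (T t f) + e' * B * h)"
    by (rule mult_left_mono) simp
  also have "\<dots> \<le> ip (T t f) f + e' * B * (n * h)" using 1 by (simp add: algebra_simps)
  also have "\<dots> \<le> ip (T t f) f + e * t" using e' t h(3) by simp
  finally have "t * - ip (T t g) (T t f) \<le> ip (T t f) f + e * t" 
    using h(3) by (simp add: mult.assoc[symmetric])
  then show "- ip (T t f) (T t g) \<le> ip (T t f) f / t + e"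
    using t ip_commute[of "T t g"] by (simp add: field_simps)
qed

text \<open>An increment of \<open>v\<close> is the ds-integral of its flux \<open>k\<close>, so
  Cauchy-Schwarz bounds its square by the ds-length times the ds-integral of k^2; by Green's
  identity this energy is at most \<open>- ip v a\<close>.\<close>

lemma oscillation_bound_aux:
  assumes v: "Lgraph v a" "integrable N v" "integrable N a" and y: "0 \<le> y" "y \<le> z"
  shows "(v z - v y)\<^sup>2 \<le> - ip v a * (s z - s y)"
proof -
  obtain k where k: "v \<in> C0" "a \<in> C0" "k 0 = 0"
    "\<And>x. x \<ge> 0 \<Longrightarrow> (v has_real_derivative k x / w x) (at x within {0..})"
    "\<And>x. x \<ge> 0 \<Longrightarrow> (k has_real_derivative 2 * w x * a x) (at x within {0..})"
    using v(1) by (auto simp: Lgraph_def)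
  have cont: "continuous_on {0..} v" "continuous_on {0..} a" using k by (auto simp: C0_def)
  define Q where "Q x = integral {0..x} (\<lambda>x. 2 * w x * (v x * a x))" for x
  have Q: "(Q has_real_derivative 2 * w x * (v x * a x)) (at x within {0..})" if "x \<ge> 0" for x
    unfolding Q_def by (rule antiderivative_atLeast[OF _ that]) (intro continuous_intros w_cont cont)
  have Q0: "Q 0 = 0" by (simp add: Q_def)
  \<comment> \<open>The energy on [0, x] after integration by parts: dE/ds = k^2 and
    \<open>E 0 = 0\<close>.\<close>
  define E where "E x = v x * k x - Q x" for x
  have E: "(E has_real_derivative (k x)\<^sup>2 / w x) (at x within {0..})" if "x \<ge> 0" for x
    unfolding E_def[abs_def] using DERIV_diff[OF DERIV_mult[OF k(4,5)[OF that]] Q[OF that]]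
    by (rule DERIV_cong) (simp add: power2_eq_square algebra_simps)
  have E_mono: "E x \<le> E y" if "0 \<le> x" "x \<le> y" for x y
    by (rule mono_of_deriv_atLeast[OF E]) (use that w_pos in \<open>auto simp: less_imp_le\<close>)
  have E_top: "E x \<le> - ip v a" if "x \<ge> 0" for x
  proof (rule tendsto_lowerbound[where F = at_top and f = E])
    have "((\<lambda>R. LINT x:{0..R}|N. v x * a x) \<longlongrightarrow> ip v a) at_top"
      unfolding ip_def by (intro integral_N_exhaust integrable_C0_mult k v)
    moreover have ev: "\<forall>\<^sub>F R in at_top. Q R = (LINT x:{0..R}|N. v x * a x)"
      using eventually_ge_at_top[of 0]
    proof eventually_elim
      case (elim R)
      have "(LINT x:{0..R}|N. v x * a x) = Q R - Q 0"
        by (rule integral_N_FTC[OF Q _ elim]) (auto intro!: continuous_intros cont)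
      then show ?case using Q0 by simp
    qed
    ultimately have "(Q \<longlongrightarrow> ip v a) at_top" by (simp add: tendsto_cong[OF ev])
    moreover have "((\<lambda>R. v R * k R) \<longlongrightarrow> 0) at_top"
    proof (rule Lim_null_comparison)
      show "\<forall>\<^sub>F R in at_top. norm (v R * k R) \<le> \<bar>v R\<bar> * (\<integral>x. \<bar>a x\<bar> \<partial>N)"
        using eventually_ge_at_top[of 0]
        by eventually_elim (use flux_bound[OF k(5,3) cont(2) v(3)] in \<open>auto simp: abs_mult intro!: mult_left_mono\<close>)
      have "((\<lambda>R. \<bar>v R\<bar> * (\<integral>x. \<bar>a x\<bar> \<partial>N)) \<longlongrightarrow> \<bar>0\<bar> * (\<integral>x. \<bar>a x\<bar> \<partial>N)) at_top"
        using k(1) by (intro tendsto_intros) (auto simp: C0_def)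
      then show "((\<lambda>R. \<bar>v R\<bar> * (\<integral>x. \<bar>a x\<bar> \<partial>N)) \<longlongrightarrow> 0) at_top" by simp
    qed
    ultimately have "((\<lambda>R. v R * k R - Q R) \<longlongrightarrow> 0 - ip v a) at_top" by (intro tendsto_diff)
    then show "(E \<longlongrightarrow> - ip v a) at_top" by (simp add: E_def[abs_def])
    show "\<forall>\<^sub>F y in at_top. E x \<le> E y"
      using eventually_ge_at_top[of x] by eventually_elim (rule E_mono[OF that])
  qed simp
  \<comment> \<open>The quadratic in \<open>x\<close> is the ds-integral of (x k - 1)^2 over [y, z],
    expressed through antiderivatives; its discriminant is Cauchy-Schwarz.\<close>
  have "0 \<le> (E z - E y) * x\<^sup>2 - 2 * (v z - v y) * x + (s z - s y)" for x
  proof -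
    have "x\<^sup>2 * E y - 2 * x * v y + s y \<le> x\<^sup>2 * E z - 2 * x * v z + s z"
    proof (rule mono_of_deriv_atLeast[where f = "\<lambda>y. x\<^sup>2 * E y - 2 * x * v y + s y" and a = y and b = z
          and f' = "\<lambda>y. (x * k y - 1)\<^sup>2 / w y"])
      fix y :: real assume y: "y \<ge> 0"
      show "((\<lambda>y. x\<^sup>2 * E y - 2 * x * v y + s y) has_real_derivative (x * k y - 1)\<^sup>2 / w y) (at y within {0..})"
        using DERIV_add[OF DERIV_diff[OF DERIV_cmult[OF E[OF y], of "x\<^sup>2"] DERIV_cmult[OF k(4)[OF y], of "2 * x"]] s_deriv[OF y]]
        by (rule DERIV_cong) (use w_pos[OF y] in \<open>simp add: power2_eq_square field_simps\<close>)
    next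
      fix x' assume "y \<le> x'" "x' \<le> z"
      then show "0 \<le> (x * k x' - 1)\<^sup>2 / w x'" using w_pos[of x'] y by simp
    qed (use y in auto)
    then show ?thesis by (simp add: algebra_simps)
  qed
  then have "(v z - v y)\<^sup>2 \<le> (E z - E y) * (s z - s y)"
    by (rule discriminant_le) (use E_mono y in auto)
  also have "\<dots> \<le> - ip v a * (s z - s y)"
  proof (rule mult_right_mono)
    have "E y \<ge> 0" using E_mono[of 0 y] y k(3) Q0 by (simp add: E_def)
    then show "E z - E y \<le> - ip v a" using E_top[of z] y by simp
  qed (use s_mono y in auto)
  finally show ?thesis .
qed

lemma oscillation_bound:
  assumes f: "Dc f g" and t: "t > 0" and y: "0 \<le> y" "0 \<le> z"
  shows "(T t f z - T t f y)\<^sup>2 \<le> ip (T t f) f / t * \<bar>s z - s y\<bar>"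
proof -
  have L: "Lgraph (T t f) (T t g)" using Lgraph_T f t by (auto simp: Dc_def)
  note int = Dc_integrable[OF f, of t]
  have *: "(T t f z - T t f y)\<^sup>2 \<le> ip (T t f) f / t * \<bar>s z - s y\<bar>" if "0 \<le> y" "y \<le> z" for y z
  proof -
    have "(T t f z - T t f y)\<^sup>2 \<le> - ip (T t f) (T t g) * (s z - s y)"
      using oscillation_bound_aux[OF L _ _ that] int t by simp
    also have "\<dots> \<le> ip (T t f) f / t * (s z - s y)"
      using energy_bound[OF f t] s_mono[OF that] by (intro mult_right_mono) auto
    finally show ?thesis using s_mono[OF that] by simp
  qed
  show ?thesis
    using *[of y z] *[of z y] y by (cases "y \<le> z") (auto simp: power2_commute abs_minus_commute)
qed

text \<open>Cauchy-Schwarz for \<open>T t f\<close> against \<open>F\<close>, which stands in for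
  \<open>F 0\<close> times the indicator of [0, Y]. The squared norm of \<open>T t f\<close> is the
  return quantity at 2 t, that of \<open>F\<close> is at most
  \<open>(F 0)\<^sup>2 * (m Y + 1)\<close>, and the pairing is at least
  \<open>F 0 - V z - t\<close>.\<close>

lemma return_lower_bound:
  assumes f: "Dc f g" "\<And>x. x \<ge> 0 \<Longrightarrow> f x \<ge> 0" "\<And>x. x \<ge> z \<Longrightarrow> f x = 0" "integral\<^sup>L N f = 1"
    and t: "t \<ge> 0" and Y: "Y \<ge> 0" "V z + t \<le> V Y" "V Y > 0" and z: "z \<ge> 0"
  shows "(1 - (V z + t) / V Y)\<^sup>2 \<le> ip (T (2 * t) f) f * (m Y + 1)"
proof -
  obtain F G Y' where F: "Lgraph F G" "Y' \<ge> Y" "m Y' = m Y + 1"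
    "\<And>x. x \<ge> Y' \<Longrightarrow> F x = 0" "\<And>x. x \<ge> Y' \<Longrightarrow> G x = 0"
    "\<And>x. x \<ge> 0 \<Longrightarrow> 0 \<le> F x" "\<And>x. x \<ge> 0 \<Longrightarrow> F x \<le> F 0" "\<And>x. x \<ge> 0 \<Longrightarrow> F 0 - V x \<le> F x"
    "\<And>x. x \<ge> 0 \<Longrightarrow> - 1 \<le> G x" "V Y \<le> F 0"
    using truncated_lyapunov[OF Y(1)] by blast
  have D: "Dc F G" using F by (auto simp: Dc_def)
  have C: "F \<in> C0" "G \<in> C0" "f \<in> C0" using Dc_C0[OF D] Dc_C0[OF f(1)] by auto
  have F0: "F 0 > 0" using F(10) Y by simp
  \<comment> \<open>Since \<open>G \<ge> - 1\<close> and \<open>T\<close> preserves this bound,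
    \<open>T t F\<close> loses at most one unit per unit of time.\<close>
  have low: "T t F x \<ge> F x - t" if x: "x \<ge> 0" for x
  proof -
    have "- T t F x - - T 0 F x \<le> 1 * t"
    proof (rule increment_bound[OF t, where F = "\<lambda>t. - T t F x"])
      fix e :: real assume "e > 0"
      then obtain d where d: "d > 0" "\<And>h t. 0 < h \<Longrightarrow> h < d \<Longrightarrow> 0 \<le> t \<Longrightarrow>
          \<bar>T (t + h) F x - T t F x - h * T t G x\<bar> \<le> e * h"
        using T_increment[OF F(1)] x by meson
      have "- T (r + h) F x - - T r F x \<le> (1 + e) * h" if "0 \<le> r" "0 < h" "h < d" for r h
      proof -
        have "h * T r G x \<ge> h * -1"
          using that T_ge_const[OF that(1) C(2) F(9) x] by (intro mult_left_mono) auto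
        then show ?thesis using d(2)[OF that(2,3,1)] by (simp add: abs_le_iff algebra_simps)
      qed
      with d(1) show "\<exists>d>0. \<forall>r h. 0 \<le> r \<longrightarrow> 0 < h \<longrightarrow> h < d \<longrightarrow> r + h \<le> t \<longrightarrow>
          - T (r + h) F x - - T r F x \<le> (1 + e) * h" by blast
    qed
    then show ?thesis using T_0[OF C(1) x] by simp
  qed
  note intf = Dc_integrable[OF f(1) order_refl] and intF = Dc_integrable[OF D order_refl]
  \<comment> \<open>A lower bound for \<open>T t F\<close> on [0, z], where \<open>f\<close> lives
    and \<open>F x \<ge> F 0 - V z\<close>.\<close>
  define q where "q = F 0 - V z - t"
  have q: "q \<ge> 0" using F(10) Y by (simp add: q_def)
  have "q = (\<integral>x. q * f x \<partial>N)" using f(4) by simp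
  also have "\<dots> \<le> (\<integral>x. f x * T t F x \<partial>N)"
  proof (rule integral_mono)
    show "integrable N (\<lambda>x. f x * T t F x)"
      by (rule integrable_C0_mult[OF C(3) Dc_integrable(1)[OF D t]])
    fix x assume "x \<in> space N"
    then have x: "x \<ge> 0" by simp
    show "q * f x \<le> f x * T t F x"
    proof (cases "x \<ge> z")
      case False
      then have "q \<le> T t F x"
        using low[OF x] F(8)[OF x] V_mono[OF x, of z] by (simp add: q_def)
      then have "q * f x \<le> T t F x * f x" by (rule mult_right_mono[OF _ f(2)[OF x]])
      then show ?thesis by (simp only: mult.commute)
    qed (use f(3) in auto)
  qed (use intf in auto)
  also have "\<dots> = ip (T t f) F"
    using T_symmetric[OF f(1) D t] by (simp add: ip_def)
  finally have "q\<^sup>2 \<le> (ip (T t f) F)\<^sup>2" using q by (intro power_mono) auto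
  also have "\<dots> \<le> ip F F * ip (T t f) (T t f)"
    using T_C0[OF t C(3)] C Dc_integrable(1)[OF f(1) t] intF by (intro ip_Cauchy_Schwarz) auto
  also have "ip (T t f) (T t f) = ip (T (2 * t) f) f"
    using ip_T_T[OF f(1) t t] by simp
  also have "ip F F * ip (T (2 * t) f) f \<le> ((F 0)\<^sup>2 * (m Y + 1)) * ip (T (2 * t) f) f"
  proof (rule mult_right_mono)
    have "ip F F = (LINT x:{0..Y'}|N. F x * F x)"
      unfolding ip_def by (rule integrable_compact_support)
        (use C F(4) in \<open>auto simp: C0_def intro!: continuous_intros\<close>)
    also have "\<dots> \<le> (LINT x:{0..Y'}|N. (F 0)\<^sup>2)"
    proof (rule set_integral_mono)
      fix x assume "x \<in> {0..Y'}"
      then show "F x * F x \<le> (F 0)\<^sup>2"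
        using F(6,7)[of x] by (auto simp: power2_eq_square intro!: mult_mono)
    qed (use C in \<open>auto intro!: set_integrable_interval continuous_intros simp: C0_def\<close>)
    also have "\<dots> = (F 0)\<^sup>2 * m Y' - (F 0)\<^sup>2 * m 0"
    proof (rule integral_N_FTC[where F = "\<lambda>x. (F 0)\<^sup>2 * m x"])
      show "((\<lambda>x. (F 0)\<^sup>2 * m x) has_real_derivative 2 * w x * (F 0)\<^sup>2) (at x within {0..})" if "x \<ge> 0" for x
        using DERIV_cmult[OF m_deriv[OF that], of "(F 0)\<^sup>2"] by (rule DERIV_cong) simp
    qed (use Y(1) F(2) in auto)
    finally show "ip F F \<le> (F 0)\<^sup>2 * (m Y + 1)" by (simp add: m_0 F(3))
    show "0 \<le> ip (T (2 * t) f) f"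
      using ip_nonneg_self[of "T t f"] ip_T_T[OF f(1) t t] by simp
  qed
  finally have "q\<^sup>2 / (F 0)\<^sup>2 \<le> ip (T (2 * t) f) f * (m Y + 1)"
    using F0 by (simp add: field_simps)
  moreover have "(1 - (V z + t) / V Y)\<^sup>2 \<le> (q / F 0)\<^sup>2"
  proof (rule power_mono)
    have "(V z + t) / F 0 \<le> (V z + t) / V Y"
      using F(10) Y V_nonneg[OF z] t F0 by (intro divide_left_mono) auto
    then show "1 - (V z + t) / V Y \<le> q / F 0"
      using F0 by (simp add: q_def diff_divide_distrib add_divide_distrib)
    show "0 \<le> 1 - (V z + t) / V Y" using Y by simp
  qed
  ultimately show ?thesis by (simp add: power_divide)
qed

end

section \<open>The transition density\<close>

locale reflected_density = reflected_semigroup +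
  fixes p :: "real \<Rightarrow> real \<Rightarrow> real \<Rightarrow> real"
  assumes p_nonneg: "t > 0 \<Longrightarrow> x \<ge> 0 \<Longrightarrow> y \<ge> 0 \<Longrightarrow> p t x y \<ge> 0"
    and p_cont: "t > 0 \<Longrightarrow> continuous_on ({0..} \<times> {0..}) (\<lambda>(x, y). p t x y)"
    and p_int: "t > 0 \<Longrightarrow> x \<ge> 0 \<Longrightarrow> integrable N (p t x)"
    and p_total: "t > 0 \<Longrightarrow> x \<ge> 0 \<Longrightarrow> integral\<^sup>L N (p t x) = 1"
    and T_density: "t > 0 \<Longrightarrow> x \<ge> 0 \<Longrightarrow> f \<in> C0 \<Longrightarrow> T t f x = (\<integral>y. p t x y * f y \<partial>N)"
begin

text \<open>An approximate unit mass at \<open>x\<close> taken from the domain. It sits to the right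
  of \<open>x\<close>, so that \<open>x = 0\<close> is no exception, and \<open>Suc n\<close> gives
  a window also for \<open>n = 0\<close>.\<close>

definition bump :: "real \<Rightarrow> nat \<Rightarrow> real \<Rightarrow> real" where
  "bump x n = (SOME f. (\<exists>g. Dc f g) \<and> (\<forall>y\<ge>0. f y \<ge> 0) \<and> (\<forall>y\<ge>x + 1 / Suc n. f y = 0) \<and>
     (\<forall>y. 0 \<le> y \<longrightarrow> y \<le> x \<longrightarrow> f y = 0) \<and> integral\<^sup>L N f = 1)"

lemma bump:
  assumes "x \<ge> 0"
  shows "\<exists>g. Dc (bump x n) g" "\<And>y. y \<ge> 0 \<Longrightarrow> bump x n y \<ge> 0"
    "\<And>y. y \<ge> x + 1 / Suc n \<Longrightarrow> bump x n y = 0" "\<And>y. 0 \<le> y \<Longrightarrow> y \<le> x \<Longrightarrow> bump x n y = 0"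
    "integral\<^sup>L N (bump x n) = 1"
proof -
  obtain f g where f: "Lgraph f g" "\<And>y. y \<ge> 0 \<Longrightarrow> f y \<ge> 0"
    "\<And>y. y \<ge> x + 1 / Suc n \<Longrightarrow> f y = 0" "\<And>y. y \<ge> x + 1 / Suc n \<Longrightarrow> g y = 0"
    "\<And>y. 0 \<le> y \<Longrightarrow> y \<le> x \<Longrightarrow> f y = 0" "integral\<^sup>L N f = 1"
    using bump_function[OF assms, of "x + 1 / Suc n"] by auto
  then have "\<exists>f. (\<exists>g. Dc f g) \<and> (\<forall>y\<ge>0. f y \<ge> 0) \<and> (\<forall>y\<ge>x + 1 / Suc n. f y = 0) \<and>
     (\<forall>y. 0 \<le> y \<longrightarrow> y \<le> x \<longrightarrow> f y = 0) \<and> integral\<^sup>L N f = 1"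
    unfolding Dc_def by blast
  from someI_ex[OF this]
  have *: "(\<exists>g. Dc (bump x n) g) \<and> (\<forall>y\<ge>0. bump x n y \<ge> 0) \<and> (\<forall>y\<ge>x + 1 / Suc n. bump x n y = 0) \<and>
     (\<forall>y. 0 \<le> y \<longrightarrow> y \<le> x \<longrightarrow> bump x n y = 0) \<and> integral\<^sup>L N (bump x n) = 1"
    unfolding bump_def .
  then show "\<exists>g. Dc (bump x n) g" "\<And>y. y \<ge> 0 \<Longrightarrow> bump x n y \<ge> 0"
    "\<And>y. y \<ge> x + 1 / Suc n \<Longrightarrow> bump x n y = 0" "\<And>y. 0 \<le> y \<Longrightarrow> y \<le> x \<Longrightarrow> bump x n y = 0"
    "integral\<^sup>L N (bump x n) = 1"
    by blast+
qed

lemma bump_C0: "x \<ge> 0 \<Longrightarrow> bump x n \<in> C0"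
  using bump(1)[of x n] Dc_C0 by blast

lemma bump_integrable: "x \<ge> 0 \<Longrightarrow> integrable N (bump x n)"
  using bump(1)[of x n] Dc_integrable(3)[OF _ order_refl] by blast

lemma bump_average:
  assumes x: "x \<ge> 0" and F: "integrable N (\<lambda>z. F z * bump x n z)"
    and near: "\<And>z. x \<le> z \<Longrightarrow> z \<le> x + 1 / Suc n \<Longrightarrow> \<bar>F z - c\<bar> \<le> e"
  shows "\<bar>(\<integral>z. F z * bump x n z \<partial>N) - c\<bar> \<le> e"
proof -
  have "\<bar>(\<integral>z. F z * bump x n z \<partial>N) - c\<bar> = \<bar>\<integral>z. F z * bump x n z - c * bump x n z \<partial>N\<bar>"
    using F bump_integrable[OF x] bump(5)[OF x] by simp
  also have "\<dots> \<le> (\<integral>z. \<bar>F z * bump x n z - c * bump x n z\<bar> \<partial>N)"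
    by (rule integral_abs_bound)
  also have "\<dots> \<le> (\<integral>z. e * bump x n z \<partial>N)"
  proof (rule integral_mono)
    fix z assume "z \<in> space N"
    then have z: "z \<ge> 0" by simp
    show "\<bar>F z * bump x n z - c * bump x n z\<bar> \<le> e * bump x n z"
    proof (cases "x \<le> z \<and> z \<le> x + 1 / Suc n")
      case True
      then have "\<bar>F z - c\<bar> * bump x n z \<le> e * bump x n z"
        using bump(2)[OF x z, of n] near[of z] by (intro mult_right_mono) auto
      moreover have "\<bar>F z * bump x n z - c * bump x n z\<bar> = \<bar>F z - c\<bar> * bump x n z"
        using bump(2)[OF x z, of n] by (simp add: left_diff_distrib[symmetric] abs_mult)
      ultimately show ?thesis by simp
    next
      case False
      then have "bump x n z = 0" using bump(3)[OF x, of n z] bump(4)[OF x z, of n] by linarith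
      then show ?thesis by simp
    qed
  qed (use F bump_integrable[OF x, of n] in auto)
  also have "\<dots> = e" using bump(5)[OF x] by simp
  finally show ?thesis .
qed

lemma p_cont_snd:
  assumes "t > 0" "x \<ge> 0"
  shows "continuous_on {0..} (p t x)"
proof -
  have "continuous_on {0..} ((\<lambda>(x, y). p t x y) \<circ> (\<lambda>y. (x, y)))"
    by (rule continuous_on_compose[OF _ continuous_on_subset[OF p_cont[OF assms(1)]]])
       (use assms in \<open>auto intro!: continuous_intros\<close>)
  then show ?thesis by (simp add: o_def)
qed

lemma p_times_integrable:
  assumes "t > 0" "x \<ge> 0" "f \<in> C0"
  shows "integrable N (\<lambda>y. p t x y * f y)"
  using integrable_C0_mult[OF assms(3) p_int[OF assms(1,2)]] by (simp add: mult.commute)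

text \<open>Joint continuity of \<open>p t\<close> at (y, x). Closeness is uniform over a window to
  the right of \<open>y\<close>, so the result serves evaluation at \<open>y\<close> as well as
  pairing with a second bump.\<close>

lemma T_bump_approx:
  assumes t: "t > 0" and x: "x \<ge> 0" and y: "y \<ge> 0" and e: "e > 0"
  shows "\<exists>n0. \<forall>n\<ge>n0. \<forall>z. y \<le> z \<longrightarrow> z \<le> y + 1 / Suc n \<longrightarrow> \<bar>T t (bump x n) z - p t y x\<bar> \<le> e"
proof -
  have "(y, x) \<in> {0..} \<times> {0..}" using x y by simp
  with p_cont[OF t] e obtain d where d: "d > 0"
    "\<And>q. q \<in> {0..} \<times> {0..} \<Longrightarrow> dist q (y, x) < d \<Longrightarrow>
       dist (case q of (x, y) \<Rightarrow> p t x y) (case (y, x) of (x, y) \<Rightarrow> p t x y) < e"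
    unfolding continuous_on_iff by meson
  obtain n0 :: nat where n0: "2 / d < real n0" using reals_Archimedean2 by blast
  have n0_pos: "real n0 > 0" using n0 d(1) by (meson divide_pos_pos less_trans zero_less_numeral)
  show ?thesis
  proof (intro exI[of _ n0] allI impI)
    fix n z assume n: "n \<ge> n0" and z: "y \<le> z" "z \<le> y + 1 / Suc n"
    have z0: "z \<ge> 0" using y z by simp
    have small: "1 / Suc n < d / 2"
    proof -
      have "1 / Suc n < 1 / real n0" using n n0_pos by (intro divide_strict_left_mono) auto
      also have "\<dots> < d / 2" using n0 n0_pos d(1) by (simp add: field_simps)
      finally show ?thesis .
    qed
    have "T t (bump x n) z = (\<integral>u. p t z u * bump x n u \<partial>N)"
      by (rule T_density[OF t z0 bump_C0[OF x]])
    moreover have "\<bar>(\<integral>u. p t z u * bump x n u \<partial>N) - p t y x\<bar> \<le> e"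
    proof (rule bump_average[OF x p_times_integrable[OF t z0 bump_C0[OF x]]])
      fix u assume u: "x \<le> u" "u \<le> x + 1 / Suc n"
      have "dist (z, u) (y, x) \<le> dist z y + dist u x"
        unfolding dist_Pair_Pair by (rule sqrt_sum_squares_le_sum) auto
      also have "\<dots> < d" using u z small by (simp add: dist_real_def)
      finally have "dist (z, u) (y, x) < d" .
      then have "\<bar>p t z u - p t y x\<bar> < e"
        using d(2)[of "(z, u)"] z0 u x by (simp add: dist_real_def)
      then show "\<bar>p t z u - p t y x\<bar> \<le> e" by simp
    qed
    ultimately show "\<bar>T t (bump x n) z - p t y x\<bar> \<le> e" by simp
  qed
qed

lemma T_bump_tendsto:
  assumes "t > 0" "x \<ge> 0" "y \<ge> 0"
  shows "(\<lambda>n. T t (bump x n) y) \<longlonglongrightarrow> p t y x"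
proof (rule LIMSEQ_I)
  fix e :: real assume "e > 0"
  then have "e / 2 > 0" by simp
  from T_bump_approx[OF assms this] obtain n0 where n0:
    "\<And>n. n \<ge> n0 \<Longrightarrow> \<bar>T t (bump x n) y - p t y x\<bar> \<le> e / 2"
    by (metis le_add_same_cancel1 order_refl zero_le_divide_1_iff of_nat_0_le_iff)
  show "\<exists>n0. \<forall>n\<ge>n0. norm (T t (bump x n) y - p t y x) < e"
  proof (intro exI[of _ n0] allI impI)
    fix n assume "n \<ge> n0"
    from n0[OF this] \<open>e > 0\<close> show "norm (T t (bump x n) y - p t y x) < e" by simp
  qed
qed

lemma ip_bump_tendsto:
  assumes t: "t > 0" and x: "x \<ge> 0" and y: "y \<ge> 0"
  shows "(\<lambda>n. ip (T t (bump x n)) (bump y n)) \<longlonglongrightarrow> p t y x"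
proof (rule LIMSEQ_I)
  fix e :: real assume "e > 0"
  then have "e / 2 > 0" by simp
  from T_bump_approx[OF t x y this] obtain n0 where n0:
    "\<And>n z. n \<ge> n0 \<Longrightarrow> y \<le> z \<Longrightarrow> z \<le> y + 1 / Suc n \<Longrightarrow> \<bar>T t (bump x n) z - p t y x\<bar> \<le> e / 2"
    by blast
  show "\<exists>n0. \<forall>n\<ge>n0. norm (ip (T t (bump x n)) (bump y n) - p t y x) < e"
  proof (intro exI[of _ n0] allI impI)
    fix n assume n: "n \<ge> n0"
    have "integrable N (\<lambda>z. T t (bump x n) z * bump y n z)"
      using t by (intro integrable_C0_mult T_C0 bump_C0 bump_integrable x y) simp
    from bump_average[OF y this n0[OF n]] \<open>e > 0\<close>
    show "norm (ip (T t (bump x n)) (bump y n) - p t y x) < e" by (simp add: ip_def)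
  qed
qed

text \<open>Both orders of the arguments are limits of the same symmetric pairings of bumps.\<close>

lemma p_symmetric:
  assumes t: "t > 0" and x: "x \<ge> 0" and y: "y \<ge> 0"
  shows "p t x y = p t y x"
proof (rule LIMSEQ_unique)
  show "(\<lambda>n. ip (T t (bump x n)) (bump y n)) \<longlonglongrightarrow> p t y x"
    by (rule ip_bump_tendsto[OF assms])
  have "ip (T t (bump x n)) (bump y n) = ip (T t (bump y n)) (bump x n)" for n
  proof -
    obtain f g where "Dc (bump x n) f" "Dc (bump y n) g" using bump(1) x y by blast
    from T_symmetric[OF this] t show ?thesis by (simp add: ip_commute)
  qed
  then show "(\<lambda>n. ip (T t (bump x n)) (bump y n)) \<longlonglongrightarrow> p t x y"
    using ip_bump_tendsto[OF t y x] by simp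
qed

text \<open>The L^2 norms of the bumps blow up, but \<open>ip (T t f) f\<close> tends to the
  diagonal value \<open>p t x x\<close>; this is why the energy was bounded by the former
  quantity.\<close>

lemma p_oscillation:
  assumes t: "t > 0" and x: "x \<ge> 0" and y: "y \<ge> 0" "z \<ge> 0"
  shows "(p t z x - p t y x)\<^sup>2 \<le> p t x x / t * \<bar>s z - s y\<bar>"
proof (rule LIMSEQ_le)
  show "(\<lambda>n. (T t (bump x n) z - T t (bump x n) y)\<^sup>2) \<longlonglongrightarrow> (p t z x - p t y x)\<^sup>2"
    by (intro tendsto_intros T_bump_tendsto assms)
  show "(\<lambda>n. ip (T t (bump x n)) (bump x n) / t * \<bar>s z - s y\<bar>) \<longlonglongrightarrow> p t x x / t * \<bar>s z - s y\<bar>"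
    by (intro tendsto_intros ip_bump_tendsto assms) (use t in auto)
  have "(T t (bump x n) z - T t (bump x n) y)\<^sup>2 \<le> ip (T t (bump x n)) (bump x n) / t * \<bar>s z - s y\<bar>" for n
    using bump(1)[OF x, of n] oscillation_bound[OF _ t y] by blast
  then show "\<exists>N. \<forall>n\<ge>N. (T t (bump x n) z - T t (bump x n) y)\<^sup>2 \<le>
      ip (T t (bump x n)) (bump x n) / t * \<bar>s z - s y\<bar>" by blast
qed

lemma p_diagonal_lower:
  assumes t: "t > 0" and x: "x \<ge> 0" and Y: "Y \<ge> 0" "V (x + 1) + t / 2 \<le> V Y"
  shows "(1 - (V (x + 1) + t / 2) / V Y)\<^sup>2 \<le> p t x x * (m Y + 1)"
proof (rule tendsto_lowerbound)
  show "(\<lambda>n. ip (T t (bump x n)) (bump x n) * (m Y + 1)) \<longlonglongrightarrow> p t x x * (m Y + 1)"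
    by (intro tendsto_intros ip_bump_tendsto t x)
  have V: "V Y > 0" using Y(2) t V_nonneg[of "x + 1"] x by simp
  have "(1 - (V (x + 1) + t / 2) / V Y)\<^sup>2 \<le> ip (T t (bump x n)) (bump x n) * (m Y + 1)" for n
  proof -
    obtain g where g: "Dc (bump x n) g" using bump(1)[OF x] by blast
    have "bump x n y = 0" if "y \<ge> x + 1" for y
    proof (rule bump(3)[OF x])
      have "1 / real (Suc n) \<le> 1" by simp
      then show "x + 1 / Suc n \<le> y" using that by linarith
    qed
    \<comment> \<open>Time \<open>t / 2\<close> is doubled back to \<open>t\<close>, and
      \<open>x + 1\<close> covers the support of every bump, so the bound is uniform in
      \<open>n\<close>.\<close>
    from return_lower_bound[where t = "t / 2" and z = "x + 1", OF g bump(2)[OF x] this bump(5)[OF x] _ Y(1) _ V] t x Y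
    show ?thesis by simp
  qed
  then show "\<forall>\<^sub>F n in sequentially. (1 - (V (x + 1) + t / 2) / V Y)\<^sup>2 \<le> ip (T t (bump x n)) (bump x n) * (m Y + 1)"
    by simp
qed simp

text \<open>As \<open>x\<close> lies in [0, Y], the density on [0, Y] stays above its diagonal value
  minus the oscillation, and the mass there cannot exceed 1.\<close>

lemma p_diagonal_upper:
  assumes t: "t > 0" and x: "x \<ge> 0" and Y: "Y \<ge> x"
  shows "m Y * (p t x x - sqrt (p t x x * s Y / t)) \<le> 1"
proof -
  define q where "q = p t x x - sqrt (p t x x * s Y / t)"
  have low: "q \<le> p t x y" if y: "0 \<le> y" "y \<le> Y" for y
  proof -
    have "\<bar>s x - s y\<bar> \<le> s Y"
      using s_mono[of 0 x] s_mono[of 0 y] s_mono[of x Y] s_mono[of y Y] s_0 y x Y by simp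
    then have "p t x x / t * \<bar>s x - s y\<bar> \<le> p t x x / t * s Y"
      using p_nonneg[OF t x x] t by (intro mult_left_mono) auto
    then have "(p t x x - p t y x)\<^sup>2 \<le> p t x x * s Y / t"
      using p_oscillation[OF t x y(1) x] by simp
    then have "p t x x - p t y x \<le> sqrt (p t x x * s Y / t)" by (rule real_le_rsqrt)
    then show ?thesis using p_symmetric[OF t x y(1)] by (simp add: q_def)
  qed
  have "m Y * q = q * m Y - q * m 0" by (simp add: m_0)
  also have "\<dots> = (LINT y:{0..Y}|N. q)"
  proof (rule integral_N_FTC[where F = "\<lambda>y. q * m y", symmetric])
    show "((\<lambda>y. q * m y) has_real_derivative 2 * w z * q) (at z within {0..})" if "z \<ge> 0" for z
      using DERIV_cmult[OF m_deriv[OF that], of q] by (rule DERIV_cong) simp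
  qed (use x Y in auto)
  also have "\<dots> \<le> (LINT y:{0..Y}|N. p t x y)"
    by (rule set_integral_mono)
       (use low in \<open>auto intro!: set_integrable_interval p_cont_snd t x\<close>)
  also have "\<dots> \<le> integral\<^sup>L N (p t x)"
    unfolding set_lebesgue_integral_def
    by (rule integral_mono)
       (use p_nonneg[OF t x] p_int[OF t x] set_integrable_interval[OF p_cont_snd[OF t x]] in
         \<open>auto simp: indicator_def set_integrable_def\<close>)
  also have "\<dots> = 1" by (rule p_total[OF t x])
  finally show ?thesis by (simp add: q_def)
qed

text \<open>The hypotheses on \<rho> say that the oscillation over [0, \<rho> r] is negligible at
  time r^2 and that this interval carries almost all of the mass \<open>m r\<close>.
  \<open>V_sq\<close> says that a start at a fixed point is unlikely to leave [0, r] by time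
  r^2.\<close>

theorem p_asymptotics:
  assumes \<rho>: "filterlim \<rho> at_top at_top"
    and s_\<rho>: "((\<lambda>r. s (\<rho> r) * m r / r\<^sup>2) \<longlongrightarrow> 0) at_top"
    and m_\<rho>: "((\<lambda>r. m r / m (\<rho> r)) \<longlongrightarrow> 1) at_top"
    and V_sq: "filterlim (\<lambda>r. V r / r\<^sup>2) at_top at_top"
    and x: "x \<ge> 0" and y: "y \<ge> 0"
  shows "((\<lambda>t. p t x y * m (sqrt t)) \<longlongrightarrow> 1) at_top"
proof -
  define M where "M t = m (sqrt t)" for t
  define \<phi> where "\<phi> t = p t x x" for t
  have M_top: "filterlim M at_top at_top"
    unfolding M_def by (rule filterlim_compose[OF m_top sqrt_at_top])
  have M_inv: "((\<lambda>t. inverse (M t)) \<longlongrightarrow> 0) at_top"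
    by (rule tendsto_inverse_0_at_top[OF M_top])
  have V_inv: "((\<lambda>t. inverse (V (sqrt t))) \<longlongrightarrow> 0) at_top"
    by (rule tendsto_inverse_0_at_top[OF filterlim_compose[OF V_top sqrt_at_top]])
  have ev0: "\<forall>\<^sub>F t in at_top. (0::real) < t" by (rule eventually_gt_at_top)
  have tV: "((\<lambda>t. t * inverse (V (sqrt t))) \<longlongrightarrow> 0) at_top"
  proof -
    have "((\<lambda>t. inverse (V (sqrt t) / (sqrt t)\<^sup>2)) \<longlongrightarrow> 0) at_top"
      by (rule tendsto_inverse_0_at_top[OF filterlim_compose[OF V_sq sqrt_at_top]])
    moreover have "\<forall>\<^sub>F t in at_top. inverse (V (sqrt t) / (sqrt t)\<^sup>2) = t * inverse (V (sqrt t))"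
      using ev0 by eventually_elim (simp add: divide_inverse)
    ultimately show ?thesis by (simp add: tendsto_cong)
  qed
  have ev_M: "\<forall>\<^sub>F t in at_top. M t > 0"
    using M_top by (simp add: filterlim_at_top_dense)
  \<comment> \<open>The escape bound \<open>(V (x + 1) + t / 2) / V (sqrt t)\<close>, split into
    summands with known limits.\<close>
  define a where "a t = V (x + 1) * inverse (V (sqrt t)) + (t * inverse (V (sqrt t))) / 2" for t
  have a: "(a \<longlongrightarrow> V (x + 1) * 0 + 0 / 2) at_top"
    unfolding a_def by (intro tendsto_intros V_inv tV) simp
  define Lo where "Lo t = (1 - a t)\<^sup>2 * inverse (1 + inverse (M t))" for t
  have Lo: "(Lo \<longlongrightarrow> 1) at_top"
  proof -
    have "(Lo \<longlongrightarrow> (1 - (V (x + 1) * 0 + 0 / 2))\<^sup>2 * inverse (1 + 0)) at_top"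
      unfolding Lo_def by (intro tendsto_intros a M_inv) simp
    then show ?thesis by simp
  qed
  have lower: "\<forall>\<^sub>F t in at_top. Lo t \<le> \<phi> t * M t"
  proof -
    have "\<forall>\<^sub>F t in at_top. a t < 1" using order_tendstoD(2)[OF a, of 1] by simp
    moreover have "\<forall>\<^sub>F t in at_top. V (sqrt t) > 0"
      using filterlim_compose[OF V_top sqrt_at_top] by (simp add: filterlim_at_top_dense)
    ultimately show ?thesis using ev0 ev_M
    proof eventually_elim
      case (elim t)
      have at: "a t = (V (x + 1) + t / 2) / V (sqrt t)" by (simp add: a_def add_divide_distrib flip: divide_inverse)
      have "V (x + 1) + t / 2 \<le> V (sqrt t)"
        using elim(1,2) by (simp add: at field_simps)
      then have "(1 - a t)\<^sup>2 \<le> \<phi> t * (M t + 1)"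
        using p_diagonal_lower[OF elim(3) x, of "sqrt t"] elim(3) by (simp add: at \<phi>_def M_def)
      moreover have "inverse (1 + inverse (M t)) = M t / (M t + 1)"
        using elim(4) by (simp add: field_simps)
      ultimately have "Lo t \<le> \<phi> t * (M t + 1) * (M t / (M t + 1))"
        using elim(4) by (simp only: Lo_def) (intro mult_right_mono, auto)
      then show ?case using elim(4) by simp
    qed
  qed
  \<comment> \<open>Bounds the oscillation relative to \<open>\<phi> t\<close>. The factor 2 comes
    from \<open>\<phi> t * M t > 1 / 2\<close>, by which 1 / \<phi> t is replaced by
    \<open>2 * M t\<close>.\<close>
  define b where "b t = sqrt (2 * (s (\<rho> (sqrt t)) * M t / (sqrt t)\<^sup>2))" for t
  have b: "(b \<longlongrightarrow> 0) at_top"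
  proof -
    have "(b \<longlongrightarrow> sqrt (2 * 0)) at_top"
      unfolding b_def M_def by (intro tendsto_intros filterlim_compose[OF s_\<rho> sqrt_at_top])
    then show ?thesis by simp
  qed
  define Up where "Up t = M t / m (\<rho> (sqrt t)) * inverse (1 - b t)" for t
  have Up: "(Up \<longlongrightarrow> 1) at_top"
  proof -
    have "(Up \<longlongrightarrow> 1 * inverse (1 - 0)) at_top"
      unfolding Up_def M_def by (intro tendsto_intros b filterlim_compose[OF m_\<rho> sqrt_at_top]) simp
    then show ?thesis by simp
  qed
  \<comment> \<open>The upper bound relies on a prior lower bound: the oscillation is proportional
    to the square root of \<open>\<phi> t\<close> and has to be compared with
    \<open>\<phi> t\<close> itself.\<close>
  have half: "\<forall>\<^sub>F t in at_top. \<phi> t * M t > 1 / 2"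
    using order_tendstoD(1)[OF Lo, of "1/2"] lower by (auto elim: eventually_elim2)
  have \<rho>s: "filterlim (\<lambda>t. \<rho> (sqrt t)) at_top at_top"
    by (rule filterlim_compose[OF \<rho> sqrt_at_top])
  have upper: "\<forall>\<^sub>F t in at_top. \<phi> t * M t \<le> Up t"
  proof -
    have "\<forall>\<^sub>F t in at_top. b t < 1" using order_tendstoD(2)[OF b, of 1] by simp
    moreover have "\<forall>\<^sub>F t in at_top. \<rho> (sqrt t) \<ge> x"
      using \<rho>s by (simp add: filterlim_at_top)
    moreover have "\<forall>\<^sub>F t in at_top. m (\<rho> (sqrt t)) > 0"
      using filterlim_compose[OF m_top \<rho>s] by (simp add: filterlim_at_top_dense)
    ultimately show ?thesis using ev0 ev_M half
    proof eventually_elim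
      case (elim t)
      define Y where "Y = \<rho> (sqrt t)"
      have Y: "Y \<ge> x" "m Y > 0" using elim by (auto simp: Y_def)
      have sY: "s Y \<ge> 0" using s_mono[of 0 Y] s_0 x Y by simp
      have \<phi>: "\<phi> t > 0" using elim(5,6)
        by (metis half_gt_zero_iff less_trans zero_less_mult_pos2 zero_less_one)
      have "\<phi> t * s Y / t \<le> (\<phi> t * b t)\<^sup>2"
      proof -
        have "(b t)\<^sup>2 = 2 * (s Y * M t / t)"
          using sY elim(4,5) by (simp add: b_def Y_def)
        then have "(\<phi> t * b t)\<^sup>2 = (\<phi> t)\<^sup>2 * (2 * (s Y * M t / t))"
          by (simp only: power_mult_distrib)
        then have "(\<phi> t * b t)\<^sup>2 = (\<phi> t * s Y / t) * (2 * (\<phi> t * M t))"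
          by (simp add: power2_eq_square)
        moreover have "(\<phi> t * s Y / t) * 1 \<le> (\<phi> t * s Y / t) * (2 * (\<phi> t * M t))"
          using \<phi> sY elim(4,6) by (intro mult_left_mono) auto
        ultimately show ?thesis by simp
      qed
      then have "sqrt (\<phi> t * s Y / t) \<le> \<phi> t * b t"
        using \<phi> sY elim(4,5) by (intro real_le_lsqrt) (auto simp: b_def Y_def)
      then have "m Y * (\<phi> t * (1 - b t)) \<le> m Y * (\<phi> t - sqrt (\<phi> t * s Y / t))"
        using Y by (intro mult_left_mono) (auto simp: algebra_simps)
      also have "\<dots> \<le> 1" using p_diagonal_upper[OF elim(4) x Y(1)] by (simp add: \<phi>_def)
      finally have "\<phi> t * (m Y * (1 - b t)) \<le> 1" by (simp add: mult_ac)
      then have "\<phi> t \<le> 1 / (m Y * (1 - b t))"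
        using Y elim(1) by (simp add: pos_le_divide_eq)
      then have "\<phi> t * M t \<le> 1 / (m Y * (1 - b t)) * M t"
        using elim(5) by (intro mult_right_mono) auto
      then show ?case by (simp add: Up_def Y_def divide_inverse mult_ac)
    qed
  qed
  have \<phi>: "((\<lambda>t. \<phi> t * M t) \<longlongrightarrow> 1) at_top"
    by (rule tendsto_sandwich[OF lower upper Lo Up])
  \<comment> \<open>Eventually \<open>s (\<rho> (sqrt t))\<close> is at least \<open>s 1\<close>,
    which is positive, so the hypothesis on \<open>s\<close> already forces m(\<surd>t) =
    o(t).\<close>
  have M_t: "((\<lambda>t. M t / t) \<longlongrightarrow> 0) at_top"
  proof (rule Lim_null_comparison)
    have "s 1 > 0" using s_strict_mono[of 0 1] s_0 by simp
    have "\<forall>\<^sub>F t in at_top. \<rho> (sqrt t) \<ge> 1" using \<rho>s by (simp add: filterlim_at_top)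
    then show "\<forall>\<^sub>F t in at_top. norm (M t / t) \<le> (s (\<rho> (sqrt t)) * m (sqrt t) / (sqrt t)\<^sup>2) * inverse (s 1)"
      using ev0 ev_M
    proof eventually_elim
      case (elim t)
      have "M t / t * s 1 \<le> M t / t * s (\<rho> (sqrt t))"
        using elim s_mono[of 1] by (intro mult_left_mono) auto
      then show ?case using elim \<open>s 1 > 0\<close> by (simp add: M_def field_simps)
    qed
    have "((\<lambda>t. (s (\<rho> (sqrt t)) * m (sqrt t) / (sqrt t)\<^sup>2) * inverse (s 1)) \<longlongrightarrow> 0 * inverse (s 1)) at_top"
      by (intro tendsto_intros filterlim_compose[OF s_\<rho> sqrt_at_top])
    then show "((\<lambda>t. (s (\<rho> (sqrt t)) * m (sqrt t) / (sqrt t)\<^sup>2) * inverse (s 1)) \<longlongrightarrow> 0) at_top" by simp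
  qed
  \<comment> \<open>For fixed points the squared oscillation times (M t)^2 is bounded by (\<phi> M)
    (M / t) times a constant, and M / t tends to 0.\<close>
  have "((\<lambda>t. (p t y x - \<phi> t) * M t) \<longlongrightarrow> 0) at_top"
  proof (rule Lim_null_comparison)
    show "\<forall>\<^sub>F t in at_top. norm ((p t y x - \<phi> t) * M t) \<le> sqrt ((\<phi> t * M t) * (M t / t) * \<bar>s y - s x\<bar>)"
      using ev0 ev_M
    proof eventually_elim
      case (elim t)
      have "((p t y x - \<phi> t) * M t)\<^sup>2 = (p t y x - \<phi> t)\<^sup>2 * (M t)\<^sup>2" by (rule power_mult_distrib)
      also have "\<dots> \<le> (\<phi> t / t * \<bar>s y - s x\<bar>) * (M t)\<^sup>2"
        using p_oscillation[OF elim(1) x x y] by (intro mult_right_mono) (auto simp: \<phi>_def)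
      also have "\<dots> = (\<phi> t * M t) * (M t / t) * \<bar>s y - s x\<bar>" by (simp add: power2_eq_square)
      finally show ?case using real_le_rsqrt[of "\<bar>(p t y x - \<phi> t) * M t\<bar>"] by simp
    qed
    have "((\<lambda>t. sqrt ((\<phi> t * M t) * (M t / t) * \<bar>s y - s x\<bar>)) \<longlongrightarrow> sqrt (1 * 0 * \<bar>s y - s x\<bar>)) at_top"
      by (intro tendsto_intros \<phi> M_t)
    then show "((\<lambda>t. sqrt ((\<phi> t * M t) * (M t / t) * \<bar>s y - s x\<bar>)) \<longlongrightarrow> 0) at_top" by simp
  qed
  from tendsto_add[OF this \<phi>] have lim: "((\<lambda>t. p t y x * M t) \<longlongrightarrow> 1) at_top"
    by (simp add: algebra_simps)
  have "\<forall>\<^sub>F t in at_top. p t x y * m (sqrt t) = p t y x * M t"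
    using ev0 by eventually_elim (simp add: M_def p_symmetric[OF _ x y])
  from tendsto_cong[OF this] lim show ?thesis by simp
qed

end

section \<open>Regularly varying weights\<close>

lemma mono_on_of_deriv:
  fixes f :: "real \<Rightarrow> real"
  assumes "\<And>x. a \<le> x \<Longrightarrow> x \<le> b \<Longrightarrow> (f has_real_derivative f' x) (at x)"
    and "\<And>x. a \<le> x \<Longrightarrow> x \<le> b \<Longrightarrow> f' x \<ge> 0" "a \<le> b"
  shows "f a \<le> f b"
  using assms by (intro DERIV_nonneg_imp_nondecreasing[OF assms(3)]) blast

text \<open>The two-sided bounds of Potter for regular variation of \<open>w\<close> with index \<open>-1\<close>.\<close>

locale potter_weight = speed_scale +
  assumes potter: "0 < \<kappa> \<Longrightarrow> \<kappa> < 1 \<Longrightarrow> \<exists>n\<ge>1. \<forall>u x. n \<le> u \<longrightarrow> u \<le> x \<longrightarrow>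
      w u \<le> exp 1 * w x * (x / u) powr (1 + \<kappa>) \<and> w x * (x / u) powr (1 - \<kappa>) \<le> exp 1 * w u"
begin

lemma interior_deriv:
  assumes "x > 0"
  shows "(m has_real_derivative 2 * w x) (at x)" "(s has_real_derivative 1 / w x) (at x)"
    "(V has_real_derivative m x / w x) (at x)"
proof -
  have "at x within {0..} = at x"
    by (rule at_within_interior) (use assms in auto)
  then show "(m has_real_derivative 2 * w x) (at x)" "(s has_real_derivative 1 / w x) (at x)"
    "(V has_real_derivative m x / w x) (at x)"
    using m_deriv[of x] s_deriv[of x] V_deriv[of x] assms by auto
qed

text \<open>Karamata's ratio of x w(x) to the mass, the small parameter in the estimates that
  follow.\<close>

definition r :: "real \<Rightarrow> real" where "r x = x * w x / m x"

lemma m_pos: "x > 0 \<Longrightarrow> m x > 0"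
  using m_strict_mono[of 0 x] m_0 by simp

lemma r_pos: "x > 0 \<Longrightarrow> r x > 0"
  using m_pos[of x] w_pos[of x] by (simp add: r_def)

text \<open>Integrating the lower Potter bound for \<open>w u\<close> over [n, x] shows that
  \<open>m x\<close> is at least 2 x w(x) (1 - (n/x)^\<kappa>) / (e \<kappa>); once the bracket
  exceeds 1/2 the claim follows.\<close>

lemma r_small:
  assumes \<kappa>: "0 < \<kappa>" "\<kappa> < 1"
  shows "\<forall>\<^sub>F x in at_top. r x \<le> exp 1 * \<kappa>"
proof -
  obtain n where n: "n \<ge> 1" "\<And>u x. n \<le> u \<Longrightarrow> u \<le> x \<Longrightarrow> w x * (x / u) powr (1 - \<kappa>) \<le> exp 1 * w u"
    using potter[OF \<kappa>] by blast
  have "((\<lambda>x. (n / x) powr \<kappa>) \<longlongrightarrow> 0) at_top"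
  proof (rule tendsto_zero_powrI)
    show "((\<lambda>x. n / x) \<longlongrightarrow> 0) at_top" by (rule tendsto_divide_0[OF tendsto_const filterlim_at_top_imp_at_infinity[OF filterlim_ident]])
    show "\<forall>\<^sub>F x in at_top. 0 \<le> n / x"
      using eventually_gt_at_top[of 0] by eventually_elim (use n in auto)
  qed (use \<kappa> in auto)
  then have "\<forall>\<^sub>F x in at_top. (n / x) powr \<kappa> < 1 / 2" by (rule order_tendstoD) simp
  then show ?thesis using eventually_ge_at_top[of n]
  proof eventually_elim
    case (elim x)
    have x: "x > 0" using elim n by simp
    define c where "c = 2 * w x * x powr (1 - \<kappa>) / exp 1"
    have c: "c > 0" using w_pos[of x] x by (simp add: c_def)
    have "m n - c * (n powr \<kappa> / \<kappa>) \<le> m x - c * (x powr \<kappa> / \<kappa>)"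
    proof (rule mono_on_of_deriv[where f = "\<lambda>u. m u - c * (u powr \<kappa> / \<kappa>)" and a = n and b = x
          and f' = "\<lambda>u. 2 * w u - c * (u powr (\<kappa> - 1))"])
      fix u assume u: "n \<le> u" "u \<le> x"
      then have u0: "u > 0" using n by simp
      show "((\<lambda>u. m u - c * (u powr \<kappa> / \<kappa>)) has_real_derivative 2 * w u - c * u powr (\<kappa> - 1)) (at u)"
        using interior_deriv(1)[OF u0] u0 \<kappa> by (auto intro!: derivative_eq_intros)
      have "c * u powr (\<kappa> - 1) = 2 * (w x * (x / u) powr (1 - \<kappa>)) / exp 1"
        using u0 x by (simp add: c_def powr_divide powr_diff field_simps)
      also have "\<dots> \<le> 2 * w u" using n(2)[OF u] by (simp add: field_simps)
      finally show "0 \<le> 2 * w u - c * u powr (\<kappa> - 1)" by simp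
    qed (use elim in auto)
    moreover have "n powr \<kappa> \<le> x powr \<kappa> / 2"
      using elim n x by (simp add: powr_divide field_simps)
    ultimately have "c * (x powr \<kappa> / (2 * \<kappa>)) \<le> m x - m n"
    proof -
      have "c * (n powr \<kappa> / \<kappa>) \<le> c * (x powr \<kappa> / (2 * \<kappa>))"
        using c \<kappa> \<open>n powr \<kappa> \<le> x powr \<kappa> / 2\<close> by (intro mult_left_mono) (auto simp: field_simps)
      moreover have "c * (x powr \<kappa> / \<kappa>) = 2 * (c * (x powr \<kappa> / (2 * \<kappa>)))" using \<kappa> by simp
      ultimately show ?thesis
        using \<open>m n - c * (n powr \<kappa> / \<kappa>) \<le> m x - c * (x powr \<kappa> / \<kappa>)\<close> by linarith
    qed
    moreover have "c * (x powr \<kappa> / (2 * \<kappa>)) = x * w x / (exp 1 * \<kappa>)"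
      using x by (simp add: c_def powr_diff)
    ultimately have "x * w x / (exp 1 * \<kappa>) \<le> m x" using m_nonneg[of n] n by linarith
    then show "r x \<le> exp 1 * \<kappa>"
      using m_pos[OF x] \<kappa> by (simp add: r_def field_simps)
  qed
qed

lemma r_tendsto: "(r \<longlongrightarrow> 0) at_top"
proof (rule tendstoI)
  fix e :: real assume e: "e > 0"
  define \<kappa> where "\<kappa> = min (1 / 2) (e / (2 * exp 1))"
  have \<kappa>: "0 < \<kappa>" "\<kappa> < 1" "exp 1 * \<kappa> < e"
  proof -
    have "exp 1 * \<kappa> \<le> exp 1 * (e / (2 * exp 1))" by (intro mult_left_mono) (auto simp: \<kappa>_def)
    also have "\<dots> < e" using e by simp
    finally show "exp 1 * \<kappa> < e" .
  qed (use e in \<open>auto simp: \<kappa>_def\<close>)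
  show "\<forall>\<^sub>F x in at_top. dist (r x) 0 < e"
    using r_small[OF \<kappa>(1,2)] eventually_gt_at_top[of 0]
    by eventually_elim (use \<kappa>(3) r_pos in \<open>auto simp: dist_real_def less_imp_le\<close>)
qed

text \<open>V' = m / w = x / r(x) with r tending to 0, so V' eventually exceeds K x for every
  K.\<close>

lemma V_over_square_top: "filterlim (\<lambda>x. V x / x\<^sup>2) at_top at_top"
  unfolding filterlim_at_top
proof
  fix Z :: real
  \<comment> \<open>Integration leaves K x^2 / 2, of which the part below \<open>x0\<close> takes at
    most a quarter when x \<ge> 2 x0; the factor 4 absorbs both losses.\<close>
  define K where "K = 4 * max 1 Z"
  have K: "K > 0" "K \<ge> 4 * Z" by (auto simp: K_def)
  have "\<forall>\<^sub>F x in at_top. r x < 1 / K" using order_tendstoD(2)[OF r_tendsto] K by simp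
  then obtain x1 where x1: "\<And>x. x \<ge> x1 \<Longrightarrow> r x < 1 / K"
    by (auto simp: eventually_at_top_linorder)
  define x0 where "x0 = max 1 x1"
  have x0: "x0 \<ge> 1" "\<And>x. x \<ge> x0 \<Longrightarrow> r x < 1 / K"
    using x1 by (auto simp: x0_def)
  show "\<forall>\<^sub>F x in at_top. Z \<le> V x / x\<^sup>2"
    using eventually_ge_at_top[of "2 * x0"]
  proof eventually_elim
    case (elim x)
    have "V x0 - K * x0\<^sup>2 / 2 \<le> V x - K * x\<^sup>2 / 2"
    proof (rule mono_on_of_deriv[where f = "\<lambda>x. V x - K * x\<^sup>2 / 2" and a = x0 and b = x
          and f' = "\<lambda>x. m x / w x - K * x"])
      fix u assume "x0 \<le> u" "u \<le> x"
      then have u: "u > 0" "r u < 1 / K" using x0 by auto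
      show "((\<lambda>x. V x - K * x\<^sup>2 / 2) has_real_derivative m u / w u - K * u) (at u)"
        using interior_deriv(3)[OF u(1)] by (auto intro!: derivative_eq_intros)
      show "0 \<le> m u / w u - K * u"
        using u m_pos[OF u(1)] w_pos[of u] K by (simp add: r_def field_simps)
    qed (use elim x0 in auto)
    moreover have "x0\<^sup>2 \<le> x\<^sup>2 / 4"
      using power_mono[OF elim, of 2] x0 by (simp add: power_mult_distrib)
    then have "K * x0\<^sup>2 \<le> K * (x\<^sup>2 / 4)" using K by (intro mult_left_mono) auto
    moreover have "4 * Z * x\<^sup>2 \<le> K * x\<^sup>2" using K by (intro mult_right_mono) auto
    moreover have "0 \<le> K * x\<^sup>2" using K by simp
    ultimately have "Z * x\<^sup>2 \<le> V x" using V_nonneg[of x0] x0 by simp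
    then show "Z \<le> V x / x\<^sup>2" using elim x0 by (simp add: field_simps)
  qed
qed

text \<open>Potter bounds with \<kappa> = 1/4 and base point \<open>n\<close> pin \<open>w x\<close>
  between multiples of x^(-5/4) and x^(-3/4). These crude powers suffice for limits that leave room
  to spare.\<close>

lemma weight_bounds:
  obtains c n where "c > 0" "n \<ge> 1" "\<And>x. x \<ge> n \<Longrightarrow> m x \<le> c * x powr (1/4)"
    "\<And>x. x \<ge> n \<Longrightarrow> x powr (3/4) \<le> c * (x\<^sup>2 * w x)"
proof -
  obtain n where n: "n \<ge> 1" "\<And>u x. n \<le> u \<Longrightarrow> u \<le> x \<Longrightarrow>
      w u \<le> exp 1 * w x * (x / u) powr (1 + 1/4) \<and> w x * (x / u) powr (1 - 1/4) \<le> exp 1 * w u"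
    using potter[of "1/4"] by auto
  define a where "a = exp 1 * w n * n powr (3/4)"
  have a: "a > 0" using w_pos[of n] n by (simp add: a_def)
  have w_le: "w x \<le> a * x powr (-3/4)" if "x \<ge> n" for x
  proof -
    have "w x * (x / n) powr (3/4) \<le> exp 1 * w n" using n(2)[OF order_refl that] by simp
    then show ?thesis using that n
      by (simp add: a_def powr_divide powr_minus field_simps)
  qed
  have m_le: "m x \<le> m n + 8 * a * x powr (1/4)" if "x \<ge> n" for x
  proof -
    have "8 * a * n powr (1/4) - m n \<le> 8 * a * x powr (1/4) - m x"
    proof (rule mono_on_of_deriv[where f = "\<lambda>x. 8 * a * x powr (1/4) - m x" and f' = "\<lambda>x. 2 * a * x powr (-3/4) - 2 * w x", OF _ _ that])
      fix u assume u: "n \<le> u"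
      then have u0: "u > 0" using n by simp
      show "((\<lambda>x. 8 * a * x powr (1/4) - m x) has_real_derivative 2 * a * u powr (-3/4) - 2 * w u) (at u)"
        using interior_deriv(1)[OF u0] u0 by (auto intro!: derivative_eq_intros)
      show "0 \<le> 2 * a * u powr (-3/4) - 2 * w u" using w_le[OF u] by simp
    qed
    moreover have "8 * a * n powr (1/4) \<ge> 0" using a by simp
    ultimately show ?thesis by linarith
  qed
  define c where "c = max (m n + 8 * a) (exp 1 / (w n * n powr (5/4)))"
  have c: "c > 0" using a m_nonneg[of n] n by (simp add: c_def less_max_iff_disj)
  show ?thesis
  proof (rule that[OF c n(1)])
    fix x assume x: "x \<ge> n"
    then have x1: "x \<ge> 1" using n by simp
    have "m n * 1 \<le> m n * x powr (1/4)"
      using m_nonneg[of n] n x1 by (intro mult_left_mono ge_one_powr_ge_zero) auto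
    then have "m x \<le> (m n + 8 * a) * x powr (1/4)" using m_le[OF x] by (simp add: algebra_simps)
    also have "\<dots> \<le> c * x powr (1/4)" by (intro mult_right_mono) (auto simp: c_def)
    finally show "m x \<le> c * x powr (1/4)" .
    have "w n \<le> exp 1 * w x * (x / n) powr (5/4)" using n(2)[OF order_refl x] by simp
    then have "w n * n powr (5/4) \<le> exp 1 * w x * x powr (5/4)"
      using n x1 by (simp add: powr_divide field_simps)
    then have "w n * n powr (5/4) * x powr (3/4) \<le> exp 1 * w x * x powr (5/4) * x powr (3/4)"
      by (rule mult_right_mono) simp
    also have "\<dots> = exp 1 * (x\<^sup>2 * w x)"
      using x1 by (simp add: mult.assoc powr_add[symmetric] mult.commute)
    finally have "x powr (3/4) \<le> exp 1 / (w n * n powr (5/4)) * (x\<^sup>2 * w x)"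
      using w_pos[of n] n by (simp add: field_simps)
    also have "\<dots> \<le> c * (x\<^sup>2 * w x)"
      using w_pos[of x] x1 by (intro mult_right_mono) (auto simp: c_def)
    finally show "x powr (3/4) \<le> c * (x\<^sup>2 * w x)" .
  qed
qed

lemma m_over_square: "((\<lambda>x. m x / x\<^sup>2) \<longlongrightarrow> 0) at_top"
proof -
  obtain c n where c: "c > 0" "n \<ge> 1" "\<And>x. x \<ge> n \<Longrightarrow> m x \<le> c * x powr (1/4)"
    using weight_bounds by metis
  show ?thesis
  proof (rule Lim_null_comparison)
    show "\<forall>\<^sub>F x in at_top. norm (m x / x\<^sup>2) \<le> c * x powr (-7/4)"
      using eventually_ge_at_top[of n]
    proof eventually_elim
      case (elim x)
      have x: "x \<ge> 1" using elim c by simp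
      have "m x / x\<^sup>2 \<le> c * x powr (1/4) / x\<^sup>2" using c(3)[OF elim] by (rule divide_right_mono) simp
      also have "x\<^sup>2 = x powr 2" using x by simp
      also have "c * x powr (1/4) / x powr 2 = c * (x powr (1/4) / x powr 2)" by simp
      also have "x powr (1/4) / x powr 2 = x powr (-7/4)" by (simp flip: powr_diff)
      finally show ?case using m_nonneg[of x] x by simp
    qed
    have "((\<lambda>x::real. x powr (-7/4)) \<longlongrightarrow> 0) at_top"
      by (intro tendsto_neg_powr filterlim_ident) simp
    from tendsto_mult_left[OF this, of c] show "((\<lambda>x. c * x powr (-7/4)) \<longlongrightarrow> 0) at_top" by simp
  qed
qed

lemma V_tendsto_top: "filterlim V at_top at_top"
proof (rule filterlim_at_top_mono[OF V_over_square_top])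
  show "\<forall>\<^sub>F x in at_top. V x / x\<^sup>2 \<le> V x"
    using eventually_ge_at_top[of 1]
  proof eventually_elim
    case (elim x)
    have "1 \<le> x\<^sup>2" using elim by (rule one_le_power)
    then have "V x * 1 \<le> V x * x\<^sup>2" using V_nonneg[of x] elim by (intro mult_left_mono) auto
    then show ?case using elim by (simp add: field_simps)
  qed
qed

lemma m_over_V_tendsto: "((\<lambda>x. m x / V x) \<longlongrightarrow> 0) at_top"
proof -
  have lim: "((\<lambda>x. m x / x\<^sup>2 * inverse (V x / x\<^sup>2)) \<longlongrightarrow> 0 * 0) at_top"
    by (intro tendsto_mult m_over_square tendsto_inverse_0_at_top V_over_square_top)
  have ev: "\<forall>\<^sub>F x in at_top. m x / x\<^sup>2 * inverse (V x / x\<^sup>2) = m x / V x"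
    using eventually_gt_at_top[of 0] by eventually_elim (simp add: divide_inverse)
  from lim show ?thesis by (simp only: tendsto_cong[OF ev] mult_zero_left)
qed

text \<open>An intermediate scale: \<open>\<rho> x = o(x)\<close> is small enough for equilibrium to be reached on
  \<open>[0, \<rho> x]\<close> by time \<open>x\<^sup>2\<close>, yet \<open>[0, \<rho> x]\<close> carries almost all of the mass \<open>m x\<close>.\<close>

definition \<rho> :: "real \<Rightarrow> real" where "\<rho> x = x * r x"

text \<open>Here \<rho>(x) = x^2 w(x) / m(x), and the exponents 3/4 and 1/4 leave at least a
  multiple of \<surd>x.\<close>

lemma \<rho>_top: "filterlim \<rho> at_top at_top"
proof -
  obtain c n where c: "c > 0" "n \<ge> 1" "\<And>x. x \<ge> n \<Longrightarrow> m x \<le> c * x powr (1/4)"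
    "\<And>x. x \<ge> n \<Longrightarrow> x powr (3/4) \<le> c * (x\<^sup>2 * w x)"
    using weight_bounds by metis
  have lower: "\<forall>\<^sub>F x in at_top. x powr (1/2) / c\<^sup>2 \<le> \<rho> x"
    using eventually_ge_at_top[of n]
  proof eventually_elim
    case (elim x)
    have x: "x > 0" using elim c by simp
    have "x powr (1/2) * m x \<le> x powr (1/2) * (c * x powr (1/4))"
      using c(3)[OF elim] by (intro mult_left_mono) auto
    also have "\<dots> = c * x powr (3/4)" by (simp add: powr_add[symmetric])
    also have "\<dots> \<le> c * (c * (x\<^sup>2 * w x))" using c(4)[OF elim] c(1) by (intro mult_left_mono) auto
    finally show ?case
      using m_pos[OF x] c(1) by (simp add: \<rho>_def r_def field_simps power2_eq_square)
  qed
  have "filterlim (\<lambda>x::real. x powr (1/2) / c\<^sup>2) at_top at_top"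
    using c(1) by real_asymp
  then show ?thesis using lower by (rule filterlim_at_top_mono)
qed

text \<open>Potter bounds with \<kappa> = 1/2 make both errors of order \<surd>r, apart from
  \<open>s n * (m x / x\<^sup>2)\<close> in the first, the contribution of the scale below
  \<open>n\<close>.\<close>

lemma \<rho>_estimates:
  shows "((\<lambda>x. s (\<rho> x) * m x / x\<^sup>2) \<longlongrightarrow> 0) at_top" "((\<lambda>x. m x / m (\<rho> x)) \<longlongrightarrow> 1) at_top"
proof -
  obtain n where n: "n \<ge> 1" "\<And>u x. n \<le> u \<Longrightarrow> u \<le> x \<Longrightarrow> w u \<le> exp 1 * w x * (x / u) powr (1 + 1/2)"
    "\<And>u x. n \<le> u \<Longrightarrow> u \<le> x \<Longrightarrow> w x * (x / u) powr (1 - 1/2) \<le> exp 1 * w u"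
    using potter[of "1/2"] by auto
  have r_half: "((\<lambda>x. r x powr (1/2)) \<longlongrightarrow> 0) at_top"
  proof (rule tendsto_zero_powrI[OF r_tendsto tendsto_const])
    show "\<forall>\<^sub>F x in at_top. 0 \<le> r x"
      using eventually_gt_at_top[of 0] by eventually_elim (simp add: r_pos less_imp_le)
  qed simp
  have ev: "\<forall>\<^sub>F x in at_top. x \<ge> n \<and> \<rho> x \<ge> n \<and> r x < 1"
    using eventually_ge_at_top[of n] \<rho>_top[unfolded filterlim_at_top, rule_format, of n]
      order_tendstoD(2)[OF r_tendsto, of 1] by (simp add: eventually_conj_iff)
  show "((\<lambda>x. s (\<rho> x) * m x / x\<^sup>2) \<longlongrightarrow> 0) at_top"
  proof (rule Lim_null_comparison)
    show "\<forall>\<^sub>F x in at_top. norm (s (\<rho> x) * m x / x\<^sup>2) \<le> s n * (m x / x\<^sup>2) + exp 1 * r x powr (1/2)"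
      using ev
    proof eventually_elim
      case (elim x)
      then have x: "x > 0" "x \<ge> n" "\<rho> x \<ge> n" "r x < 1" using n by auto
      have r: "r x > 0" by (rule r_pos[OF x(1)])
      have \<rho>x: "\<rho> x \<le> x" using x r by (simp add: \<rho>_def mult_left_le)
      \<comment> \<open>For u \<le> \<rho> x the ratio x / u is at least 1 / r x, so
        \<open>c\<close> bounds \<open>1 / w u\<close> on [n, \<rho> x].\<close>
      define c where "c = exp 1 / w x * r x powr (1/2)"
      have c0: "c \<ge> 0" using w_pos[of x] x by (simp add: c_def)
      have "c * n - s n \<le> c * \<rho> x - s (\<rho> x)"
      proof (rule mono_on_of_deriv[where f = "\<lambda>u. c * u - s u" and f' = "\<lambda>u. c - 1 / w u", OF _ _ x(3)])
        fix u assume u: "n \<le> u" "u \<le> \<rho> x"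
        then have u0: "u > 0" using n by simp
        show "((\<lambda>u. c * u - s u) has_real_derivative c - 1 / w u) (at u)"
          using interior_deriv(2)[OF u0] by (auto intro!: derivative_eq_intros)
        have "w x * (x / u) powr (1/2) \<le> exp 1 * w u" using n(3)[OF u(1)] u(2) \<rho>x by simp
        moreover have "w x * (1 / r x) powr (1/2) \<le> w x * (x / u) powr (1/2)"
          using w_pos[of x] x r u u0 by (intro mult_left_mono powr_mono2) (auto simp: \<rho>_def field_simps)
        ultimately have "w x * (1 / r x) powr (1/2) \<le> exp 1 * w u" by linarith
        then show "0 \<le> c - 1 / w u"
          using w_pos[of u] w_pos[of x] x r u0 by (simp add: c_def powr_divide field_simps)
      qed
      then have "s (\<rho> x) \<le> s n + c * \<rho> x" using mult_nonneg_nonneg[OF c0, of n] n by simp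
      then have "s (\<rho> x) * (m x / x\<^sup>2) \<le> (s n + c * \<rho> x) * (m x / x\<^sup>2)"
        using m_pos[OF x(1)] by (intro mult_right_mono) auto
      \<comment> \<open>The choice of \<rho> makes \<open>\<rho> x * (m x / x\<^sup>2)\<close> equal
        to \<open>w x\<close>, which cancels the factor 1 / w x in \<open>c\<close>.\<close>
      also have "\<dots> = s n * (m x / x\<^sup>2) + exp 1 * r x powr (1/2)"
      proof -
        have "(c * \<rho> x) * (m x / x\<^sup>2) = exp 1 * r x powr (1/2) * ((x * r x * m x) / (w x * x\<^sup>2))"
          by (simp add: c_def \<rho>_def)
        also have "x * r x * m x = w x * x\<^sup>2"
          using m_pos[OF x(1)] by (simp add: r_def power2_eq_square)
        finally show ?thesis using x(1) w_pos[of x] by (simp add: distrib_right add_divide_distrib)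
      qed
      finally show ?case
        using s_mono[of 0 "\<rho> x"] s_0 x n m_pos[OF x(1)] by (simp add: abs_mult)
    qed
    have "((\<lambda>x. s n * (m x / x\<^sup>2) + exp 1 * r x powr (1/2)) \<longlongrightarrow> s n * 0 + exp 1 * 0) at_top"
      by (intro tendsto_intros m_over_square r_half)
    then show "((\<lambda>x. s n * (m x / x\<^sup>2) + exp 1 * r x powr (1/2)) \<longlongrightarrow> 0) at_top" by simp
  qed
  have ratio: "((\<lambda>x. m (\<rho> x) / m x) \<longlongrightarrow> 1) at_top"
  proof (rule tendsto_sandwich)
    show "\<forall>\<^sub>F x in at_top. 1 - 4 * exp 1 * r x powr (1/2) \<le> m (\<rho> x) / m x"
      using ev
    proof eventually_elim
      case (elim x)
      then have x: "x > 0" "x \<ge> n" "\<rho> x \<ge> n" "r x < 1" using n by auto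
      have r: "r x > 0" by (rule r_pos[OF x(1)])
      have \<rho>x: "\<rho> x \<le> x" "\<rho> x > 0" using x r n by (auto simp: \<rho>_def mult_left_le)
      \<comment> \<open>Comes from the upper Potter bound integrated over [\<rho> x, x]; the 4 is 2
        from m' = 2 w times 2 from integrating u^(-3/2).\<close>
      define c where "c = 4 * exp 1 * w x * x powr (3/2)"
      have c0: "c \<ge> 0" using w_pos[of x] x by (simp add: c_def)
      have "- c * \<rho> x powr (-1/2) - m (\<rho> x) \<le> - c * x powr (-1/2) - m x"
      proof (rule mono_on_of_deriv[where f = "\<lambda>u. - c * u powr (-1/2) - m u" and f' = "\<lambda>u. (c / 2) * u powr (-3/2) - 2 * w u", OF _ _ \<rho>x(1)])
        fix u assume u: "\<rho> x \<le> u" "u \<le> x"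
        then have u0: "u > 0" using \<rho>x by simp
        show "((\<lambda>u. - c * u powr (-1/2) - m u) has_real_derivative (c / 2) * u powr (-3/2) - 2 * w u) (at u)"
          using interior_deriv(1)[OF u0] u0 by (auto intro!: derivative_eq_intros)
        have "w u \<le> exp 1 * w x * (x / u) powr (3/2)" using n(2)[of u x] u x by simp
        also have "(x / u) powr (3/2) = x powr (3/2) * u powr (-3/2)"
          using x u0 by (simp add: powr_divide powr_minus field_simps)
        finally show "0 \<le> (c / 2) * u powr (-3/2) - 2 * w u" by (simp add: c_def)
      qed
      then have "m x - m (\<rho> x) \<le> c * \<rho> x powr (-1/2)"
        using mult_nonneg_nonneg[OF c0, of "x powr (-1/2)"] by simp
      also have "\<dots> = 4 * exp 1 * w x * (x powr (3/2) * x powr (-1/2)) * r x powr (-1/2)"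
        using x r by (simp add: c_def \<rho>_def powr_mult)
      also have "x powr (3/2) * x powr (-1/2) = x" using x by (simp add: powr_add[symmetric])
      also have "4 * exp 1 * w x * x * r x powr (-1/2) = m x * (4 * exp 1 * (r x * r x powr (-1/2)))"
        using m_pos[OF x(1)] by (simp add: r_def)
      also have "r x * r x powr (-1/2) = r x powr (1/2)"
        using r powr_add[of "r x" 1 "-1/2"] by simp
      finally show ?case using m_pos[OF x(1)] by (simp add: field_simps)
    qed
    show "\<forall>\<^sub>F x in at_top. m (\<rho> x) / m x \<le> 1"
      using ev
    proof eventually_elim
      case (elim x)
      then have x: "x > 0" "\<rho> x \<ge> n" "r x < 1" using n by auto
      have "\<rho> x \<le> x" using x r_pos[OF x(1)] by (simp add: \<rho>_def mult_left_le)
      then have "m (\<rho> x) \<le> m x" using x n by (intro m_mono) auto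
      then show ?case using m_pos[OF x(1)] by simp
    qed
    have "((\<lambda>x. 1 - 4 * exp 1 * r x powr (1/2)) \<longlongrightarrow> 1 - 4 * exp 1 * 0) at_top"
      by (intro tendsto_intros r_half)
    then show "((\<lambda>x. 1 - 4 * exp 1 * r x powr (1/2)) \<longlongrightarrow> 1) at_top" by simp
  qed simp
  have "((\<lambda>x. inverse (m (\<rho> x) / m x)) \<longlongrightarrow> inverse 1) at_top"
    by (intro tendsto_intros ratio) simp
  then show "((\<lambda>x. m x / m (\<rho> x)) \<longlongrightarrow> 1) at_top" by simp
qed

end

section \<open>The coefficients of the diffusion\<close>

text \<open>Passes from the oriented Lebesgue integral, taken over an open interval, to the gauge
  integral over the closed one, for which additivity and the fundamental theorem are used.\<close>

lemma interval_integral_lebesgue: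
  assumes "a \<le> b" "set_integrable lebesgue {a..b} (f :: real \<Rightarrow> real)"
  shows "(LINT u=ereal a..ereal b|lebesgue. f u) = integral {a..b} f"
proof -
  have "set_integrable lebesgue {a<..<b} f"
    by (rule set_integrable_subset[OF assms(2)]) auto
  from set_lebesgue_integral_eq_integral(2)[OF this] assms(1) show ?thesis
    by (simp add: interval_lebesgue_integral_def integral_open_interval_real)
qed

lemma L1_loc_subset:
  assumes "L1_loc f" "0 \<le> a"
  shows "set_integrable lebesgue {a..b} f"
proof (rule set_integrable_subset)
  show "set_integrable lebesgue {0..max 0 b} f" using assms(1) by (simp add: L1_loc_def)
qed (use assms(2) in auto)

lemma L1_loc_integrable:
  assumes "L1_loc f" "0 \<le> a"
  shows "f integrable_on {a..b}"
  by (rule set_lebesgue_integral_eq_integral(1)[OF L1_loc_subset[OF assms]])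

text \<open>Moving the base point to 0 removes the orientation of the integral; the two cases are
  additivity on either side of 1.\<close>

lemma W_eq:
  assumes b: "L1_loc b" and x: "x \<ge> 0"
  shows "W b x = exp (integral {0..x} b - integral {0..1} b)"
proof (cases "x \<ge> 1")
  case True
  have "(LINT u=1..x|lebesgue. b u) = integral {1..x} b"
    using interval_integral_lebesgue[OF True L1_loc_subset[OF b]] by (simp add: one_ereal_def)
  moreover have "integral {0..1} b + integral {1..x} b = integral {0..x} b"
    by (rule Henstock_Kurzweil_Integration.integral_combine) (use True L1_loc_integrable[OF b] in auto)
  ultimately show ?thesis by (simp add: W_def)
next
  case False
  then have "x \<le> 1" by simp
  have "(LINT u=1..x|lebesgue. b u) = - (LINT u=x..1|lebesgue. b u)"
    using False by (simp add: interval_lebesgue_integral_def one_ereal_def)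
  also have "(LINT u=x..1|lebesgue. b u) = integral {x..1} b"
    using interval_integral_lebesgue[OF \<open>x \<le> 1\<close> L1_loc_subset[OF b x]] by (simp add: one_ereal_def)
  finally have "(LINT u=1..x|lebesgue. b u) = - integral {x..1} b" .
  moreover have "integral {0..x} b + integral {x..1} b = integral {0..1} b"
    by (rule Henstock_Kurzweil_Integration.integral_combine) (use \<open>x \<le> 1\<close> x L1_loc_integrable[OF b] in auto)
  ultimately show ?thesis by (simp add: W_def)
qed

lemma W_pos: "W b x > 0"
  by (simp add: W_def)

lemma continuous_on_W:
  assumes b: "L1_loc b"
  shows "continuous_on {0..} (W b)"
proof -
  have "continuous_on {0..} (\<lambda>x. integral {0..x} b)"
    unfolding continuous_on_eq_continuous_within
  proof
    fix t :: real assume t: "t \<in> {0..}"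
    have "continuous_on {0..t+1} (\<lambda>x. integral {0..x} b)"
      by (rule indefinite_integral_continuous_1[OF L1_loc_integrable[OF b]]) simp
    then have "continuous (at t within {0..t+1}) (\<lambda>x. integral {0..x} b)"
      using t by (simp add: continuous_on_eq_continuous_within)
    moreover have "at t within {0..t+1} = at t within {0..}"
      by (rule at_within_nhd[of _ "{t-1<..<t+1}"]) auto
    ultimately show "continuous (at t within {0..}) (\<lambda>x. integral {0..x} b)"
      by (simp add: continuous_within)
  qed
  then have "continuous_on {0..} (\<lambda>x. exp (integral {0..x} b - integral {0..1} b))"
    by (intro continuous_intros)
  then show ?thesis
    by (rule continuous_on_eq) (simp add: W_eq[OF b])
qed

lemma interval_integral_continuous:
  assumes "continuous_on {0..} (q :: real \<Rightarrow> real)" "x \<ge> 0"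
  shows "(LINT u=0..x|lebesgue. q u) = integral {0..x} q"
proof -
  have "set_integrable lebesgue {0..x} q"
    using continuous_on_subset[OF assms(1)] by (intro absolutely_integrable_continuous_real) auto
  from interval_integral_lebesgue[OF assms(2) this] show ?thesis by (simp add: zero_ereal_def)
qed

lemma interval_integral_deriv:
  assumes q: "continuous_on {0..} (q :: real \<Rightarrow> real)" and x: "x \<ge> 0"
  shows "((\<lambda>x. LINT u=0..x|lebesgue. q u) has_real_derivative q x) (at x within {0..})"
  by (rule has_field_derivative_transform_within[OF antiderivative_atLeast[OF q x], of 1])
     (use x in \<open>auto simp: interval_integral_continuous[OF q]\<close>)

text \<open>This is V. Probabilistically, V z - V x is the mean time to reach z from x \<le>
  z.\<close>

definition Lyapunov :: "(real \<Rightarrow> real) \<Rightarrow> real \<Rightarrow> real" where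
  "Lyapunov b x = integral {0..x} (\<lambda>u. speed b u / W b u)"

lemma speed_scale_W:
  assumes b: "L1_loc b" and "filterlim (speed b) at_top at_top"
  shows "speed_scale (W b) (scale b) (speed b) (Lyapunov b)"
proof
  note Wc = continuous_on_W[OF b]
  have W0: "W b x \<noteq> 0" for x using W_pos[of b x] by simp
  show speed: "(speed b has_real_derivative 2 * W b x) (at x within {0..})" if "x \<ge> 0" for x
    unfolding speed_def[abs_def] using DERIV_cmult[OF interval_integral_deriv[OF Wc that], of 2] by simp
  have "continuous_on {0..} (\<lambda>x. speed b x / W b x)"
    by (intro continuous_intros Wc continuous_on_of_deriv_atLeast[OF speed]) (use W0 in auto)
  then show "(Lyapunov b has_real_derivative speed b x / W b x) (at x within {0..})" if "x \<ge> 0" for x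
    unfolding Lyapunov_def[abs_def] using that by (rule antiderivative_atLeast)
  show "(scale b has_real_derivative 1 / W b x) (at x within {0..})" if "x \<ge> 0" for x
    unfolding scale_def[abs_def]
    by (rule interval_integral_deriv[OF _ that]) (intro continuous_intros Wc ballI W0)
  show "scale b 0 = 0" "speed b 0 = 0"
    unfolding scale_def speed_def by (simp_all add: interval_lebesgue_integral_def zero_ereal_def set_lebesgue_integral_def)
  show "Lyapunov b 0 = 0" by (simp add: Lyapunov_def)
qed (use assms W_pos continuous_on_W in auto)

section \<open>Derivatives with respect to scale and speed\<close>

lemma has_deriv_wrt_iff:
  assumes \<phi>: "(\<phi> has_real_derivative d) (at x within {0..})" "d \<noteq> 0"
    and inj: "inj_on \<phi> {0..}" and x: "x \<ge> 0"
  shows "has_deriv_wrt f \<phi> D x \<longleftrightarrow> (f has_real_derivative D * d) (at x within {0..})"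
proof -
  \<comment> \<open>Injectivity keeps both denominators away from 0 near \<open>x\<close>, so
    difference quotients can be multiplied and divided freely.\<close>
  have ev: "\<forall>\<^sub>F y in at x within {0..}. y \<noteq> x \<and> \<phi> y - \<phi> x \<noteq> 0"
    unfolding eventually_at_filter
    by (rule always_eventually) (use inj x in \<open>auto simp: inj_on_def\<close>)
  have \<phi>': "((\<lambda>y. (\<phi> y - \<phi> x) / (y - x)) \<longlongrightarrow> d) (at x within {0..})"
    using \<phi>(1) by (simp add: has_field_derivative_iff)
  show ?thesis
  proof
    assume "has_deriv_wrt f \<phi> D x"
    then have "((\<lambda>y. (f y - f x) / (\<phi> y - \<phi> x) * ((\<phi> y - \<phi> x) / (y - x))) \<longlongrightarrow> D * d) (at x within {0..})"
      unfolding has_deriv_wrt_def by (rule tendsto_mult[OF _ \<phi>'])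
    moreover have "\<forall>\<^sub>F y in at x within {0..}.
        (f y - f x) / (\<phi> y - \<phi> x) * ((\<phi> y - \<phi> x) / (y - x)) = (f y - f x) / (y - x)"
      using ev by eventually_elim simp
    ultimately show "(f has_real_derivative D * d) (at x within {0..})"
      unfolding has_field_derivative_iff by (rule Lim_transform_eventually)
  next
    assume "(f has_real_derivative D * d) (at x within {0..})"
    then have "((\<lambda>y. (f y - f x) / (y - x) / ((\<phi> y - \<phi> x) / (y - x))) \<longlongrightarrow> D * d / d) (at x within {0..})"
      unfolding has_field_derivative_iff by (rule tendsto_divide[OF _ \<phi>' \<phi>(2)])
    moreover have "\<forall>\<^sub>F y in at x within {0..}.
        (f y - f x) / (y - x) / ((\<phi> y - \<phi> x) / (y - x)) = (f y - f x) / (\<phi> y - \<phi> x)"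
      using ev by eventually_elim simp
    ultimately have "((\<lambda>y. (f y - f x) / (\<phi> y - \<phi> x)) \<longlongrightarrow> D * d / d) (at x within {0..})"
      by (rule Lim_transform_eventually)
    then show "has_deriv_wrt f \<phi> D x" using \<phi>(2) by (simp add: has_deriv_wrt_def)
  qed
qed

lemma (in speed_scale) has_deriv_wrt_scale:
  assumes "x \<ge> 0"
  shows "has_deriv_wrt f s D x \<longleftrightarrow> (f has_real_derivative D / w x) (at x within {0..})"
proof -
  have "inj_on s {0..}" by (auto intro!: strict_mono_on_imp_inj_on strict_mono_onI s_strict_mono)
  from has_deriv_wrt_iff[OF s_deriv[OF assms] _ this assms] show ?thesis using w_pos[OF assms] by simp
qed

lemma (in speed_scale) has_deriv_wrt_speed:
  assumes "x \<ge> 0"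
  shows "has_deriv_wrt f m D x \<longleftrightarrow> (f has_real_derivative 2 * w x * D) (at x within {0..})"
proof -
  have "inj_on m {0..}" by (auto intro!: strict_mono_on_imp_inj_on strict_mono_onI m_strict_mono)
  from has_deriv_wrt_iff[OF m_deriv[OF assms] _ this assms] show ?thesis
    using w_pos[OF assms] by (simp add: mult.commute)
qed

lemma reflecting_L_iff:
  assumes "speed_scale (W b) (scale b) (speed b) V"
  shows "f \<in> C0 \<and> g \<in> C0 \<and> reflecting_L b f g \<longleftrightarrow> speed_scale.Lgraph (W b) f g"
proof -
  interpret speed_scale "W b" "scale b" "speed b" V by fact
  show ?thesis
    unfolding Lgraph_def reflecting_L_def
    by (simp add: has_deriv_wrt_scale has_deriv_wrt_speed conj_ac cong: conj_cong)
qed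

lemma has_integral_inverse_Icc:
  fixes c :: real
  assumes "0 < u" "u \<le> x"
  shows "((\<lambda>v. c / v) has_integral c * ln (x / u)) {u..x}"
proof -
  have "((\<lambda>v. c / v) has_integral c * ln x - c * ln u) {u..x}"
    by (rule fundamental_theorem_of_calculus)
       (use assms in \<open>auto intro!: derivative_eq_intros simp: has_real_derivative_iff_has_vector_derivative[symmetric]\<close>)
  then show ?thesis using assms by (simp add: ln_div right_diff_distrib)
qed

text \<open>W x / W u is the exponential of the integral of \<open>b\<close> over [u, x]. There -1/v
  contributes u / x, \<epsilon> a factor between (x/u)^(-\<kappa>) and (x/u)^\<kappa>, and \<eta> a
  factor between 1/e and e, because increments of its convergent integral are eventually below
  1.\<close>

lemma W_potter:
  assumes b: "L1_loc b" and eq: "\<And>x. x \<ge> 1 \<Longrightarrow> b x = (- 1 + \<epsilon> x) / x + \<eta> x"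
    and \<epsilon>: "(\<epsilon> \<longlongrightarrow> 0) at_top" and \<eta>: "L1_loc \<eta>"
    and A: "((\<lambda>x::real. LINT u=1..x|lebesgue. \<eta> u) \<longlongrightarrow> A) at_top"
    and \<kappa>: "0 < \<kappa>"
  shows "\<exists>n\<ge>1. \<forall>u x. n \<le> u \<longrightarrow> u \<le> x \<longrightarrow>
      W b u \<le> exp 1 * W b x * (x / u) powr (1 + \<kappa>) \<and> W b x * (x / u) powr (1 - \<kappa>) \<le> exp 1 * W b u"
proof -
  define H where "H x = (LINT u=1..x|lebesgue. \<eta> u)" for x :: real
  have half: "(0::real) < 1 / 2" by simp
  have "\<forall>\<^sub>F x in at_top. 1 \<le> x \<and> \<bar>\<epsilon> x\<bar> < \<kappa> \<and> \<bar>H x - A\<bar> < 1 / 2"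
    using eventually_ge_at_top[of 1] tendstoD[OF \<epsilon> \<kappa>] tendstoD[OF A half]
    by eventually_elim (auto simp: dist_real_def H_def)
  then obtain n where n: "\<And>x. x \<ge> n \<Longrightarrow> 1 \<le> x \<and> \<bar>\<epsilon> x\<bar> < \<kappa> \<and> \<bar>H x - A\<bar> < 1 / 2"
    by (auto simp: eventually_at_top_linorder)
  have "W b u \<le> exp 1 * W b x * (x / u) powr (1 + \<kappa>) \<and> W b x * (x / u) powr (1 - \<kappa>) \<le> exp 1 * W b u"
    if u: "n \<le> u" and x: "u \<le> x" for u x
  proof -
    have u1: "u \<ge> 1" using n[OF u] by simp
    define L where "L = ln (x / u)"
    define D where "D = integral {u..x} b"
    have int_\<eta>: "\<eta> integrable_on {u..x}" and int_b: "b integrable_on {u..x}"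
      using u1 by (auto intro!: L1_loc_integrable \<eta> b)
    have "integral {u..x} \<eta> = H x - H u"
    proof -
      have "H y = integral {1..y} \<eta>" if "y \<ge> 1" for y
        unfolding H_def using interval_integral_lebesgue[OF that L1_loc_subset[OF \<eta>]]
        by (simp add: one_ereal_def)
      moreover have "integral {1..u} \<eta> + integral {u..x} \<eta> = integral {1..x} \<eta>"
        by (rule Henstock_Kurzweil_Integration.integral_combine)
           (use u1 x L1_loc_integrable[OF \<eta>] in auto)
      ultimately show ?thesis using u1 x by simp
    qed
    then have I\<eta>: "\<bar>integral {u..x} \<eta>\<bar> < 1" using n[OF u] n[of x] u x by (simp add: abs_if split: if_splits)
    have I: "((\<lambda>v. c / v + \<eta> v) has_integral c * L + integral {u..x} \<eta>) {u..x}" for c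
      unfolding L_def by (intro has_integral_add has_integral_inverse_Icc integrable_integral int_\<eta>)
        (use u1 x in auto)
    have up: "D \<le> (- 1 + \<kappa>) * L + integral {u..x} \<eta>"
      unfolding D_def
    proof (rule has_integral_le[OF integrable_integral[OF int_b] I])
      fix v assume v: "v \<in> {u..x}"
      then show "b v \<le> (- 1 + \<kappa>) / v + \<eta> v"
        using n[of v] u u1 by (auto simp: eq intro!: divide_right_mono)
    qed
    have low: "(- 1 - \<kappa>) * L + integral {u..x} \<eta> \<le> D"
      unfolding D_def
    proof (rule has_integral_le[OF I integrable_integral[OF int_b]])
      fix v assume v: "v \<in> {u..x}"
      then show "(- 1 - \<kappa>) / v + \<eta> v \<le> b v"
        using n[of v] u u1 by (auto simp: eq intro!: divide_right_mono)
    qed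
    have "integral {0..u} b + integral {u..x} b = integral {0..x} b"
      by (rule Henstock_Kurzweil_Integration.integral_combine)
         (use u1 x L1_loc_integrable[OF b] in auto)
    then have Wx: "W b x = W b u * exp D"
      using u1 x by (simp add: W_eq[OF b] D_def exp_add[symmetric])
    have pw: "(x / u) powr c = exp (c * L)" for c
      using u1 x by (simp add: powr_def L_def)
    have "W b u * 1 \<le> W b u * exp (1 + D + (1 + \<kappa>) * L)"
      using low I\<eta> W_pos[of b u] by (intro mult_left_mono) (auto simp: algebra_simps)
    then have 1: "W b u \<le> exp 1 * W b x * (x / u) powr (1 + \<kappa>)"
      by (simp add: Wx pw exp_add mult_ac)
    have "W b u * exp (D + (1 - \<kappa>) * L) \<le> W b u * exp 1"
      using up I\<eta> W_pos[of b u] by (intro mult_left_mono) (auto simp: algebra_simps)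
    then have 2: "W b x * (x / u) powr (1 - \<kappa>) \<le> exp 1 * W b u"
      by (simp add: Wx pw exp_add mult_ac)
    from 1 2 show ?thesis ..
  qed
  then show ?thesis using n[of n] by blast
qed

section \<open>The semigroup of the Markov process\<close>

lemma C0_extension_measurable:
  assumes "continuous_on {0..} (f :: real \<Rightarrow> real)"
  shows "(\<lambda>y. indicator {0..} y * f y) \<in> borel_measurable borel"
  using borel_measurable_continuous_on_indicator[OF _ assms] by simp

locale feller_process =
  fixes P :: "real \<Rightarrow> 'w measure" and X :: "real \<Rightarrow> 'w \<Rightarrow> real"
  assumes markov: "continuous_markov_process P X" and feller: "feller P X"
begin

abbreviation "T \<equiv> transition_op P X"

lemmas markovD = markov[unfolded continuous_markov_process_def]
lemmas P_laws = markovD[THEN conjunct1, rule_format]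
  and X_measurable_0 = markovD[THEN conjunct2, THEN conjunct1, rule_format]
  and X_paths = markovD[THEN conjunct2, THEN conjunct2, THEN conjunct1, rule_format]
  and X_start = markovD[THEN conjunct2, THEN conjunct2, THEN conjunct2, THEN conjunct1, rule_format]
  and kernel_measure_measurable =
    markovD[THEN conjunct2, THEN conjunct2, THEN conjunct2, THEN conjunct2, THEN conjunct1, rule_format]
  and markov_property =
    markovD[THEN conjunct2, THEN conjunct2, THEN conjunct2, THEN conjunct2, THEN conjunct2, rule_format]

lemma prob_space_P: "x \<ge> 0 \<Longrightarrow> prob_space (P x)"
  and sets_P: "x \<ge> 0 \<Longrightarrow> sets (P x) = sets (P 0)"
  using P_laws[of x] by simp_all

lemma space_P: "x \<ge> 0 \<Longrightarrow> space (P x) = space (P 0)"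
  by (rule sets_eq_imp_space_eq[OF sets_P])

lemma X_measurable: "x \<ge> 0 \<Longrightarrow> t \<ge> 0 \<Longrightarrow> X t \<in> borel_measurable (P x)"
  unfolding measurable_cong_sets[OF sets_P refl] by (rule X_measurable_0)

lemma X_nonneg: "x \<ge> 0 \<Longrightarrow> t \<ge> 0 \<Longrightarrow> \<omega> \<in> space (P x) \<Longrightarrow> X t \<omega> \<ge> 0"
  using X_paths[of \<omega>] space_P[of x] by simp

lemma X_measurable_halfline:
  "x \<ge> 0 \<Longrightarrow> t \<ge> 0 \<Longrightarrow> X t \<in> measurable (P x) (restrict_space borel {0..})"
  using X_nonneg X_measurable by (intro measurable_restrict_space2) auto

lemma C0_X_measurable:
  assumes "continuous_on {0..} f" "x \<ge> 0" "t \<ge> 0"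
  shows "(\<lambda>\<omega>. f (X t \<omega>)) \<in> borel_measurable (P x)"
  by (rule measurable_compose[OF X_measurable_halfline[OF assms(2,3)]
        borel_measurable_continuous_on_restrict[OF assms(1)]])

lemma C0_X_integrable:
  assumes f: "f \<in> C0" and x: "x \<ge> 0" and t: "t \<ge> 0"
  shows "integrable (P x) (\<lambda>\<omega>. f (X t \<omega>))"
proof -
  interpret prob_space "P x" by (rule prob_space_P[OF x])
  have cont: "continuous_on {0..} f" using f by (simp add: C0_def)
  obtain C where C: "\<And>y. y \<ge> 0 \<Longrightarrow> \<bar>f y\<bar> \<le> C" using C0_bounded[OF f] by blast
  show ?thesis
  proof (rule integrable_const_bound[where B = C])
    show "AE \<omega> in P x. norm (f (X t \<omega>)) \<le> C"
      by (rule AE_I2) (simp add: C X_nonneg[OF x t])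
  qed (rule C0_X_measurable[OF cont x t])
qed

lemma T_lin:
  assumes "t \<ge> 0" "f \<in> C0" "g \<in> C0" "x \<ge> 0"
  shows "T t (\<lambda>x. a * f x + c * g x) x = a * T t f x + c * T t g x"
  using C0_X_integrable[OF assms(2,4,1)] C0_X_integrable[OF assms(3,4,1)]
  by (simp add: transition_op_def)

lemma T_le_const:
  assumes t: "t \<ge> 0" and f: "f \<in> C0" "\<And>y. y \<ge> 0 \<Longrightarrow> f y \<le> c" and x: "x \<ge> 0"
  shows "T t f x \<le> c"
proof -
  interpret prob_space "P x" by (rule prob_space_P[OF x])
  show ?thesis unfolding transition_op_def
    by (rule integral_le_const[OF C0_X_integrable[OF f(1) x t]])
       (rule AE_I2, rule f(2), rule X_nonneg[OF x t])
qed

lemma T_ge_const: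
  assumes t: "t \<ge> 0" and f: "f \<in> C0" "\<And>y. y \<ge> 0 \<Longrightarrow> c \<le> f y" and x: "x \<ge> 0"
  shows "c \<le> T t f x"
  using T_le_const[OF t C0_lin[OF f(1,1), of "-1" 0] _ x, of "- c"] T_lin[OF t f(1,1) x, of "-1" 0] f(2)
  by simp

lemma T_0:
  assumes f: "f \<in> C0" and x: "x \<ge> 0"
  shows "T 0 f x = f x"
proof -
  interpret prob_space "P x" by (rule prob_space_P[OF x])
  have "AE \<omega> in P x. X 0 \<omega> = x" by (rule X_start[OF x])
  then have "AE \<omega> in P x. f (X 0 \<omega>) = f x" by eventually_elim simp
  then have "T 0 f x = (LINT \<omega>|P x. f x)"
    unfolding transition_op_def
    by (rule integral_cong_AE[rotated 2]) (use C0_X_integrable[OF f x] in auto)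
  then show ?thesis by (simp add: prob_space)
qed

lemma kernel_measurable:
  assumes "t \<ge> 0" "B \<in> sets borel"
  shows "(\<lambda>x. emeasure (P x) {\<omega>\<in>space (P x). X t \<omega> \<in> B}) \<in> borel_measurable (restrict_space borel {0..})"
proof -
  have "(\<lambda>x. ennreal (measure (P x) {\<omega>\<in>space (P x). X t \<omega> \<in> B})) \<in> borel_measurable (restrict_space borel {0..})"
  proof (rule measurable_compose[OF _ measurable_ennreal])
    show "(\<lambda>x. measure (P x) {\<omega>\<in>space (P x). X t \<omega> \<in> B}) \<in> borel_measurable (restrict_space borel {0..})"
      by (rule kernel_measure_measurable[OF assms])
  qed
  then show ?thesis
  proof (rule measurable_cong[THEN iffD1, rotated])
    fix x assume "x \<in> space (restrict_space borel {0::real..})"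
    then interpret prob_space "P x" by (intro prob_space_P) (simp add: space_restrict_space)
    show "ennreal (measure (P x) {\<omega>\<in>space (P x). X t \<omega> \<in> B}) = emeasure (P x) {\<omega>\<in>space (P x). X t \<omega> \<in> B}"
      by (simp add: emeasure_eq_measure)
  qed
qed

text \<open>Expectations are taken in the Markov property, conditional expectation preserving the
  integral. Values in \<open>ennreal\<close> prepare the passage to nonnegative functions.\<close>

lemma markov_sets:
  assumes x: "x \<ge> 0" and s: "s \<ge> 0" and t: "t \<ge> 0" and B: "B \<in> sets borel"
  shows "emeasure (P x) {\<omega>\<in>space (P x). X (s + t) \<omega> \<in> B} =
    (\<integral>\<^sup>+\<omega>. emeasure (P (X s \<omega>)) {\<omega>'\<in>space (P (X s \<omega>)). X t \<omega>' \<in> B} \<partial>P x)"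
proof -
  interpret prob_space "P x" by (rule prob_space_P[OF x])
  define F where "F = past (P x) X s"
  define K where "K y = measure (P y) {\<omega>'\<in>space (P y). X t \<omega>' \<in> B}" for y
  \<comment> \<open>The past is generated by events of \<open>P x\<close>, hence a subalgebra, as
    conditional expectation requires.\<close>
  have gen: "{X u -` B \<inter> space (P x) | u B. 0 \<le> u \<and> u \<le> s \<and> B \<in> sets borel} \<subseteq> sets (P x)"
    using measurable_sets[OF X_measurable[OF x]] by auto
  then have gen': "{X u -` B \<inter> space (P x) | u B. 0 \<le> u \<and> u \<le> s \<and> B \<in> sets borel} \<subseteq> Pow (space (P x))"
    using sets.sets_into_space by blast
  have "subalgebra (P x) F"
    unfolding subalgebra_def F_def past_def
    using space_measure_of[OF gen'] sets_measure_of[OF gen'] sets.sigma_sets_subset[OF gen] by simp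
  then interpret finite_measure_subalgebra "P x" F
    by unfold_locales
  have Km: "K \<in> borel_measurable (restrict_space borel {0..})"
    unfolding K_def by (rule kernel_measure_measurable[OF t B])
  have KX: "(\<lambda>\<omega>. K (X s \<omega>)) \<in> borel_measurable (P x)"
    by (rule measurable_compose[OF X_measurable_halfline[OF x s] Km])
  have ind: "(\<lambda>\<omega>. indicator B (X (s + t) \<omega>) :: real) \<in> borel_measurable (P x)"
    using X_measurable[OF x add_nonneg_nonneg[OF s t]] B by measurable
  have int: "integrable (P x) (\<lambda>\<omega>. indicator B (X (s + t) \<omega>) :: real)"
    by (rule integrable_const_bound[where B = 1]) (use ind in auto)
  have "AE \<omega> in P x. real_cond_exp (P x) F (\<lambda>\<omega>'. indicator B (X (s + t) \<omega>')) \<omega> = K (X s \<omega>)"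
    unfolding K_def F_def by (rule markov_property[OF x s t B])
  then have "(\<integral>\<omega>. real_cond_exp (P x) F (\<lambda>\<omega>'. indicator B (X (s + t) \<omega>')) \<omega> \<partial>P x) = (\<integral>\<omega>. K (X s \<omega>) \<partial>P x)"
    by (rule integral_cong_AE[rotated 2]) (use KX in auto)
  then have eq: "(\<integral>\<omega>. indicator B (X (s + t) \<omega>) \<partial>P x) = (\<integral>\<omega>. K (X s \<omega>) \<partial>P x)"
    using real_cond_exp_int(2)[OF int] by simp
  have "{\<omega>\<in>space (P x). X (s + t) \<omega> \<in> B} \<in> sets (P x)"
    using measurable_sets[OF X_measurable[OF x] B, of "s + t"] s t
    by (simp add: vimage_def Int_def conj_commute)
  then have "emeasure (P x) {\<omega>\<in>space (P x). X (s + t) \<omega> \<in> B} = ennreal (\<integral>\<omega>. indicator {\<omega>\<in>space (P x). X (s + t) \<omega> \<in> B} \<omega> \<partial>P x)"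
    by (simp add: emeasure_eq_measure Int_absorb1 subset_eq)
  also have "(\<integral>\<omega>. indicator {\<omega>\<in>space (P x). X (s + t) \<omega> \<in> B} \<omega> \<partial>P x) = (\<integral>\<omega>. indicator B (X (s + t) \<omega>) \<partial>P x)"
    by (rule Bochner_Integration.integral_cong) (auto simp: indicator_def)
  also have "ennreal \<dots> = ennreal (\<integral>\<omega>. K (X s \<omega>) \<partial>P x)" by (simp add: eq)
  also have "\<dots> = (\<integral>\<^sup>+\<omega>. ennreal (K (X s \<omega>)) \<partial>P x)"
  proof (rule nn_integral_eq_integral[symmetric])
    show "integrable (P x) (\<lambda>\<omega>. K (X s \<omega>))"
    proof (rule integrable_const_bound[where B = 1, OF _ KX], rule AE_I2)
      fix \<omega> assume "\<omega> \<in> space (P x)"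
      then interpret Q: prob_space "P (X s \<omega>)" by (intro prob_space_P X_nonneg[OF x s])
      show "norm (K (X s \<omega>)) \<le> 1" by (simp add: K_def)
    qed
  qed (simp add: K_def)
  also have "\<dots> = (\<integral>\<^sup>+\<omega>. emeasure (P (X s \<omega>)) {\<omega>'\<in>space (P (X s \<omega>)). X t \<omega>' \<in> B} \<partial>P x)"
  proof (rule nn_integral_cong)
    fix \<omega> assume "\<omega> \<in> space (P x)"
    then interpret Q: prob_space "P (X s \<omega>)" by (intro prob_space_P X_nonneg[OF x s])
    show "ennreal (K (X s \<omega>)) = emeasure (P (X s \<omega>)) {\<omega>'\<in>space (P (X s \<omega>)). X t \<omega>' \<in> B}"
      by (simp add: K_def Q.emeasure_eq_measure)
  qed
  finally show ?thesis .
qed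

abbreviation E :: "real \<Rightarrow> (real \<Rightarrow> ennreal) \<Rightarrow> real \<Rightarrow> ennreal" where
  "E t g y \<equiv> \<integral>\<^sup>+\<omega>. g (X t \<omega>) \<partial>P y"

text \<open>Extends the identity from indicators. Measurability of the inner integral in its
  starting point runs through the same induction, since linearity and monotone convergence of the
  outer integral rely on it.\<close>

lemma markov_nn_integral:
  assumes t: "t \<ge> 0" and g: "g \<in> borel_measurable borel"
  shows "(\<lambda>y. E t g y) \<in> borel_measurable (restrict_space borel {0..}) \<and>
    (\<forall>x\<ge>0. \<forall>s\<ge>0. E (s + t) g x = (\<integral>\<^sup>+\<omega>. E t g (X s \<omega>) \<partial>P x))"
  using g
proof (induction rule: borel_measurable_induct)
  case (cong f g)
  then have "f = g" by auto
  with cong show ?case by simp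
next
  case (set A)
  have eq: "E r (indicator A) x = emeasure (P x) {\<omega>\<in>space (P x). X r \<omega> \<in> A}"
    if "x \<ge> 0" "r \<ge> 0" for x r
  proof -
    have "{\<omega>\<in>space (P x). X r \<omega> \<in> A} \<in> sets (P x)"
      using measurable_sets[OF X_measurable[OF that] set]
      by (simp add: vimage_def Int_def conj_commute)
    moreover have "E r (indicator A) x = (\<integral>\<^sup>+\<omega>. indicator {\<omega>\<in>space (P x). X r \<omega> \<in> A} \<omega> \<partial>P x)"
      by (rule nn_integral_cong) (auto simp: indicator_def)
    ultimately show ?thesis by simp
  qed
  have "(\<lambda>y. E t (indicator A) y) \<in> borel_measurable (restrict_space borel {0..})"
    using kernel_measurable[OF t set]
    by (rule measurable_cong[THEN iffD1, rotated]) (simp add: eq t space_restrict_space)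
  moreover have "E (s + t) (indicator A) x = (\<integral>\<^sup>+\<omega>. E t (indicator A) (X s \<omega>) \<partial>P x)"
    if "x \<ge> 0" "s \<ge> 0" for x s
    using markov_sets[OF that t set] that t
    by (simp add: eq X_nonneg cong: nn_integral_cong)
  ultimately show ?case by simp
next
  case (mult u c)
  have m: "(\<lambda>\<omega>. u (X r \<omega>)) \<in> borel_measurable (P x)" if "x \<ge> 0" "r \<ge> 0" for x r
    using X_measurable[OF that] mult(2) by measurable
  have eq: "(\<integral>\<^sup>+\<omega>. c * u (X r \<omega>) \<partial>P x) = c * E r u x" if "x \<ge> 0" "r \<ge> 0" for x r
    by (rule nn_integral_cmult[OF m[OF that]])
  have 1: "(\<lambda>y. \<integral>\<^sup>+\<omega>. c * u (X t \<omega>) \<partial>P y) \<in> borel_measurable (restrict_space borel {0..})"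
    by (rule measurable_cong[THEN iffD2, OF _ borel_measurable_times_ennreal[OF measurable_const]])
       (use mult eq t in \<open>auto simp: space_restrict_space\<close>)
  have "(\<integral>\<^sup>+\<omega>. c * u (X (s + t) \<omega>) \<partial>P x) = (\<integral>\<^sup>+\<omega>. (\<integral>\<^sup>+\<omega>'. c * u (X t \<omega>') \<partial>P (X s \<omega>)) \<partial>P x)"
    if xs: "x \<ge> 0" "s \<ge> 0" for x s
  proof -
    have "(\<integral>\<^sup>+\<omega>. (\<integral>\<^sup>+\<omega>'. c * u (X t \<omega>') \<partial>P (X s \<omega>)) \<partial>P x) = (\<integral>\<^sup>+\<omega>. c * E t u (X s \<omega>) \<partial>P x)"
      by (rule nn_integral_cong) (use eq t X_nonneg[OF xs] in auto)
    also have "\<dots> = c * (\<integral>\<^sup>+\<omega>. E t u (X s \<omega>) \<partial>P x)"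
      by (rule nn_integral_cmult[OF measurable_compose[OF X_measurable_halfline[OF xs]]]) (use mult in auto)
    finally show ?thesis using mult eq[of x "s + t"] xs t by simp
  qed
  with 1 show ?case by simp
next
  case (add u v)
  have m: "(\<lambda>\<omega>. u (X r \<omega>)) \<in> borel_measurable (P x)" "(\<lambda>\<omega>. v (X r \<omega>)) \<in> borel_measurable (P x)"
    if "x \<ge> 0" "r \<ge> 0" for x r
    using X_measurable[OF that] add(1,3) by measurable
  have eq: "(\<integral>\<^sup>+\<omega>. v (X r \<omega>) + u (X r \<omega>) \<partial>P x) = E r v x + E r u x"
    if "x \<ge> 0" "r \<ge> 0" for x r
    by (rule nn_integral_add[OF m(2,1)[OF that]])
  have 1: "(\<lambda>y. \<integral>\<^sup>+\<omega>. v (X t \<omega>) + u (X t \<omega>) \<partial>P y) \<in> borel_measurable (restrict_space borel {0..})"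
    by (rule measurable_cong[THEN iffD2, OF _ borel_measurable_add])
       (use add eq t in \<open>auto simp: space_restrict_space\<close>)
  have "(\<integral>\<^sup>+\<omega>. v (X (s + t) \<omega>) + u (X (s + t) \<omega>) \<partial>P x)
      = (\<integral>\<^sup>+\<omega>. (\<integral>\<^sup>+\<omega>'. v (X t \<omega>') + u (X t \<omega>') \<partial>P (X s \<omega>)) \<partial>P x)"
    if xs: "x \<ge> 0" "s \<ge> 0" for x s
  proof -
    have "(\<integral>\<^sup>+\<omega>. (\<integral>\<^sup>+\<omega>'. v (X t \<omega>') + u (X t \<omega>') \<partial>P (X s \<omega>)) \<partial>P x)
        = (\<integral>\<^sup>+\<omega>. E t v (X s \<omega>) + E t u (X s \<omega>) \<partial>P x)"
      by (rule nn_integral_cong) (use eq t X_nonneg[OF xs] in auto)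
    also have "\<dots> = (\<integral>\<^sup>+\<omega>. E t v (X s \<omega>) \<partial>P x) + (\<integral>\<^sup>+\<omega>. E t u (X s \<omega>) \<partial>P x)"
      by (rule nn_integral_add; rule measurable_compose[OF X_measurable_halfline[OF xs]]) (use add in auto)
    finally show ?thesis using add eq[of x "s + t"] xs t by simp
  qed
  with 1 show ?case by simp
next
  case (seq U)
  have m: "(\<lambda>\<omega>. U i (X r \<omega>)) \<in> borel_measurable (P x)" if "x \<ge> 0" "r \<ge> 0" for x r i
    using X_measurable[OF that] seq(1) by measurable
  have eq: "(\<integral>\<^sup>+\<omega>. (SUP i. U i) (X r \<omega>) \<partial>P x) = (SUP i. E r (U i) x)"
    if "x \<ge> 0" "r \<ge> 0" for x r
    unfolding SUP_apply
    by (rule nn_integral_monotone_convergence_SUP[OF _ m[OF that]])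
       (use \<open>incseq U\<close> in \<open>auto simp: incseq_def le_fun_def\<close>)
  have 1: "(\<lambda>y. \<integral>\<^sup>+\<omega>. (SUP i. U i) (X t \<omega>) \<partial>P y) \<in> borel_measurable (restrict_space borel {0..})"
    by (rule measurable_cong[THEN iffD2, OF _ borel_measurable_SUP[OF countableI_type]])
       (use seq eq t in \<open>auto simp: space_restrict_space\<close>)
  have "(\<integral>\<^sup>+\<omega>. (SUP i. U i) (X (s + t) \<omega>) \<partial>P x) = (\<integral>\<^sup>+\<omega>. (\<integral>\<^sup>+\<omega>'. (SUP i. U i) (X t \<omega>') \<partial>P (X s \<omega>)) \<partial>P x)"
    if xs: "x \<ge> 0" "s \<ge> 0" for x s
  proof -
    have "(\<integral>\<^sup>+\<omega>. (\<integral>\<^sup>+\<omega>'. (SUP i. U i) (X t \<omega>') \<partial>P (X s \<omega>)) \<partial>P x)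
        = (\<integral>\<^sup>+\<omega>. (SUP i. E t (U i) (X s \<omega>)) \<partial>P x)"
      by (rule nn_integral_cong) (use eq t X_nonneg[OF xs] in auto)
    also have "\<dots> = (SUP i. \<integral>\<^sup>+\<omega>. E t (U i) (X s \<omega>) \<partial>P x)"
    proof (rule nn_integral_monotone_convergence_SUP)
      show "incseq (\<lambda>i \<omega>. E t (U i) (X s \<omega>))"
        using \<open>incseq U\<close> by (auto simp: incseq_def le_fun_def intro!: nn_integral_mono)
      show "(\<lambda>\<omega>. E t (U i) (X s \<omega>)) \<in> borel_measurable (P x)" for i
        by (rule measurable_compose[OF X_measurable_halfline[OF xs]]) (use seq in auto)
    qed
    finally show ?thesis using seq eq[of x "s + t"] xs t by simp
  qed
  with 1 show ?case by simp
qed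

lemma T_C0: "t \<ge> 0 \<Longrightarrow> f \<in> C0 \<Longrightarrow> T t f \<in> C0"
  using feller by (auto simp: feller_def)

text \<open>Adding a bound \<open>C\<close> makes \<open>f\<close> nonnegative, so that the identity
  for nonnegative functions applies; as all laws have mass 1, \<open>C\<close> cancels at the
  end.\<close>

lemma T_semigroup:
  assumes s: "s \<ge> 0" and t: "t \<ge> 0" and f: "f \<in> C0" and x: "x \<ge> 0"
  shows "T (s + t) f x = T s (T t f) x"
proof -
  have cont: "continuous_on {0..} f" using f by (simp add: C0_def)
  obtain C where C: "\<And>y. y \<ge> 0 \<Longrightarrow> \<bar>f y\<bar> \<le> C" using C0_bounded[OF f] by blast
  \<comment> \<open>The cutoff at negative arguments makes \<open>g\<close> Borel on the whole line;
    the process never sees it.\<close>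
  define g where "g y = ennreal (indicator {0..} y * f y + C)" for y
  have g: "g \<in> borel_measurable borel"
    unfolding g_def using C0_extension_measurable[OF cont] by measurable
  have C_shift: "(\<integral>\<^sup>+\<omega>. ennreal (h (X r \<omega>) + C) \<partial>P y) = ennreal (T r h y + C)"
    if "y \<ge> 0" "r \<ge> 0" "h \<in> C0" "\<And>z. z \<ge> 0 \<Longrightarrow> - C \<le> h z" for y r h
  proof -
    interpret prob_space "P y" by (rule prob_space_P[OF that(1)])
    have "(\<integral>\<^sup>+\<omega>. ennreal (h (X r \<omega>) + C) \<partial>P y) = ennreal (\<integral>\<omega>. h (X r \<omega>) + C \<partial>P y)"
    proof (rule nn_integral_eq_integral)
      show "AE \<omega> in P y. 0 \<le> h (X r \<omega>) + C"
      proof (rule AE_I2)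
        fix \<omega> assume "\<omega> \<in> space (P y)"
        from that(4)[OF X_nonneg[OF that(1,2) this]] show "0 \<le> h (X r \<omega>) + C" by simp
      qed
    qed (use C0_X_integrable[OF that(3,1,2)] in auto)
    also have "(\<integral>\<omega>. h (X r \<omega>) + C \<partial>P y) = T r h y + C"
      using C0_X_integrable[OF that(3,1,2)] by (simp add: transition_op_def prob_space)
    finally show ?thesis .
  qed
  have g_eq: "(\<integral>\<^sup>+\<omega>. g (X r \<omega>) \<partial>P y) = ennreal (T r f y + C)" if "y \<ge> 0" "r \<ge> 0" for y r
  proof -
    have "(\<integral>\<^sup>+\<omega>. g (X r \<omega>) \<partial>P y) = (\<integral>\<^sup>+\<omega>. ennreal (f (X r \<omega>) + C) \<partial>P y)"
      by (rule nn_integral_cong) (use X_nonneg[OF that] in \<open>auto simp: g_def\<close>)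
    also have "\<dots> = ennreal (T r f y + C)"
    proof (rule C_shift[OF that f])
      fix z :: real assume "z \<ge> 0"
      from C[OF this] show "- C \<le> f z" by simp
    qed
    finally show ?thesis .
  qed
  have T_ge: "- C \<le> T r f y" if "y \<ge> 0" "r \<ge> 0" for y r
  proof (rule T_ge_const[OF that(2) f _ that(1)])
    fix z :: real assume "z \<ge> 0"
    from C[OF this] show "- C \<le> f z" by simp
  qed
  have "ennreal (T (s + t) f x + C) = (\<integral>\<^sup>+\<omega>. g (X (s + t) \<omega>) \<partial>P x)"
    using g_eq[OF x] s t by simp
  also have "\<dots> = (\<integral>\<^sup>+\<omega>. (\<integral>\<^sup>+\<omega>'. g (X t \<omega>') \<partial>P (X s \<omega>)) \<partial>P x)"
    using markov_nn_integral[OF t g] x s by blast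
  also have "\<dots> = (\<integral>\<^sup>+\<omega>. ennreal (T t f (X s \<omega>) + C) \<partial>P x)"
    by (rule nn_integral_cong) (use g_eq t X_nonneg[OF x s] in auto)
  also have "\<dots> = ennreal (T s (T t f) x + C)"
    by (rule C_shift[OF x s T_C0[OF t f]]) (rule T_ge[OF _ t])
  finally have "ennreal (T (s + t) f x + C) = ennreal (T s (T t f) x + C)" .
  moreover have "T (s + t) f x + C \<ge> 0" using T_ge[OF x, of "s + t"] s t by simp
  moreover have "T s (T t f) x + C \<ge> 0"
    using T_ge_const[OF s T_C0[OF t f] T_ge[OF _ t] x] by simp
  ultimately show ?thesis by simp
qed

end

text \<open>Moves the density from \<open>speed_measure b\<close>, a measure on the line, to
  \<open>N\<close> on the half-line. The link between the abstract weight and \<open>b\<close> is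
  the equation \<open>w = W b\<close>.\<close>

lemma (in speed_scale) density_law:
  assumes X: "feller_process P X" and p: "transition_density b P X p"
    and w: "w = W b" and t: "t > 0" and x: "x \<ge> 0"
  shows "distr (P x) (restrict_space borel {0..}) (X t) = density N (\<lambda>y. ennreal (p t x y))"
    "p t x \<in> borel_measurable N"
proof -
  interpret feller_process P X by fact
  have pc: "continuous_on {0..} (p t x)"
  proof -
    have "continuous_on ({0..} \<times> {0..}) (\<lambda>(x, y). p t x y)"
      using p t by (simp add: transition_density_def)
    then have "continuous_on {0..} ((\<lambda>(x, y). p t x y) \<circ> (\<lambda>y. (x, y)))"
      by (intro continuous_on_compose continuous_intros) (erule continuous_on_subset, use x in auto)
    then show ?thesis by (simp add: o_def)
  qed
  then show pm: "p t x \<in> borel_measurable N" by (rule measurable_N)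
  show "distr (P x) (restrict_space borel {0..}) (X t) = density N (\<lambda>y. ennreal (p t x y))"
  proof (rule measure_eqI)
    show "sets (distr (P x) (restrict_space borel {0..}) (X t)) = sets (density N (\<lambda>y. ennreal (p t x y)))"
      by (simp add: sets_N)
    fix B assume "B \<in> sets (distr (P x) (restrict_space borel {0..}) (X t))"
    then have BR: "B \<in> sets (restrict_space borel {0::real..})" by simp
    then have BN: "B \<in> sets N" by (simp add: sets_N)
    have B: "B \<in> sets borel" "B \<subseteq> {0..}"
      using BR by (auto simp: sets_restrict_space)
    have pB: "(\<lambda>y. ennreal (p t x y) * indicator B y) \<in> borel_measurable borel"
    proof -
      have "(\<lambda>y. ennreal (indicator {0..} y * p t x y) * indicator B y) \<in> borel_measurable borel"
        using C0_extension_measurable[OF pc] B(1) by measurable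
      moreover have "ennreal (indicator {0..} y * p t x y) * indicator B y = ennreal (p t x y) * indicator B y" for y
        using B(2) by (auto simp: indicator_def)
      ultimately show ?thesis by simp
    qed
    have pB': "(\<lambda>y. ennreal (p t x y) * indicator B y) \<in> borel_measurable N"
      using pm BN by measurable
    have wm: "(\<lambda>y. ennreal (indicator {0..} y * (2 * w y))) \<in> borel_measurable lborel"
    proof -
      have "(\<lambda>y. indicator {0..} y * (2 * w y)) \<in> borel_measurable borel"
        by (rule C0_extension_measurable) (intro continuous_intros w_cont)
      then show ?thesis by (intro measurable_compose[OF _ measurable_ennreal]) simp
    qed
    have "emeasure (distr (P x) (restrict_space borel {0..}) (X t)) B = emeasure (P x) {\<omega>\<in>space (P x). X t \<omega> \<in> B}"
      using emeasure_distr[OF X_measurable_halfline[OF x] BR, of t] t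
      by (simp add: vimage_def Int_def conj_commute)
    also have "\<dots> = (\<integral>\<^sup>+y. ennreal (p t x y) * indicator B y \<partial>speed_measure b)"
      using p t x B by (simp add: transition_density_def)
    also have "\<dots> = (\<integral>\<^sup>+y. ennreal (indicator {0..} y * (2 * w y)) * (ennreal (p t x y) * indicator B y) \<partial>lborel)"
      unfolding speed_measure_def w[symmetric]
      by (rule nn_integral_density[OF wm]) (use pB in simp)
    also have "\<dots> = (\<integral>\<^sup>+y. ennreal (2 * w y) * (ennreal (p t x y) * indicator B y) * indicator {0..} y \<partial>lborel)"
      by (rule nn_integral_cong) (auto simp: indicator_def)
    also have "\<dots> = (\<integral>\<^sup>+y. ennreal (2 * w y) * (ennreal (p t x y) * indicator B y) \<partial>restrict_space lborel {0..})"
      by (subst nn_integral_restrict_space) auto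
    also have "\<dots> = (\<integral>\<^sup>+y. ennreal (p t x y) * indicator B y \<partial>N)"
      unfolding N_def by (rule nn_integral_density[symmetric]) (use pB' measurable_N_eq in \<open>auto simp: measurable_N_eq[symmetric]\<close>)
    also have "\<dots> = emeasure (density N (\<lambda>y. ennreal (p t x y))) B"
      by (rule emeasure_density[symmetric]) (use pm BN in auto)
    finally show "emeasure (distr (P x) (restrict_space borel {0..}) (X t)) B
        = emeasure (density N (\<lambda>y. ennreal (p t x y))) B" .
  qed
qed

text \<open>The total mass is 1 because the paths stay in \<open>{0..}\<close>; the formula for the
  semigroup is a change of variables under the law of \<open>X t\<close>.\<close>

lemma (in speed_scale) transition_density_N:
  assumes X: "feller_process P X" and p: "transition_density b P X p"
    and w: "w = W b" and t: "t > 0" and x: "x \<ge> 0"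
  shows "integrable N (p t x)" "integral\<^sup>L N (p t x) = 1"
    "f \<in> C0 \<Longrightarrow> transition_op P X t f x = (\<integral>y. p t x y * f y \<partial>N)"
proof -
  interpret feller_process P X by fact
  interpret prob_space "P x" by (rule prob_space_P[OF x])
  note law = density_law[OF assms]
  have t0: "t \<ge> 0" using t by simp
  have nonneg: "p t x y \<ge> 0" if "y \<ge> 0" for y using p t x that by (simp add: transition_density_def)
  have "(\<integral>\<^sup>+y. ennreal (p t x y) \<partial>N) = emeasure (density N (\<lambda>y. ennreal (p t x y))) (space N)"
    using law(2) sets.top[of N] by (subst emeasure_density) (auto intro!: nn_integral_cong)
  also have "\<dots> = emeasure (distr (P x) (restrict_space borel {0..}) (X t)) {0..}"
    by (simp add: law(1))
  also have "\<dots> = emeasure (P x) (space (P x))"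
  proof -
    have "X t -` {0..} \<inter> space (P x) = space (P x)" using X_nonneg[OF x t0] by auto
    moreover have "{0..} \<in> sets (restrict_space borel {0::real..})"
      by (auto simp: sets_restrict_space intro!: image_eqI[of _ _ UNIV])
    ultimately show ?thesis using emeasure_distr[OF X_measurable_halfline[OF x t0]] by simp
  qed
  finally have one: "(\<integral>\<^sup>+y. ennreal (p t x y) \<partial>N) = ennreal 1" by (simp add: emeasure_space_1)
  show int: "integrable N (p t x)"
    by (rule integrableI_nn_integral_finite[OF law(2) _ one]) (auto intro!: AE_I2 nonneg)
  show "integral\<^sup>L N (p t x) = 1"
  proof -
    have "AE y in N. 0 \<le> p t x y" by (intro AE_I2 nonneg) simp
    from nn_integral_eq_integral[OF int this] integral_nonneg_AE[OF this] one show ?thesis by simp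
  qed
  show "transition_op P X t f x = (\<integral>y. p t x y * f y \<partial>N)" if f: "f \<in> C0"
  proof -
    have fm: "f \<in> borel_measurable (restrict_space borel {0..})"
      using f by (intro borel_measurable_continuous_on_restrict) (simp add: C0_def)
    then have fN: "f \<in> borel_measurable N" using f by (intro measurable_N) (simp add: C0_def)
    have "transition_op P X t f x = (\<integral>y. f y \<partial>distr (P x) (restrict_space borel {0..}) (X t))"
      unfolding transition_op_def by (rule integral_distr[OF X_measurable_halfline[OF x t0] fm, symmetric])
    also have "\<dots> = (\<integral>y. f y \<partial>density N (\<lambda>y. ennreal (p t x y)))" by (simp add: law(1))
    also have "\<dots> = (\<integral>y. p t x y *\<^sub>R f y \<partial>N)"
      by (rule integral_density[OF fN law(2)]) (auto intro!: AE_I2 nonneg)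
    finally show ?thesis by simp
  qed
qed

theorem theorem1p3:
  fixes b \<epsilon> \<eta> :: "real \<Rightarrow> real" and A :: real
    and P :: "real \<Rightarrow> 'w measure" and X :: "real \<Rightarrow> 'w \<Rightarrow> real"
    and p :: "real \<Rightarrow> real \<Rightarrow> real \<Rightarrow> real"
  assumes "L1_loc b"
    and "\<And>x. x \<ge> 1 \<Longrightarrow> b x = (- 1 + \<epsilon> x) / x + \<eta> x"
    and "(\<epsilon> \<longlongrightarrow> 0) at_top"
    and "L1_loc \<eta>"
    and "((\<lambda>x::real. LINT u=1..x|lebesgue. \<eta> u) \<longlongrightarrow> A) at_top"
    and "reflecting_diffusion b P X"
    and "transition_density b P X p"
    and "filterlim (speed b) at_top at_top"
  shows "\<forall>x\<ge>0. \<forall>y\<ge>0. (\<lambda>t. p t x y) \<sim>[at_top] (\<lambda>t. 1 / speed b (sqrt t))"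
proof (intro allI impI)
  fix x y :: real assume x: "x \<ge> 0" and y: "y \<ge> 0"
  have diffusion: "continuous_markov_process P X" "feller P X"
    and gen: "\<And>f g. generator P X f g \<longleftrightarrow> f \<in> C0 \<and> g \<in> C0 \<and> reflecting_L b f g"
    using assms(6) unfolding reflecting_diffusion_def by blast+
  interpret potter_weight "W b" "scale b" "speed b" "Lyapunov b"
  proof (intro potter_weight.intro potter_weight_axioms.intro)
    show ss: "speed_scale (W b) (scale b) (speed b) (Lyapunov b)"
      by (rule speed_scale_W[OF assms(1,8)])
  qed (rule W_potter[OF assms(1-5)])
  interpret feller_process P X
    by unfold_locales (fact diffusion)+
  note density = transition_density_N[OF feller_process_axioms assms(7) refl]
  interpret reflected_density "W b" "scale b" "speed b" "Lyapunov b" "transition_op P X" p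
  proof unfold_locales
    \<comment> \<open>The generator hypothesis is used in both directions: it puts the test
      functions into the domain, and it supplies fluxes for elements such as
      \<open>T t f\<close>.\<close>
    show "Lgraph f g \<longleftrightarrow> f \<in> C0 \<and> g \<in> C0 \<and>
        uniform_limit {0..} (\<lambda>t x. (transition_op P X t f x - f x) / t) g (at_right 0)" for f g
      using gen[of f g] reflecting_L_iff[OF speed_scale_axioms, of f g]
      by (simp add: generator_def)
    show "0 \<le> p t x y" if "0 < t" "0 \<le> x" "0 \<le> y" for t x y
      using assms(7) that by (simp add: transition_density_def)
    show "continuous_on ({0..} \<times> {0..}) (\<lambda>(x, y). p t x y)" if "0 < t" for t
      using assms(7) that by (simp add: transition_density_def)
  qed (fact V_tendsto_top m_over_V_tendsto T_C0 T_lin T_le_const T_0 T_semigroup density)+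
  have "((\<lambda>t. p t x y * speed b (sqrt t)) \<longlongrightarrow> 1) at_top"
    by (rule p_asymptotics[OF \<rho>_top \<rho>_estimates V_over_square_top x y])
  then show "(\<lambda>t. p t x y) \<sim>[at_top] (\<lambda>t. 1 / speed b (sqrt t))"
    by (intro asymp_equivI') simp
qed

end
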